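(* Let $\mathfrak G_1$ and $\mathfrak G_2$ be two crossed modules of topological groupoids. Then $\mathfrak G_1$ and $\mathfrak G_2$ admit a crossed extension if and only if $\mathfrak G_1$ and $\mathfrak G_2$ are Morita equivalent.
   Context: **Groupoids and crossed modules.** In a topological groupoid $\mathcal G\rightrightarrows\mathcal G^0$ an arrow $g:x\to y$ has source $s(g)=x$, target $t(g)=y$; $gf$ is defined when $s(g)=t(f)$; units are identified with identity arrows. Strict morphisms of topological groupoids are continuous functors. A bundle of topological groups over $X$ is a topological groupoid $\mathcal H\rightrightarrows X$ with $s=t$; its fibre at $x$ is $\mathcal H^x$. An action by automorphisms of $\mathcal G\rightrightarrows X$ on $\mathcal H\to X$ assigns to each $g:x\to y$ an isomorphism of topological groups $\mathcal H^y\to\mathcal H^x$, $h\mapsto h^g$, continuous in $(h,g)$, with $h^{gf}=(h^g)^f$ and $h^{1_x}=h$. A crossed module of topological groupoids (groupoid crossed module) $\mathfrak G=(\mathcal H\xrightarrow{\partial}\mathcal G)$ with unit space $X$ consists of a topological groupoid $\mathcal G\rightrightarrows X$, a bundle of topological groups $\mathcal H\to X$, a strict morphism $\partial:\mathcal H\to\mathcal G$ that is the identity on $X$, and an action by automorphisms of $\mathcal G$ on $\mathcal H$ such that $\partial(h^g)=g^{-1}\partial(h)g$ for $h\in\mathcal H^{t(g)}$ and $k^{\partial(h)}=h^{-1}kh$ for $h,k$ in the same fibre. A strict morphism $\chi:\mathfrak G_1\to\mathfrak G_2$ is a pair of strict groupoid morphisms $\mathcal H_1\to\mathcal H_2$,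 $\mathcal G_1\to\mathcal G_2$ (both written $\chi$, inducing the same map on unit spaces) with $\chi\partial_1=\partial_2\chi$ and $\chi(h^g)=\chi(h)^{\chi(g)}$. **Pullbacks.** For $\sigma:Z\to\mathcal G^0$ continuous, $\mathcal G[Z]=\{(z_1,g,z_2)\in Z\times\mathcal G\times Z:\sigma(z_1)=t(g),\ s(g)=\sigma(z_2)\}$ is a groupoid over $Z$ with target $z_1$, source $z_2$, product $(z_1,g,z_2)(z_2,f,z_3)=(z_1,gf,z_3)$. Put $\mathcal H[Z]=\{(z,h)\in Z\times\mathcal H: h\in\mathcal H^{\sigma(z)}\}$. The pullback crossed module $\mathfrak G[Z]=\sigma^*\mathfrak G$ is $\sigma^*\partial:\mathcal H[Z]\to\mathcal G[Z]$, $(z,h)\mapsto(z,\partial(h),z)$, with action $(z_1,h)^{(z_1,g,z_2)}=(z_2,h^g)$. **Crossings and crossed extensions.** Let $\mathfrak G_i=(\mathcal H_i\xrightarrow{\partial_i}\mathcal G_i)$, $i=1,2$, have unit spaces $X_i$. A crossing from $\mathfrak G_1$ to $\mathfrak G_2$ is a topological groupoid $\mathcal M\rightrightarrows\mathcal M^0$ with continuous maps $X_1\xleftarrow{\tau}\mathcal M^0\xrightarrow{\sigma}X_2$ and strict morphisms, identity on $\mathcal M^0$, $\alpha_1:\mathcal H_1[\mathcal M^0]\to\mathcal M$, $\alpha_2:\mathcal M\to\mathcal G_1[\mathcal M^0]$, $\beta_1:\mathcal H_2[\mathcal M^0]\to\mathcal M$, $\beta_2:\mathcal M\to\mathcal G_2[\mathcal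 M^0]$ (pullbacks along $\tau$ for index 1, along $\sigma$ for index 2) such that: $\alpha_2\alpha_1=\tau^*\partial_1$ and $\beta_2\beta_1=\sigma^*\partial_2$; $\beta_2\alpha_1$ and $\alpha_2\beta_1$ take values in units; $\mathcal H_2[\mathcal M^0]\xrightarrow{\beta_1}\mathcal M\xrightarrow{\alpha_2}\mathcal G_1[\mathcal M^0]$ is an extension of topological groupoids ($\beta_1$ a homeomorphism onto its image, $\alpha_2$ surjective, image of $\beta_1$ equal to the kernel of $\alpha_2$); and $\alpha_1(h_1^{\alpha_2(m)})=m^{-1}\alpha_1(h_1)m$, $\beta_1(h_2^{\beta_2(m)})=m^{-1}\beta_1(h_2)m$ for all $m\in\mathcal M$ and $h_1,h_2$ in the fibres over $t(m)$. It is a crossed extension of $\mathfrak G_1$ and $\mathfrak G_2$ if in addition $\mathcal H_1[\mathcal M^0]\xrightarrow{\alpha_1}\mathcal M\xrightarrow{\beta_2}\mathcal G_2[\mathcal M^0]$ is an extension of topological groupoids. **2-groupoids and hypercovers.** A topological $2$-groupoid $\mathbf G$ is a strict $2$-category with all $1$- and $2$-arrows invertible, with topological spaces $\mathbf G^0,\mathbf G^1,\mathbf G^2$ of objects, $1$-arrows, $2$-arrows and all structure maps continuous ($s,t:\mathbf G^1\to\mathbf G^0$; $s_2,t_2:\mathbf G^2\to\mathbf G^1$). A strict homomorphism (continuous strict $2$-functor) $\phi:\mathbf G\to\mathbf H$ is a weak equivalence if: (WE1) $\mathbf G^0\times_{\phi,\mathbf H^0,t}\mathbf H^1\to\mathbf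 H^0$, $(x,\gamma)\mapsto s(\gamma)$, is surjective; (WE2) $\mathbf G^1\times_{\phi,\mathbf H^1,t_2}\mathbf H^2\to\mathbf H^1[\mathbf G^0]$, $(g,b)\mapsto(t(g),s_2(b),s(g))$, is surjective; (WE3) the square with $\phi:\mathbf G^2\to\mathbf H^2$, $(s_2,t_2)$ and $\phi\times\phi:\mathbf G^1\times\mathbf G^1\to\mathbf H^1\times\mathbf H^1$ is a pullback of topological spaces. The topological $2$-groupoid associated to $\mathfrak G=(\mathcal H\xrightarrow{\partial}\mathcal G)$ is $\mathcal H\rtimes\mathcal G\rightrightarrows\mathcal G\rightrightarrows\mathcal G^0$, with $\mathcal H\rtimes\mathcal G=\{(h,g):h\in\mathcal H^{t(g)}\}$, $s_2(h,g)=g$, $t_2(h,g)=\partial(h)g$, horizontal composition $(h_1,g_1)\star_h(h_2,g_2)=(h_1h_2^{g_1^{-1}},g_1g_2)$, and the vertical composite of $(h,g)$ followed by $(k,\partial(h)g)$ equal to $(kh,g)$. A strict morphism of crossed modules is a hypercover if the induced strict homomorphism of associated $2$-groupoids is a weak equivalence. **Morita equivalence.** $\mathfrak G_1$ and $\mathfrak G_2$ are Morita equivalent if there is a finite sequence of crossed modules $\tilde{\mathfrak G}_1=\mathfrak G_1,\tilde{\mathfrak G}_2,\dots,\tilde{\mathfrak G}_n=\mathfrak G_2$ and, for each $1\le i\le n-1$, a hypercover $\tilde{\mathfrak G}_i\to\tilde{\mathfrak G}_{i+1}$ or a hypercover $\tilde{\mathfrak G}_{i+1}\to\tilde{\mathfrak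 G}_i$.
   Formalization: The crossed extension must also have τ and σ meeting every orbit of the unit spaces (else the empty groupoid is a crossed extension of any two crossed modules); all spaces, including the intermediate crossed modules, have carriers in one arbitrary infinite set. *)

theory Defs
  imports "HOL-Analysis.Analysis"
begin

section \<open>Topological groupoids\<close>

text \<open>Spaces are abstract topologies, so carriers are subsets of types. The space of
  arrows carries the topology; units are included by \<open>idn\<close>, which is a topological embedding
  because \<open>src\<close> is a continuous left inverse. \<open>mult G g f\<close> is the product \<open>gf\<close>, defined if
  \<open>src G g = tgt G f\<close>.\<close>

record ('x, 'g) tgrpd =
  Obj :: "'x topology"
  Arr :: "'g topology"
  src :: "'g \<Rightarrow> 'x"
  tgt :: "'g \<Rightarrow> 'x"
  idn :: "'x \<Rightarrow> 'g"
  mult :: "'g \<Rightarrow> 'g \<Rightarrow> 'g"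
  inve :: "'g \<Rightarrow> 'g"

abbreviation obj :: "('x, 'g, 'm) tgrpd_scheme \<Rightarrow> 'x set" where
  "obj G \<equiv> topspace (Obj G)"

abbreviation arr :: "('x, 'g, 'm) tgrpd_scheme \<Rightarrow> 'g set" where
  "arr G \<equiv> topspace (Arr G)"

definition composable :: "('x, 'g) tgrpd \<Rightarrow> ('g \<times> 'g) set" where
  "composable G = {(g, f). g \<in> arr G \<and> f \<in> arr G \<and> src G g = tgt G f}"

definition units :: "('x, 'g) tgrpd \<Rightarrow> 'g set" where
  "units G = idn G ` obj G"

locale topological_groupoid =
  fixes G :: "('x, 'g) tgrpd"
  assumes continuous_src: "continuous_map (Arr G) (Obj G) (src G)"
    and continuous_tgt: "continuous_map (Arr G) (Obj G) (tgt G)"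
    and continuous_idn: "continuous_map (Obj G) (Arr G) (idn G)"
    and continuous_inve: "continuous_map (Arr G) (Arr G) (inve G)"
    and continuous_mult:
      "continuous_map (subtopology (prod_topology (Arr G) (Arr G)) (composable G)) (Arr G)
         (\<lambda>(g, f). mult G g f)"
    and src_idn: "x \<in> obj G \<Longrightarrow> src G (idn G x) = x"
    and tgt_idn: "x \<in> obj G \<Longrightarrow> tgt G (idn G x) = x"
    and src_mult: "(g, f) \<in> composable G \<Longrightarrow> src G (mult G g f) = src G f"
    and tgt_mult: "(g, f) \<in> composable G \<Longrightarrow> tgt G (mult G g f) = tgt G g"
    and mult_assoc: "(g, f) \<in> composable G \<Longrightarrow> (f, e) \<in> composable G \<Longrightarrow>
      mult G (mult G g f) e = mult G g (mult G f e)"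
    and mult_idn_left: "g \<in> arr G \<Longrightarrow> mult G (idn G (tgt G g)) g = g"
    and mult_idn_right: "g \<in> arr G \<Longrightarrow> mult G g (idn G (src G g)) = g"
    and src_inve: "g \<in> arr G \<Longrightarrow> src G (inve G g) = tgt G g"
    and tgt_inve: "g \<in> arr G \<Longrightarrow> tgt G (inve G g) = src G g"
    and mult_inve_left: "g \<in> arr G \<Longrightarrow> mult G (inve G g) g = idn G (src G g)"
    and mult_inve_right: "g \<in> arr G \<Longrightarrow> mult G g (inve G g) = idn G (tgt G g)"

definition strict_morphism ::
    "('x, 'g) tgrpd \<Rightarrow> ('y, 'h) tgrpd \<Rightarrow> ('x \<Rightarrow> 'y) \<Rightarrow> ('g \<Rightarrow> 'h) \<Rightarrow> bool" where
  "strict_morphism G H f0 f1 \<longleftrightarrow>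
     continuous_map (Obj G) (Obj H) f0 \<and> continuous_map (Arr G) (Arr H) f1 \<and>
     (\<forall>g\<in>arr G. src H (f1 g) = f0 (src G g) \<and> tgt H (f1 g) = f0 (tgt G g)) \<and>
     (\<forall>x\<in>obj G. f1 (idn G x) = idn H (f0 x)) \<and>
     (\<forall>(g, f)\<in>composable G. f1 (mult G g f) = mult H (f1 g) (f1 f))"

definition fibre :: "('x, 'h) tgrpd \<Rightarrow> 'x \<Rightarrow> 'h set" where
  "fibre H x = {h \<in> arr H. src H h = x}"

locale group_bundle = topological_groupoid H for H :: "('x, 'h) tgrpd" +
  assumes src_eq_tgt: "h \<in> arr H \<Longrightarrow> src H h = tgt H h"

section \<open>Crossed modules\<close>

text \<open>\<open>act h g\<close> is \<open>h\<close> to the power \<open>g\<close>, defined for \<open>h\<close> in the fibre at \<open>tgt G g\<close>; it is a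
  right action.\<close>

locale groupoid_action =
  fixes G :: "('x, 'g) tgrpd" and H :: "('x, 'h) tgrpd" and act :: "'h \<Rightarrow> 'g \<Rightarrow> 'h"
  assumes homeomorphic_act: "g \<in> arr G \<Longrightarrow>
      homeomorphic_map (subtopology (Arr H) (fibre H (tgt G g)))
        (subtopology (Arr H) (fibre H (src G g))) (\<lambda>h. act h g)"
    and act_mult: "g \<in> arr G \<Longrightarrow> h \<in> fibre H (tgt G g) \<Longrightarrow> k \<in> fibre H (tgt G g) \<Longrightarrow>
      act (mult H h k) g = mult H (act h g) (act k g)"
    and continuous_act:
      "continuous_map
         (subtopology (prod_topology (Arr H) (Arr G)) {(h, g). src H h = tgt G g}) (Arr H)
         (\<lambda>(h, g). act h g)"
    and act_comp: "(g, f) \<in> composable G \<Longrightarrow> h \<in> fibre H (tgt G g) \<Longrightarrow>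
      act h (mult G g f) = act (act h g) f"
    and act_idn: "x \<in> obj G \<Longrightarrow> h \<in> fibre H x \<Longrightarrow> act h (idn G x) = h"

record ('x, 'g, 'h) xmod =
  Grpd :: "('x, 'g) tgrpd"
  Bundle :: "('x, 'h) tgrpd"
  bdry :: "'h \<Rightarrow> 'g"
  act :: "'h \<Rightarrow> 'g \<Rightarrow> 'h"

locale crossed_module =
  fixes \<GG> :: "('x, 'g, 'h) xmod"
  assumes groupoid_Grpd: "topological_groupoid (Grpd \<GG>)"
    and bundle_Bundle: "group_bundle (Bundle \<GG>)"
    and same_units: "Obj (Bundle \<GG>) = Obj (Grpd \<GG>)"
    and bdry_morphism: "strict_morphism (Bundle \<GG>) (Grpd \<GG>) (\<lambda>x. x) (bdry \<GG>)"
    and action: "groupoid_action (Grpd \<GG>) (Bundle \<GG>) (act \<GG>)"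
    and bdry_act: "g \<in> arr (Grpd \<GG>) \<Longrightarrow> h \<in> fibre (Bundle \<GG>) (tgt (Grpd \<GG>) g) \<Longrightarrow>
      bdry \<GG> (act \<GG> h g) =
        mult (Grpd \<GG>) (mult (Grpd \<GG>) (inve (Grpd \<GG>) g) (bdry \<GG> h)) g"
    and peiffer: "h \<in> fibre (Bundle \<GG>) x \<Longrightarrow> k \<in> fibre (Bundle \<GG>) x \<Longrightarrow>
      act \<GG> k (bdry \<GG> h) =
        mult (Bundle \<GG>) (mult (Bundle \<GG>) (inve (Bundle \<GG>) h) k) h"

definition strict_xmod_morphism ::
    "('x, 'g, 'h) xmod \<Rightarrow> ('y, 'k, 'l) xmod \<Rightarrow>
     ('x \<Rightarrow> 'y) \<Rightarrow> ('g \<Rightarrow> 'k) \<Rightarrow> ('h \<Rightarrow> 'l) \<Rightarrow> bool" where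
  "strict_xmod_morphism \<GG>1 \<GG>2 \<chi>0 \<chi>G \<chi>H \<longleftrightarrow>
     strict_morphism (Grpd \<GG>1) (Grpd \<GG>2) \<chi>0 \<chi>G \<and>
     strict_morphism (Bundle \<GG>1) (Bundle \<GG>2) \<chi>0 \<chi>H \<and>
     (\<forall>h\<in>arr (Bundle \<GG>1). \<chi>G (bdry \<GG>1 h) = bdry \<GG>2 (\<chi>H h)) \<and>
     (\<forall>g\<in>arr (Grpd \<GG>1). \<forall>h\<in>fibre (Bundle \<GG>1) (tgt (Grpd \<GG>1) g).
        \<chi>H (act \<GG>1 h g) = act \<GG>2 (\<chi>H h) (\<chi>G g))"

section \<open>Pullbacks\<close>

text \<open>An arrow \<open>(z1, g, z2)\<close> of a pullback groupoid has target \<open>z1\<close> and source \<open>z2\<close>.\<close>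

definition pullback_grpd ::
    "'z topology \<Rightarrow> ('z \<Rightarrow> 'x) \<Rightarrow> ('x, 'g) tgrpd \<Rightarrow> ('z, 'z \<times> 'g \<times> 'z) tgrpd" where
  "pullback_grpd Z \<sigma> G =
     \<lparr> Obj = Z,
       Arr = subtopology (prod_topology Z (prod_topology (Arr G) Z))
               {(z1, g, z2). \<sigma> z1 = tgt G g \<and> src G g = \<sigma> z2},
       src = (\<lambda>(z1, g, z2). z2),
       tgt = (\<lambda>(z1, g, z2). z1),
       idn = (\<lambda>z. (z, idn G (\<sigma> z), z)),
       mult = (\<lambda>(z1, g, _) (_, f, z3). (z1, mult G g f, z3)),
       inve = (\<lambda>(z1, g, z2). (z2, inve G g, z1)) \<rparr>"

definition pullback_bundle ::
    "'z topology \<Rightarrow> ('z \<Rightarrow> 'x) \<Rightarrow> ('x, 'h) tgrpd \<Rightarrow> ('z, 'z \<times> 'h) tgrpd" where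
  "pullback_bundle Z \<sigma> H =
     \<lparr> Obj = Z,
       Arr = subtopology (prod_topology Z (Arr H)) {(z, h). h \<in> fibre H (\<sigma> z)},
       src = fst,
       tgt = fst,
       idn = (\<lambda>z. (z, idn H (\<sigma> z))),
       mult = (\<lambda>(z, h) (_, k). (z, mult H h k)),
       inve = (\<lambda>(z, h). (z, inve H h)) \<rparr>"

definition pullback_xmod ::
    "'z topology \<Rightarrow> ('z \<Rightarrow> 'x) \<Rightarrow> ('x, 'g, 'h) xmod \<Rightarrow> ('z, 'z \<times> 'g \<times> 'z, 'z \<times> 'h) xmod" where
  "pullback_xmod Z \<sigma> \<GG> =
     \<lparr> Grpd = pullback_grpd Z \<sigma> (Grpd \<GG>),
       Bundle = pullback_bundle Z \<sigma> (Bundle \<GG>),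
       bdry = (\<lambda>(z, h). (z, bdry \<GG> h, z)),
       act = (\<lambda>(_, h) (_, g, z2). (z2, act \<GG> h g)) \<rparr>"

section \<open>Crossings and crossed extensions\<close>

definition groupoid_extension ::
    "('z, 'k) tgrpd \<Rightarrow> ('k \<Rightarrow> 'm) \<Rightarrow> ('z, 'm) tgrpd \<Rightarrow> ('m \<Rightarrow> 'q) \<Rightarrow> ('z, 'q) tgrpd \<Rightarrow> bool" where
  "groupoid_extension K i M p Q \<longleftrightarrow>
     embedding_map (Arr K) (Arr M) i \<and>
     p ` arr M = arr Q \<and>
     i ` arr K = {m \<in> arr M. p m \<in> units Q}"

definition crossing ::
    "('x1, 'g1, 'h1) xmod \<Rightarrow> ('x2, 'g2, 'h2) xmod \<Rightarrow> ('z, 'm) tgrpd \<Rightarrow>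
     ('z \<Rightarrow> 'x1) \<Rightarrow> ('z \<Rightarrow> 'x2) \<Rightarrow>
     ('z \<times> 'h1 \<Rightarrow> 'm) \<Rightarrow> ('m \<Rightarrow> 'z \<times> 'g1 \<times> 'z) \<Rightarrow>
     ('z \<times> 'h2 \<Rightarrow> 'm) \<Rightarrow> ('m \<Rightarrow> 'z \<times> 'g2 \<times> 'z) \<Rightarrow> bool" where
  "crossing \<GG>1 \<GG>2 M \<tau> \<sigma> \<alpha>1 \<alpha>2 \<beta>1 \<beta>2 \<longleftrightarrow>
     (let \<PP>1 = pullback_xmod (Obj M) \<tau> \<GG>1; \<PP>2 = pullback_xmod (Obj M) \<sigma> \<GG>2 in
      topological_groupoid M \<and>
      continuous_map (Obj M) (Obj (Grpd \<GG>1)) \<tau> \<and>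
      continuous_map (Obj M) (Obj (Grpd \<GG>2)) \<sigma> \<and>
      strict_morphism (Bundle \<PP>1) M (\<lambda>z. z) \<alpha>1 \<and>
      strict_morphism M (Grpd \<PP>1) (\<lambda>z. z) \<alpha>2 \<and>
      strict_morphism (Bundle \<PP>2) M (\<lambda>z. z) \<beta>1 \<and>
      strict_morphism M (Grpd \<PP>2) (\<lambda>z. z) \<beta>2 \<and>
      (\<forall>h\<in>arr (Bundle \<PP>1). \<alpha>2 (\<alpha>1 h) = bdry \<PP>1 h) \<and>
      (\<forall>h\<in>arr (Bundle \<PP>2). \<beta>2 (\<beta>1 h) = bdry \<PP>2 h) \<and>
      (\<forall>h\<in>arr (Bundle \<PP>1). \<beta>2 (\<alpha>1 h) \<in> units (Grpd \<PP>2)) \<and>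
      (\<forall>h\<in>arr (Bundle \<PP>2). \<alpha>2 (\<beta>1 h) \<in> units (Grpd \<PP>1)) \<and>
      groupoid_extension (Bundle \<PP>2) \<beta>1 M \<alpha>2 (Grpd \<PP>1) \<and>
      (\<forall>m\<in>arr M. \<forall>h\<in>fibre (Bundle \<PP>1) (tgt M m).
         \<alpha>1 (act \<PP>1 h (\<alpha>2 m)) = mult M (mult M (inve M m) (\<alpha>1 h)) m) \<and>
      (\<forall>m\<in>arr M. \<forall>h\<in>fibre (Bundle \<PP>2) (tgt M m).
         \<beta>1 (act \<PP>2 h (\<beta>2 m)) = mult M (mult M (inve M m) (\<beta>1 h)) m))"

definition crossed_extension ::
    "('x1, 'g1, 'h1) xmod \<Rightarrow> ('x2, 'g2, 'h2) xmod \<Rightarrow> ('z, 'm) tgrpd \<Rightarrow>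
     ('z \<Rightarrow> 'x1) \<Rightarrow> ('z \<Rightarrow> 'x2) \<Rightarrow>
     ('z \<times> 'h1 \<Rightarrow> 'm) \<Rightarrow> ('m \<Rightarrow> 'z \<times> 'g1 \<times> 'z) \<Rightarrow>
     ('z \<times> 'h2 \<Rightarrow> 'm) \<Rightarrow> ('m \<Rightarrow> 'z \<times> 'g2 \<times> 'z) \<Rightarrow> bool" where
  "crossed_extension \<GG>1 \<GG>2 M \<tau> \<sigma> \<alpha>1 \<alpha>2 \<beta>1 \<beta>2 \<longleftrightarrow>
     crossing \<GG>1 \<GG>2 M \<tau> \<sigma> \<alpha>1 \<alpha>2 \<beta>1 \<beta>2 \<and>
     groupoid_extension (pullback_bundle (Obj M) \<tau> (Bundle \<GG>1)) \<alpha>1 M \<beta>2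
       (pullback_grpd (Obj M) \<sigma> (Grpd \<GG>2))"

section \<open>Topological 2-groupoids\<close>

text \<open>The 1-arrows form the groupoid \<open>Hor\<close> over the objects, the 2-arrows form, under vertical
  composition, the groupoid \<open>Ver\<close> over the space of 1-arrows. Horizontal inverses of 2-arrows
  need no separate axiom: they are obtained continuously from the inverses in \<open>Hor\<close> and \<open>Ver\<close>.\<close>

record ('x, 'g, 'b) two_grpd =
  Hor :: "('x, 'g) tgrpd"
  Ver :: "('g, 'b) tgrpd"
  hcomp :: "'b \<Rightarrow> 'b \<Rightarrow> 'b"

definition src0 :: "('x, 'g, 'b) two_grpd \<Rightarrow> 'b \<Rightarrow> 'x" where
  "src0 A b = src (Hor A) (src (Ver A) b)"

definition tgt0 :: "('x, 'g, 'b) two_grpd \<Rightarrow> 'b \<Rightarrow> 'x" where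
  "tgt0 A b = tgt (Hor A) (src (Ver A) b)"

definition hcomposable :: "('x, 'g, 'b) two_grpd \<Rightarrow> ('b \<times> 'b) set" where
  "hcomposable A = {(b, a). b \<in> arr (Ver A) \<and> a \<in> arr (Ver A) \<and> src0 A b = tgt0 A a}"

locale topological_two_groupoid =
  fixes A :: "('x, 'g, 'b) two_grpd"
  assumes horizontal: "topological_groupoid (Hor A)"
    and vertical: "topological_groupoid (Ver A)"
    and Obj_Ver: "Obj (Ver A) = Arr (Hor A)"
    and parallel_src: "b \<in> arr (Ver A) \<Longrightarrow> src (Hor A) (tgt (Ver A) b) = src0 A b"
    and parallel_tgt: "b \<in> arr (Ver A) \<Longrightarrow> tgt (Hor A) (tgt (Ver A) b) = tgt0 A b"
    and continuous_hcomp: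
      "continuous_map (subtopology (prod_topology (Arr (Ver A)) (Arr (Ver A))) (hcomposable A))
         (Arr (Ver A)) (\<lambda>(b, a). hcomp A b a)"
    and src_hcomp: "(b, a) \<in> hcomposable A \<Longrightarrow>
      src (Ver A) (hcomp A b a) = mult (Hor A) (src (Ver A) b) (src (Ver A) a)"
    and tgt_hcomp: "(b, a) \<in> hcomposable A \<Longrightarrow>
      tgt (Ver A) (hcomp A b a) = mult (Hor A) (tgt (Ver A) b) (tgt (Ver A) a)"
    and hcomp_assoc: "(c, b) \<in> hcomposable A \<Longrightarrow> (b, a) \<in> hcomposable A \<Longrightarrow>
      hcomp A (hcomp A c b) a = hcomp A c (hcomp A b a)"
    and hcomp_idn_left: "b \<in> arr (Ver A) \<Longrightarrow>
      hcomp A (idn (Ver A) (idn (Hor A) (tgt0 A b))) b = b"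
    and hcomp_idn_right: "b \<in> arr (Ver A) \<Longrightarrow>
      hcomp A b (idn (Ver A) (idn (Hor A) (src0 A b))) = b"
    and hcomp_idn: "(g, f) \<in> composable (Hor A) \<Longrightarrow>
      hcomp A (idn (Ver A) g) (idn (Ver A) f) = idn (Ver A) (mult (Hor A) g f)"
    and interchange: "(b', b) \<in> composable (Ver A) \<Longrightarrow> (a', a) \<in> composable (Ver A) \<Longrightarrow>
      (b, a) \<in> hcomposable A \<Longrightarrow>
      hcomp A (mult (Ver A) b' b) (mult (Ver A) a' a) =
        mult (Ver A) (hcomp A b' a') (hcomp A b a)"

definition strict_two_functor ::
    "('x, 'g, 'b) two_grpd \<Rightarrow> ('y, 'h, 'c) two_grpd \<Rightarrow>
     ('x \<Rightarrow> 'y) \<Rightarrow> ('g \<Rightarrow> 'h) \<Rightarrow> ('b \<Rightarrow> 'c) \<Rightarrow> bool" where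
  "strict_two_functor A B \<phi>0 \<phi>1 \<phi>2 \<longleftrightarrow>
     strict_morphism (Hor A) (Hor B) \<phi>0 \<phi>1 \<and>
     strict_morphism (Ver A) (Ver B) \<phi>1 \<phi>2 \<and>
     (\<forall>(b, a)\<in>hcomposable A. \<phi>2 (hcomp A b a) = hcomp B (\<phi>2 b) (\<phi>2 a))"

definition essentially_surjective ::
    "'z topology \<Rightarrow> ('z \<Rightarrow> 'x) \<Rightarrow> ('x, 'g) tgrpd \<Rightarrow> bool" where
  "essentially_surjective Z \<sigma> G \<longleftrightarrow>
     (\<lambda>(z, \<gamma>). src G \<gamma>) ` {(z, \<gamma>). z \<in> topspace Z \<and> \<gamma> \<in> arr G \<and> \<sigma> z = tgt G \<gamma>} = obj G"

text \<open>In the last conjunct, the pullback property of the square formed by \<open>\<phi>2\<close> and the pairs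
  (source, target) says that the canonical map to the fibre product is a homeomorphism.\<close>

definition weak_equivalence ::
    "('x, 'g, 'b) two_grpd \<Rightarrow> ('y, 'h, 'c) two_grpd \<Rightarrow>
     ('x \<Rightarrow> 'y) \<Rightarrow> ('g \<Rightarrow> 'h) \<Rightarrow> ('b \<Rightarrow> 'c) \<Rightarrow> bool" where
  "weak_equivalence A B \<phi>0 \<phi>1 \<phi>2 \<longleftrightarrow>
     topological_two_groupoid A \<and> topological_two_groupoid B \<and>
     strict_two_functor A B \<phi>0 \<phi>1 \<phi>2 \<and>
     essentially_surjective (Obj (Hor A)) \<phi>0 (Hor B) \<and>
     (\<lambda>(g, b). (tgt (Hor A) g, src (Ver B) b, src (Hor A) g)) `
         {(g, b). g \<in> arr (Hor A) \<and> b \<in> arr (Ver B) \<and> \<phi>1 g = tgt (Ver B) b}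
       = arr (pullback_grpd (Obj (Hor A)) \<phi>0 (Hor B)) \<and>
     homeomorphic_map (Arr (Ver A))
       (subtopology (prod_topology (Arr (Ver B)) (prod_topology (Arr (Hor A)) (Arr (Hor A))))
          {(b, g, g'). src (Ver B) b = \<phi>1 g \<and> tgt (Ver B) b = \<phi>1 g'})
       (\<lambda>a. (\<phi>2 a, src (Ver A) a, tgt (Ver A) a))"

section \<open>Hypercovers and Morita equivalence\<close>

definition assoc_two_grpd :: "('x, 'g, 'h) xmod \<Rightarrow> ('x, 'g, 'h \<times> 'g) two_grpd" where
  "assoc_two_grpd \<GG> =
     (let G = Grpd \<GG>; H = Bundle \<GG> in
      \<lparr> Hor = G,
        Ver =
          \<lparr> Obj = Arr G,
            Arr = subtopology (prod_topology (Arr H) (Arr G)) {(h, g). h \<in> fibre H (tgt G g)},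
            src = snd,
            tgt = (\<lambda>(h, g). mult G (bdry \<GG> h) g),
            idn = (\<lambda>g. (idn H (tgt G g), g)),
            mult = (\<lambda>(k, _) (h, g). (mult H k h, g)),
            inve = (\<lambda>(h, g). (inve H h, mult G (bdry \<GG> h) g)) \<rparr>,
        hcomp = (\<lambda>(h1, g1) (h2, g2). (mult H h1 (act \<GG> h2 (inve G g1)), mult G g1 g2)) \<rparr>)"

definition hypercover ::
    "('x, 'g, 'h) xmod \<Rightarrow> ('y, 'k, 'l) xmod \<Rightarrow>
     ('x \<Rightarrow> 'y) \<Rightarrow> ('g \<Rightarrow> 'k) \<Rightarrow> ('h \<Rightarrow> 'l) \<Rightarrow> bool" where
  "hypercover \<GG>1 \<GG>2 \<chi>0 \<chi>G \<chi>H \<longleftrightarrow>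
     strict_xmod_morphism \<GG>1 \<GG>2 \<chi>0 \<chi>G \<chi>H \<and>
     weak_equivalence (assoc_two_grpd \<GG>1) (assoc_two_grpd \<GG>2) \<chi>0 \<chi>G (map_prod \<chi>H \<chi>G)"

definition morita_equivalent :: "('x, 'g, 'h) xmod \<Rightarrow> ('x, 'g, 'h) xmod \<Rightarrow> bool" where
  "morita_equivalent \<GG>1 \<GG>2 \<longleftrightarrow>
     (\<exists>\<GG>s. \<GG>s \<noteq> [] \<and> hd \<GG>s = \<GG>1 \<and> last \<GG>s = \<GG>2 \<and>
        (\<forall>\<GG>\<in>set \<GG>s. crossed_module \<GG>) \<and>
        (\<forall>i. Suc i < length \<GG>s \<longrightarrow>
           (\<exists>\<chi>0 \<chi>G \<chi>H. hypercover (\<GG>s ! i) (\<GG>s ! Suc i) \<chi>0 \<chi>G \<chi>H) \<or>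
           (\<exists>\<chi>0 \<chi>G \<chi>H. hypercover (\<GG>s ! Suc i) (\<GG>s ! i) \<chi>0 \<chi>G \<chi>H)))"

end

theory Submission
  imports "HOL-Algebra.Group" Defs
begin

text \<open>Neither side of the equivalence sees much of the topology of the unit spaces. Essential
  surjectivity and surjectivity on arrows are required pointwise, and the topological conditions,
  that an inclusion of bundles is an embedding and that the square of 2-arrows is a pullback of
  spaces, can be restricted to any set of objects. Both directions of the proof therefore work
  with one object in each orbit.

  From a crossed extension to Morita equivalence. Let \<open>M\<close> be a crossed extension of \<open>\<GG>1\<close> and \<open>\<GG>2\<close>,
  with projections \<open>\<alpha>2\<close> and \<open>\<beta>2\<close> to the pullbacks of the two groupoids. The kernel of \<open>\<beta>2\<close> is a copy
  of the bundle of \<open>\<GG>1\<close>, pulled back to the objects of \<open>M\<close>, on which \<open>M\<close> acts by conjugation through \<open>\<alpha>2\<close>; since \<open>\<alpha>2\<close> is trivial on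
  its own kernel, the two kernels commute (\<open>kernels_commute\<close>). Hence pairs of elements of
  the kernels, with \<open>(x, y) \<mapsto> xy\<close> as boundary and conjugation as action, form a crossed
  module over \<open>M\<close> (locale \<open>commuting_pair\<close>), and forgetting one component of the pairs maps it to
  \<open>\<GG>1\<close> and to \<open>\<GG>2\<close>. The pullback condition on 2-arrows, applied to identities, makes a hypercover
  injective on objects. So everything is first restricted to a set of objects of \<open>M\<close> with one
  element in each orbit; on such a set the maps to the objects of \<open>\<GG>1\<close> and \<open>\<GG>2\<close> are injective, and
  the two maps are hypercovers (\<open>span_of_hypercovers\<close>).

  From Morita equivalence to a crossed extension. A hypercover induces a bijection of orbits and,
  after conjugation with an arrow, a weak equivalence \<open>A \<rightarrow> B\<close> of crossed modules of topological
  groups between the isotropy at corresponding objects (\<open>hypercover_isotropy\<close>). Such a weak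
  equivalence yields a crossed extension of \<open>A\<close> and \<open>B\<close>, namely the semidirect product of the top
  group of \<open>B\<close> with the base of \<open>A\<close> (locale \<open>group_weq\<close>). Crossed extensions of groups can be
  reversed, and they can be composed: one takes the fibre product over the base of the middle
  crossed module and divides by the copy of its top group embedded in both factors (locale
  \<open>composition\<close>). Here it is essential to be working with groups, because quotient maps of groups
  are open and so products of them are quotient maps. Along the zigzag this gives a relation
  between the objects of \<open>\<GG>1\<close> and of \<open>\<GG>2\<close> that matches orbits and relates only objects whose
  isotropy crossed modules have a crossed extension (\<open>linking\<close>). Finally the
  extensions at one object from each orbit of \<open>\<GG>1\<close> are put side by side over a discrete unit space
  (\<open>linking_imp_crossed_extension\<close>); its projections are surjective because no arrow of \<open>\<GG>1\<close> or
  of \<open>\<GG>2\<close> joins two different chosen objects.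

  Every construction starts from pairs of points. An injection \<open>e\<close> of pairs into the given
  infinite type brings the results back into that type, and the topology is transported
  along \<open>e\<close> as a coinduced topology.\<close>

section \<open>Continuity and coinduced topologies\<close>

lemma continuous_map_binop:
  assumes "continuous_map (subtopology (prod_topology X Y) S) Z (\<lambda>(x, y). m x y)"
    and "continuous_map W X f" and "continuous_map W Y g"
    and "\<And>w. w \<in> topspace W \<Longrightarrow> (f w, g w) \<in> S"
  shows "continuous_map W Z (\<lambda>w. m (f w) (g w))"
proof -
  have "continuous_map W (subtopology (prod_topology X Y) S) (\<lambda>w. (f w, g w))"
    using assms by (auto simp: continuous_map_in_subtopology continuous_map_paired)
  from continuous_map_compose[OF this assms(1)] show ?thesis
    by (simp add: o_def)
qed

lemma continuous_map_apply:
  "continuous_map Y Z g \<Longrightarrow> continuous_map X Y f \<Longrightarrow> continuous_map X Z (\<lambda>x. g (f x))"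
  using continuous_map_compose[of X Y f Z g] by (simp add: o_def)

lemma continuous_map_ident: "continuous_map X X (\<lambda>x. x)"
  using continuous_map_id[of X] by (simp add: id_def)

lemma continuous_map_point: "continuous_map X Y f \<Longrightarrow> x \<in> topspace X \<Longrightarrow> f x \<in> topspace Y"
  using continuous_map_funspace by fastforce

lemma continuous_map_fst_apply:
  "continuous_map X (prod_topology Y Z) f \<Longrightarrow> continuous_map X Y (\<lambda>x. fst (f x))"
  using continuous_map_fst_of by (fastforce simp: o_def)

lemma continuous_map_snd_apply:
  "continuous_map X (prod_topology Y Z) f \<Longrightarrow> continuous_map X Z (\<lambda>x. snd (f x))"
  using continuous_map_snd_of by (fastforce simp: o_def)

lemma embedding_map_witness:
  assumes "continuous_map X Y f"
    and "continuous_map (subtopology Y (f ` topspace X)) X g"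
    and "\<And>x. x \<in> topspace X \<Longrightarrow> g (f x) = x"
  shows "embedding_map X Y f"
proof -
  have "homeomorphic_maps X (subtopology Y (f ` topspace X)) f g"
    unfolding homeomorphic_maps_def using assms
    by (auto simp: continuous_map_in_subtopology)
  then show ?thesis
    unfolding embedding_map_def using homeomorphic_map_maps by blast
qed

lemma embedding_map_inverse:
  assumes "embedding_map X Y f"
  shows "continuous_map X Y f" "inj_on f (topspace X)"
    "continuous_map (subtopology Y (f ` topspace X)) X (inv_into (topspace X) f)"
proof -
  have h: "homeomorphic_map X (subtopology Y (f ` topspace X)) f"
    using assms by (simp add: embedding_map_def)
  show inj: "inj_on f (topspace X)"
    using h by (simp add: homeomorphic_eq_everything_map)
  show c: "continuous_map X Y f"
    using h by (simp add: homeomorphic_eq_everything_map continuous_map_in_subtopology)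
  obtain g where g: "homeomorphic_maps X (subtopology Y (f ` topspace X)) f g"
    using h homeomorphic_map_maps by blast
  have "continuous_map (subtopology Y (f ` topspace X)) X g"
    using g by (simp add: homeomorphic_maps_def)
  moreover have "g y = inv_into (topspace X) f y"
    if "y \<in> topspace (subtopology Y (f ` topspace X))" for y
    using g that inj by (auto simp: homeomorphic_maps_def)
  ultimately show "continuous_map (subtopology Y (f ` topspace X)) X (inv_into (topspace X) f)"
    by (rule continuous_map_eq)
qed

lemma homeomorphic_map_witness:
  assumes "continuous_map X Y f" "continuous_map Y X g"
    and "\<And>x. x \<in> topspace X \<Longrightarrow> g (f x) = x" "\<And>y. y \<in> topspace Y \<Longrightarrow> f (g y) = y"
  shows "homeomorphic_map X Y f"
  using assms unfolding homeomorphic_map_maps homeomorphic_maps_def by blast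

lemma homeomorphic_map_inverse:
  assumes "homeomorphic_map X Y f"
  shows "continuous_map X Y f" "continuous_map Y X (inv_into (topspace X) f)"
    "x \<in> topspace X \<Longrightarrow> inv_into (topspace X) f (f x) = x"
    "y \<in> topspace Y \<Longrightarrow> f (inv_into (topspace X) f y) = y"
proof -
  have img: "f ` topspace X = topspace Y" and inj: "inj_on f (topspace X)"
    and c: "continuous_map X Y f"
    using assms by (simp_all add: homeomorphic_eq_everything_map)
  then show "continuous_map X Y f" "x \<in> topspace X \<Longrightarrow> inv_into (topspace X) f (f x) = x"
    "y \<in> topspace Y \<Longrightarrow> f (inv_into (topspace X) f y) = y"
    by (simp_all add: f_inv_into_f)
  have "embedding_map X Y f"
    unfolding embedding_map_def img using assms by simp
  from embedding_map_inverse(3)[OF this] show "continuous_map Y X (inv_into (topspace X) f)"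
    by (simp add: img)
qed

lemma open_map_prod:
  assumes f: "open_map X X' f" and g: "open_map Y Y' g"
  shows "open_map (prod_topology X Y) (prod_topology X' Y') (\<lambda>(x, y). (f x, g y))"
  unfolding open_map_def
proof (intro allI impI)
  fix W assume W: "openin (prod_topology X Y) W"
  show "openin (prod_topology X' Y') ((\<lambda>(x, y). (f x, g y)) ` W)"
    unfolding openin_prod_topology_alt
  proof (intro allI impI)
    fix a b assume "(a, b) \<in> (\<lambda>(x, y). (f x, g y)) ` W"
    then obtain x y where xy: "(x, y) \<in> W" "a = f x" "b = g y" by auto
    obtain U V where UV: "openin X U" "openin Y V" "x \<in> U" "y \<in> V" "U \<times> V \<subseteq> W"
      using W xy unfolding openin_prod_topology_alt by meson
    have "f ` U \<times> g ` V \<subseteq> (\<lambda>(x, y). (f x, g y)) ` W" using UV by force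
    then show "\<exists>U V. openin X' U \<and> openin Y' V \<and> a \<in> U \<and> b \<in> V \<and>
        U \<times> V \<subseteq> (\<lambda>(x, y). (f x, g y)) ` W"
      using UV xy f g
      by (intro exI[of _ "f ` U"] exI[of _ "g ` V"]) (simp add: open_map_def)
  qed
qed

definition coinduced :: "'a topology \<Rightarrow> ('a \<Rightarrow> 'b) \<Rightarrow> 'b topology" where
  "coinduced X f = topology (\<lambda>U. U \<subseteq> f ` topspace X \<and> openin X {x \<in> topspace X. f x \<in> U})"

lemma openin_coinduced:
  "openin (coinduced X f) U \<longleftrightarrow> U \<subseteq> f ` topspace X \<and> openin X {x \<in> topspace X. f x \<in> U}"
proof -
  have "istopology (\<lambda>U. U \<subseteq> f ` topspace X \<and> openin X {x \<in> topspace X. f x \<in> U})"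
    unfolding istopology_def
  proof (intro conjI allI impI)
    fix S T
    assume "S \<subseteq> f ` topspace X \<and> openin X {x \<in> topspace X. f x \<in> S}"
      "T \<subseteq> f ` topspace X \<and> openin X {x \<in> topspace X. f x \<in> T}"
    moreover have "{x \<in> topspace X. f x \<in> S \<inter> T} =
      {x \<in> topspace X. f x \<in> S} \<inter> {x \<in> topspace X. f x \<in> T}" by blast
    ultimately show "S \<inter> T \<subseteq> f ` topspace X" "openin X {x \<in> topspace X. f x \<in> S \<inter> T}"
      by (auto simp del: Int_iff)
  next
    fix \<K> assume K: "\<forall>K\<in>\<K>. K \<subseteq> f ` topspace X \<and> openin X {x \<in> topspace X. f x \<in> K}"
    then show "\<Union> \<K> \<subseteq> f ` topspace X" by blast
    have "{x \<in> topspace X. f x \<in> \<Union> \<K>} = (\<Union>K\<in>\<K>. {x \<in> topspace X. f x \<in> K})" by blast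
    then show "openin X {x \<in> topspace X. f x \<in> \<Union> \<K>}" using K by auto
  qed
  then show ?thesis unfolding coinduced_def by simp
qed

lemma topspace_coinduced [simp]: "topspace (coinduced X f) = f ` topspace X"
proof
  show "topspace (coinduced X f) \<subseteq> f ` topspace X"
    using openin_coinduced[of X f "topspace (coinduced X f)"] by simp
  have "{x \<in> topspace X. f x \<in> f ` topspace X} = topspace X" by blast
  then have "openin (coinduced X f) (f ` topspace X)"
    by (simp add: openin_coinduced)
  then show "f ` topspace X \<subseteq> topspace (coinduced X f)" by (rule openin_subset)
qed

lemma quotient_map_coinduced: "quotient_map X (coinduced X f) f"
  by (auto simp: quotient_map_def openin_coinduced)

lemma continuous_map_to_coinduced: "continuous_map X (coinduced X f) f"
  by (rule quotient_imp_continuous_map[OF quotient_map_coinduced])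

lemma continuous_map_from_coinduced:
  assumes "continuous_map X Y (\<lambda>x. g (f x))"
  shows "continuous_map (coinduced X f) Y g"
  using continuous_compose_quotient_map[OF quotient_map_coinduced] assms by (simp add: o_def)

text \<open>Coinducing along an injection only renames points; this is how spaces of pairs are moved
  into the ambient type.\<close>

lemma homeomorphic_map_coinduced:
  assumes "inj_on f (topspace X)"
  shows "homeomorphic_map X (coinduced X f) f"
  by (simp add: homeomorphic_map_def quotient_map_coinduced assms)

lemma continuous_map_decode:
  assumes "\<And>x. x \<in> topspace X \<Longrightarrow> d (f x) = x"
  shows "continuous_map (coinduced X f) X d"
proof (rule continuous_map_from_coinduced)
  show "continuous_map X X (\<lambda>x. d (f x))"
    by (rule continuous_map_eq[OF continuous_map_id]) (simp add: assms)
qed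

section \<open>Topological groups and their quotients\<close>

locale topological_group = group G for G :: "'a monoid" (structure) +
  fixes T :: "'a topology"
  assumes carrier_eq: "carrier G = topspace T"
    and continuous_mult_group: "continuous_map (prod_topology T T) T (\<lambda>(x, y). x \<otimes> y)"
    and continuous_inv_group: "continuous_map T T (m_inv G)"
begin

lemma continuous_mult_apply:
  "continuous_map X T f \<Longrightarrow> continuous_map X T g \<Longrightarrow> continuous_map X T (\<lambda>x. f x \<otimes> g x)"
  by (rule continuous_map_binop[where S = UNIV, OF _ _ _ UNIV_I])
    (simp_all add: continuous_mult_group)

lemma continuous_inv_apply: "continuous_map X T f \<Longrightarrow> continuous_map X T (\<lambda>x. inv (f x))"
  by (rule continuous_map_apply[OF continuous_inv_group])

lemma inv_mult_cancel: "x \<in> carrier G \<Longrightarrow> y \<in> carrier G \<Longrightarrow> inv x \<otimes> (x \<otimes> y) = y"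
  by (simp add: m_assoc[symmetric])

lemma mult_inv_cancel: "x \<in> carrier G \<Longrightarrow> y \<in> carrier G \<Longrightarrow> x \<otimes> (inv x \<otimes> y) = y"
  by (simp add: m_assoc[symmetric])

end

text \<open>Quotients are presented as images under a map \<open>f\<close> whose fibres are the cosets of a normal
  subgroup, instead of sets of cosets. In this way the points of the quotient may be chosen in any
  type that is large enough, and renaming a group along an injection is the special case of a
  trivial subgroup.\<close>

definition group_congruence :: "'a monoid \<Rightarrow> ('a \<Rightarrow> 'b) \<Rightarrow> bool" where
  "group_congruence G f \<longleftrightarrow>
     (\<forall>x\<in>carrier G. \<forall>x'\<in>carrier G. \<forall>y\<in>carrier G. f x = f x' \<longrightarrow>
        f (x \<otimes>\<^bsub>G\<^esub> y) = f (x' \<otimes>\<^bsub>G\<^esub> y) \<and> f (y \<otimes>\<^bsub>G\<^esub> x) = f (y \<otimes>\<^bsub>G\<^esub> x'))"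

lemma group_congruenceD:
  "group_congruence G f \<Longrightarrow> x \<in> carrier G \<Longrightarrow> x' \<in> carrier G \<Longrightarrow> y \<in> carrier G \<Longrightarrow> f x = f x' \<Longrightarrow>
    f (x \<otimes>\<^bsub>G\<^esub> y) = f (x' \<otimes>\<^bsub>G\<^esub> y) \<and> f (y \<otimes>\<^bsub>G\<^esub> x) = f (y \<otimes>\<^bsub>G\<^esub> x')"
  unfolding group_congruence_def by blast

lemma group_congruence_inj:
  assumes "inj_on f (carrier G)" shows "group_congruence G f"
  unfolding group_congruence_def
proof (intro ballI impI)
  fix x x' y assume "x \<in> carrier G" "x' \<in> carrier G" "f x = f x'"
  then have "x = x'" using assms by (simp add: inj_on_eq_iff)
  then show "f (x \<otimes>\<^bsub>G\<^esub> y) = f (x' \<otimes>\<^bsub>G\<^esub> y) \<and> f (y \<otimes>\<^bsub>G\<^esub> x) = f (y \<otimes>\<^bsub>G\<^esub> x')" by simp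
qed

definition image_group :: "'a monoid \<Rightarrow> ('a \<Rightarrow> 'b) \<Rightarrow> 'b monoid" where
  "image_group G f =
     \<lparr> carrier = f ` carrier G,
       monoid.mult = (\<lambda>x y. f (inv_into (carrier G) f x \<otimes>\<^bsub>G\<^esub> inv_into (carrier G) f y)),
       one = f \<one>\<^bsub>G\<^esub> \<rparr>"

lemma carrier_image_group: "carrier (image_group G f) = f ` carrier G"
  by (simp add: image_group_def)

text \<open>The saturation of an open set is a union of translates of it by the elements that \<open>f\<close>
  identifies with the unit, and translations are homeomorphisms.\<close>

lemma (in topological_group) open_map_group_congruence:
  assumes "group_congruence G f"
  shows "open_map T (coinduced T f) f"
  unfolding open_map_def
proof (intro allI impI)
  note cong = group_congruenceD[OF assms]
  fix U assume U: "openin T U"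
  then have sub: "U \<subseteq> carrier G" by (simp add: carrier_eq openin_subset)
  have "{x \<in> topspace T. f x \<in> f ` U} =
    (\<Union>n\<in>{n\<in>carrier G. f n = f \<one>}. {x \<in> topspace T. x \<otimes> n \<in> U})" (is "?L = ?R")
  proof (intro Set.set_eqI iffI)
    fix x assume "x \<in> ?L"
    then have "x \<in> topspace T" "f x \<in> f ` U" by simp_all
    then obtain u where u: "u \<in> U" "x \<in> carrier G" "f x = f u"
      unfolding carrier_eq by (elim imageE) simp
    then have uc: "u \<in> carrier G" using sub by blast
    have "f (inv x \<otimes> u) = f (inv x \<otimes> x)" using u uc cong[of u x "inv x"] by simp
    then have "f (inv x \<otimes> u) = f \<one>" using u by simp
    moreover have "x \<otimes> (inv x \<otimes> u) = u" using u uc by (simp add: mult_inv_cancel)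
    ultimately show "x \<in> ?R" using u uc unfolding carrier_eq[symmetric]
      by (intro UN_I[of "inv x \<otimes> u"]) simp_all
  next
    fix x assume "x \<in> ?R"
    then obtain n where n: "n \<in> carrier G" "f n = f \<one>" "x \<in> carrier G" "x \<otimes> n \<in> U"
      unfolding carrier_eq by (elim UN_E) auto
    then have "f (x \<otimes> n) = f x" using cong[of n \<one> x] by simp
    then show "x \<in> ?L" using n unfolding carrier_eq[symmetric]
      by (intro CollectI conjI image_eqI[of _ f "x \<otimes> n"]) simp_all
  qed
  moreover have "openin T {x \<in> topspace T. x \<otimes> n \<in> U}" if "n \<in> carrier G" for n
  proof -
    have "continuous_map T T (\<lambda>x. x \<otimes> n)"
      using that carrier_eq by (intro continuous_mult_apply) auto
    then show ?thesis using U by (rule openin_continuous_map_preimage)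
  qed
  ultimately show "openin (coinduced T f) (f ` U)"
    using sub unfolding openin_coinduced carrier_eq[symmetric] by (auto intro!: openin_Union)
qed

text \<open>A quotient map need not stay one when multiplied by itself, but an open one does. This is
  what makes the multiplication of the quotient continuous on the product of the quotient
  topologies.\<close>

lemma (in topological_group) image_group:
  assumes "group_congruence G f"
  shows "topological_group (image_group G f) (coinduced T f)"
    and "f \<in> hom G (image_group G f)"
    and "open_map T (coinduced T f) f"
proof -
  note cong = group_congruenceD[OF assms]
  let ?Q = "image_group G f"
  have mult: "f x \<otimes>\<^bsub>?Q\<^esub> f y = f (x \<otimes> y)" if "x \<in> carrier G" "y \<in> carrier G" for x y
  proof -
    let ?s = "inv_into (carrier G) f"
    have s: "?s (f x) \<in> carrier G" "?s (f y) \<in> carrier G" "f (?s (f x)) = f x" "f (?s (f y)) = f y"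
      using that by (simp_all add: inv_into_into f_inv_into_f)
    have "f (?s (f x) \<otimes> ?s (f y)) = f (x \<otimes> ?s (f y))"
      using cong[OF s(1) that(1) s(2) s(3)] by (rule conjunct1)
    also have "\<dots> = f (x \<otimes> y)"
      using cong[OF s(2) that(2) that(1) s(4)] by (rule conjunct2)
    finally have "f (?s (f x) \<otimes> ?s (f y)) = f (x \<otimes> y)" .
    then show ?thesis by (simp add: image_group_def)
  qed
  have carr: "carrier ?Q = f ` carrier G" and one: "\<one>\<^bsub>?Q\<^esub> = f \<one>"
    by (simp_all add: image_group_def)
  show hom: "f \<in> hom G ?Q"
    by (rule homI) (simp_all add: carr mult)
  interpret Q: group ?Q
  proof (rule groupI)
    show "\<one>\<^bsub>?Q\<^esub> \<in> carrier ?Q" by (simp add: carr one)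
  next
    fix x assume "x \<in> carrier ?Q"
    then obtain a where a: "a \<in> carrier G" "x = f a" by (auto simp: carr)
    then show "\<one>\<^bsub>?Q\<^esub> \<otimes>\<^bsub>?Q\<^esub> x = x" by (simp add: one mult)
    show "\<exists>y\<in>carrier ?Q. y \<otimes>\<^bsub>?Q\<^esub> x = \<one>\<^bsub>?Q\<^esub>"
      using a by (intro bexI[of _ "f (inv a)"]) (auto simp: mult one carr)
  qed (auto simp: carr mult m_assoc)
  have inv: "inv\<^bsub>?Q\<^esub> (f x) = f (inv x)" if "x \<in> carrier G" for x
    using that by (intro Q.inv_equality) (auto simp: mult one carr)
  show op: "open_map T (coinduced T f) f"
    by (rule open_map_group_congruence[OF assms])
  have q2: "quotient_map (prod_topology T T) (prod_topology (coinduced T f) (coinduced T f))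
      (\<lambda>(x, y). (f x, f y))"
  proof (rule continuous_open_imp_quotient_map)
    show "continuous_map (prod_topology T T) (prod_topology (coinduced T f) (coinduced T f))
      (\<lambda>(x, y). (f x, f y))"
      by (simp add: continuous_map_prod_top continuous_map_to_coinduced)
    show "open_map (prod_topology T T) (prod_topology (coinduced T f) (coinduced T f))
      (\<lambda>(x, y). (f x, f y))"
      by (rule open_map_prod[OF op op])
    show "(\<lambda>(x, y). (f x, f y)) ` topspace (prod_topology T T) =
      topspace (prod_topology (coinduced T f) (coinduced T f))"
      by auto
  qed
  show "topological_group ?Q (coinduced T f)"
  proof
    show "carrier ?Q = topspace (coinduced T f)" by (simp add: carr carrier_eq)
    have "continuous_map (prod_topology T T) (coinduced T f) (\<lambda>p. f (fst p \<otimes> snd p))"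
      by (intro continuous_map_apply[OF continuous_map_to_coinduced] continuous_mult_apply
          continuous_map_fst continuous_map_snd)
    then have "continuous_map (prod_topology T T) (coinduced T f)
        ((\<lambda>(x, y). x \<otimes>\<^bsub>?Q\<^esub> y) \<circ> (\<lambda>(x, y). (f x, f y)))"
      by (rule continuous_map_eq) (auto simp: mult carrier_eq)
    then show "continuous_map (prod_topology (coinduced T f) (coinduced T f)) (coinduced T f)
        (\<lambda>(x, y). x \<otimes>\<^bsub>?Q\<^esub> y)"
      by (rule continuous_compose_quotient_map[OF q2])
    show "continuous_map (coinduced T f) (coinduced T f) (m_inv ?Q)"
    proof (rule continuous_map_from_coinduced)
      have "continuous_map T (coinduced T f) (\<lambda>x. f (inv x))"
        by (intro continuous_map_apply[OF continuous_map_to_coinduced] continuous_inv_group)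
      then show "continuous_map T (coinduced T f) (\<lambda>x. inv\<^bsub>?Q\<^esub> f x)"
        by (rule continuous_map_eq) (simp add: inv carrier_eq)
    qed
  qed
qed

section \<open>Crossed modules of topological groups\<close>

record ('g, 'h) group_xmod =
  base :: "'g monoid"
  base_top :: "'g topology"
  top_grp :: "'h monoid"
  top_top :: "'h topology"
  bd :: "'h \<Rightarrow> 'g"
  ac :: "'h \<Rightarrow> 'g \<Rightarrow> 'h"

locale topological_group_xmod =
  fixes A :: "('g, 'h) group_xmod"
  assumes base_group: "topological_group (base A) (base_top A)"
    and top_group: "topological_group (top_grp A) (top_top A)"
    and bd_hom: "bd A \<in> hom (top_grp A) (base A)"
    and continuous_bd: "continuous_map (top_top A) (base_top A) (bd A)"
    and continuous_ac:
      "continuous_map (prod_topology (top_top A) (base_top A)) (top_top A) (\<lambda>(h, g). ac A h g)"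
    and ac_mult: "h \<in> carrier (top_grp A) \<Longrightarrow> k \<in> carrier (top_grp A) \<Longrightarrow> g \<in> carrier (base A) \<Longrightarrow>
      ac A (h \<otimes>\<^bsub>top_grp A\<^esub> k) g = ac A h g \<otimes>\<^bsub>top_grp A\<^esub> ac A k g"
    and ac_comp: "h \<in> carrier (top_grp A) \<Longrightarrow> g \<in> carrier (base A) \<Longrightarrow> f \<in> carrier (base A) \<Longrightarrow>
      ac A h (g \<otimes>\<^bsub>base A\<^esub> f) = ac A (ac A h g) f"
    and ac_one: "h \<in> carrier (top_grp A) \<Longrightarrow> ac A h \<one>\<^bsub>base A\<^esub> = h"
    and bd_ac: "h \<in> carrier (top_grp A) \<Longrightarrow> g \<in> carrier (base A) \<Longrightarrow>
      bd A (ac A h g) = inv\<^bsub>base A\<^esub> g \<otimes>\<^bsub>base A\<^esub> bd A h \<otimes>\<^bsub>base A\<^esub> g"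
    and ac_bd: "h \<in> carrier (top_grp A) \<Longrightarrow> k \<in> carrier (top_grp A) \<Longrightarrow>
      ac A k (bd A h) = inv\<^bsub>top_grp A\<^esub> h \<otimes>\<^bsub>top_grp A\<^esub> k \<otimes>\<^bsub>top_grp A\<^esub> h"
begin

sublocale B: topological_group "base A" "base_top A"
  by (rule base_group)

sublocale H: topological_group "top_grp A" "top_top A"
  by (rule top_group)

sublocale bd: group_hom "top_grp A" "base A" "bd A"
  by unfold_locales (rule bd_hom)

lemma continuous_ac_apply:
  "continuous_map X (top_top A) f \<Longrightarrow> continuous_map X (base_top A) g \<Longrightarrow>
    continuous_map X (top_top A) (\<lambda>x. ac A (f x) (g x))"
  by (rule continuous_map_binop[where S = UNIV, OF _ _ _ UNIV_I])
    (simp_all add: continuous_ac)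

lemma ac_closed [simp]:
  assumes "h \<in> carrier (top_grp A)" "g \<in> carrier (base A)"
  shows "ac A h g \<in> carrier (top_grp A)"
  using continuous_map_point[OF continuous_ac, of "(h, g)"] assms
  by (simp add: H.carrier_eq B.carrier_eq)

lemma ac_unit [simp]:
  assumes "g \<in> carrier (base A)"
  shows "ac A \<one>\<^bsub>top_grp A\<^esub> g = \<one>\<^bsub>top_grp A\<^esub>"
proof -
  have "ac A \<one>\<^bsub>top_grp A\<^esub> g \<otimes>\<^bsub>top_grp A\<^esub> ac A \<one>\<^bsub>top_grp A\<^esub> g = ac A \<one>\<^bsub>top_grp A\<^esub> g"
    using ac_mult[of "\<one>\<^bsub>top_grp A\<^esub>" "\<one>\<^bsub>top_grp A\<^esub>" g] assms by simp
  then show ?thesis using assms by (metis H.one_closed H.r_cancel_one ac_closed)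
qed

lemma ac_inv:
  assumes "h \<in> carrier (top_grp A)" "g \<in> carrier (base A)"
  shows "ac A (inv\<^bsub>top_grp A\<^esub> h) g = inv\<^bsub>top_grp A\<^esub> (ac A h g)"
proof -
  have "ac A (inv\<^bsub>top_grp A\<^esub> h) g \<otimes>\<^bsub>top_grp A\<^esub> ac A h g = \<one>\<^bsub>top_grp A\<^esub>"
    using ac_mult[of "inv\<^bsub>top_grp A\<^esub> h" h g] assms by simp
  then show ?thesis using assms H.inv_equality[of _ "ac A h g"] by simp
qed

end

text \<open>A crossed extension consists of two symmetric halves, each relating the extending group
  \<open>M\<close> to one of the two crossed modules; the only trace of the other one is \<open>K\<close>, the kernel of the
  projection to its base. Each half needs to be treated only once.\<close>

definition extension_side ::
    "('g, 'h) group_xmod \<Rightarrow> 'm monoid \<Rightarrow> 'm topology \<Rightarrow> 'm set \<Rightarrow> ('h \<Rightarrow> 'm) \<Rightarrow> ('m \<Rightarrow> 'g) \<Rightarrow> bool" where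
  "extension_side A M T K \<alpha> \<alpha>' \<longleftrightarrow>
     \<alpha> \<in> hom (top_grp A) M \<and> embedding_map (top_top A) T \<alpha> \<and> \<alpha> ` carrier (top_grp A) = K \<and>
     \<alpha>' \<in> hom M (base A) \<and> continuous_map T (base_top A) \<alpha>' \<and> \<alpha>' ` carrier M = carrier (base A) \<and>
     (\<forall>h\<in>carrier (top_grp A). \<alpha>' (\<alpha> h) = bd A h) \<and>
     (\<forall>m\<in>carrier M. \<forall>h\<in>carrier (top_grp A).
        \<alpha> (ac A h (\<alpha>' m)) = inv\<^bsub>M\<^esub> m \<otimes>\<^bsub>M\<^esub> \<alpha> h \<otimes>\<^bsub>M\<^esub> m)"

definition kernel_set :: "'m monoid \<Rightarrow> 'g monoid \<Rightarrow> ('m \<Rightarrow> 'g) \<Rightarrow> 'm set" where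
  "kernel_set M G f = {m \<in> carrier M. f m = \<one>\<^bsub>G\<^esub>}"

definition group_crossed_extension ::
    "('g, 'h) group_xmod \<Rightarrow> ('k, 'l) group_xmod \<Rightarrow> 'm monoid \<Rightarrow> 'm topology \<Rightarrow>
     ('h \<Rightarrow> 'm) \<Rightarrow> ('m \<Rightarrow> 'g) \<Rightarrow> ('l \<Rightarrow> 'm) \<Rightarrow> ('m \<Rightarrow> 'k) \<Rightarrow> bool" where
  "group_crossed_extension A B M T \<alpha> \<alpha>' \<beta> \<beta>' \<longleftrightarrow>
     topological_group M T \<and>
     extension_side A M T (kernel_set M (base B) \<beta>') \<alpha> \<alpha>' \<and>
     extension_side B M T (kernel_set M (base A) \<alpha>') \<beta> \<beta>'"

lemma group_crossed_extension_sym: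
  "group_crossed_extension A B M T \<alpha> \<alpha>' \<beta> \<beta>' \<Longrightarrow> group_crossed_extension B A M T \<beta> \<beta>' \<alpha> \<alpha>'"
  by (auto simp: group_crossed_extension_def)

text \<open>Transport of structure along \<open>f\<close>. It moves extending groups built from pairs
  into a prescribed type.\<close>

lemma extension_side_image:
  assumes M: "topological_group M T" and side: "extension_side A M T K \<alpha> \<alpha>'"
    and A: "topological_group_xmod A" and inj: "inj_on f (carrier M)"
  shows "extension_side A (image_group M f) (coinduced T f) (f ` K)
    (\<lambda>h. f (\<alpha> h)) (\<lambda>m. \<alpha>' (inv_into (carrier M) f m))"
proof -
  interpret M: topological_group M T by (rule M)
  interpret A: topological_group_xmod A by (rule A)
  have cong: "group_congruence M f"
    using inj by (rule group_congruence_inj)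
  interpret Q: topological_group "image_group M f" "coinduced T f"
    by (rule M.image_group(1)[OF cong])
  interpret f: group_hom M "image_group M f" f
    by unfold_locales (rule M.image_group(2)[OF cong])
  let ?d = "inv_into (carrier M) f"
  note carr = carrier_image_group[of M f]
  have d: "?d (f x) = x" if "x \<in> carrier M" for x using inj that by simp
  have s: "\<alpha> \<in> hom (top_grp A) M" "embedding_map (top_top A) T \<alpha>" "\<alpha> ` carrier (top_grp A) = K"
    "\<alpha>' \<in> hom M (base A)" "continuous_map T (base_top A) \<alpha>'" "\<alpha>' ` carrier M = carrier (base A)"
    "\<And>h. h \<in> carrier (top_grp A) \<Longrightarrow> \<alpha>' (\<alpha> h) = bd A h"
    "\<And>m h. m \<in> carrier M \<Longrightarrow> h \<in> carrier (top_grp A) \<Longrightarrow>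
      \<alpha> (ac A h (\<alpha>' m)) = inv\<^bsub>M\<^esub> m \<otimes>\<^bsub>M\<^esub> \<alpha> h \<otimes>\<^bsub>M\<^esub> m"
    using side unfolding extension_side_def by auto
  interpret \<alpha>: group_hom "top_grp A" M \<alpha> by unfold_locales (rule s)
  interpret \<alpha>': group_hom M "base A" \<alpha>' by unfold_locales (rule s)
  show ?thesis
    unfolding extension_side_def
  proof (intro conjI ballI)
    show "(\<lambda>h. f (\<alpha> h)) \<in> hom (top_grp A) (image_group M f)" by (rule homI) simp_all
    have "embedding_map T (coinduced T f) f"
      using homeomorphic_map_coinduced[of f T] inj
      by (simp add: embedding_map_def M.carrier_eq subtopology_superset)
    from embedding_map_compose[OF s(2) this]
    show "embedding_map (top_top A) (coinduced T f) (\<lambda>h. f (\<alpha> h))" by (simp add: o_def)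
    show "(\<lambda>h. f (\<alpha> h)) ` carrier (top_grp A) = f ` K"
      using s(3) by blast
    show "(\<lambda>m. \<alpha>' (?d m)) \<in> hom (image_group M f) (base A)"
    proof (rule homI)
      fix x y assume "x \<in> carrier (image_group M f)" "y \<in> carrier (image_group M f)"
      then obtain a b where ab: "a \<in> carrier M" "b \<in> carrier M" "x = f a" "y = f b"
        by (auto simp: carr)
      have "\<alpha>' (?d (f (a \<otimes>\<^bsub>M\<^esub> b))) = \<alpha>' (?d (f a)) \<otimes>\<^bsub>base A\<^esub> \<alpha>' (?d (f b))"
        using ab by (simp add: d del: f.hom_mult)
      then show "\<alpha>' (?d (x \<otimes>\<^bsub>image_group M f\<^esub> y)) = \<alpha>' (?d x) \<otimes>\<^bsub>base A\<^esub> \<alpha>' (?d y)"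
        using ab by simp
    qed (auto simp: carr d)
    show "continuous_map (coinduced T f) (base_top A) (\<lambda>m. \<alpha>' (?d m))"
      using s(5) by (rule continuous_map_apply)
        (rule continuous_map_decode, simp add: d M.carrier_eq[symmetric])
    show "(\<lambda>m. \<alpha>' (?d m)) ` carrier (image_group M f) = carrier (base A)"
      using s(6) by (simp add: carr image_image d)
    show "\<alpha>' (?d (f (\<alpha> h))) = bd A h" if "h \<in> carrier (top_grp A)" for h
      using that by (simp add: d s)
    show "f (\<alpha> (ac A h (\<alpha>' (?d m)))) =
        inv\<^bsub>image_group M f\<^esub> m \<otimes>\<^bsub>image_group M f\<^esub> f (\<alpha> h) \<otimes>\<^bsub>image_group M f\<^esub> m"
      if m: "m \<in> carrier (image_group M f)" and h: "h \<in> carrier (top_grp A)" for m h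
    proof -
      obtain a where a: "a \<in> carrier M" "m = f a" using m by (auto simp: carr)
      have "f (inv\<^bsub>M\<^esub> a \<otimes>\<^bsub>M\<^esub> \<alpha> h \<otimes>\<^bsub>M\<^esub> a) =
        inv\<^bsub>image_group M f\<^esub> f a \<otimes>\<^bsub>image_group M f\<^esub> f (\<alpha> h) \<otimes>\<^bsub>image_group M f\<^esub> f a"
        using a h by simp
      then show ?thesis using a h by (simp add: d s(8))
    qed
  qed
qed

lemma group_crossed_extension_image:
  assumes ext: "group_crossed_extension A B M T \<alpha> \<alpha>' \<beta> \<beta>'"
    and A: "topological_group_xmod A" and B: "topological_group_xmod B"
    and inj: "inj_on f (carrier M)"
  shows "group_crossed_extension A B (image_group M f) (coinduced T f)
    (\<lambda>h. f (\<alpha> h)) (\<lambda>m. \<alpha>' (inv_into (carrier M) f m))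
    (\<lambda>h. f (\<beta> h)) (\<lambda>m. \<beta>' (inv_into (carrier M) f m))"
proof -
  interpret M: topological_group M T using ext by (simp add: group_crossed_extension_def)
  have top: "topological_group (image_group M f) (coinduced T f)"
    using inj by (intro M.image_group group_congruence_inj)
  have ker: "kernel_set (image_group M f) G (\<lambda>m. \<gamma> (inv_into (carrier M) f m)) =
      f ` kernel_set M G \<gamma>" for G :: "'z monoid" and \<gamma>
    using inj by (auto simp: kernel_set_def carrier_image_group)
  show ?thesis
    unfolding group_crossed_extension_def ker
    using ext A B inj top M.topological_group_axioms
    by (auto simp: group_crossed_extension_def intro!: extension_side_image)
qed

section \<open>Crossed extensions from weak equivalences\<close>

text \<open>A weak equivalence of 2-groupoids, read for crossed modules of groups: every
  element of the base of \<open>B\<close> comes from the base of \<open>A\<close> up to a boundary, and the top group of \<open>A\<close> is,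
  as a space, the fibre product of the top group of \<open>B\<close> and the base of \<open>A\<close>.\<close>

definition group_weak_equivalence ::
    "('g, 'h) group_xmod \<Rightarrow> ('k, 'l) group_xmod \<Rightarrow> ('g \<Rightarrow> 'k) \<Rightarrow> ('h \<Rightarrow> 'l) \<Rightarrow> bool" where
  "group_weak_equivalence A B c d \<longleftrightarrow>
     c \<in> hom (base A) (base B) \<and> continuous_map (base_top A) (base_top B) c \<and>
     d \<in> hom (top_grp A) (top_grp B) \<and>
     (\<forall>k\<in>carrier (top_grp A). c (bd A k) = bd B (d k)) \<and>
     (\<forall>k\<in>carrier (top_grp A). \<forall>g\<in>carrier (base A). d (ac A k g) = ac B (d k) (c g)) \<and>
     (\<forall>g\<in>carrier (base B). \<exists>h\<in>carrier (top_grp B). \<exists>g'\<in>carrier (base A).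
        g = bd B h \<otimes>\<^bsub>base B\<^esub> c g') \<and>
     homeomorphic_map (top_top A)
       (subtopology (prod_topology (top_top B) (base_top A)) {(h, g). bd B h = c g})
       (\<lambda>k. (d k, bd A k))"

locale group_weq = A: topological_group_xmod A + B: topological_group_xmod B
  for A :: "('g, 'h) group_xmod" and B :: "('k, 'l) group_xmod" +
  fixes c :: "'g \<Rightarrow> 'k" and d :: "'h \<Rightarrow> 'l"
  assumes weq: "group_weak_equivalence A B c d"
begin

text \<open>The base of \<open>A\<close> acts on the top group of \<open>B\<close> through \<open>c\<close>. The semidirect product, with
  the product topology, extends \<open>A\<close> by \<open>B\<close>: it contains the top group of \<open>B\<close> with quotient the base
  of \<open>A\<close>, and it maps onto the base of \<open>B\<close> by \<open>(h, g) \<mapsto> \<partial>h c(g)\<close>, because the weak equivalence is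
  surjective up to boundaries. The kernel of this map consists of the \<open>(h, g)\<close> with
  \<open>\<partial>(h\<inverse>) = c(g)\<close>, which is the fibre product that the weak equivalence identifies with
  the top group of \<open>A\<close>. That explains the inverse in \<open>\<alpha>1\<close> below.\<close>

definition semidirect :: "('l \<times> 'g) monoid" where
  "semidirect =
     \<lparr> carrier = carrier (top_grp B) \<times> carrier (base A),
       monoid.mult = (\<lambda>(h, g) (h', g').
         (h \<otimes>\<^bsub>top_grp B\<^esub> ac B h' (inv\<^bsub>base B\<^esub> (c g)), g \<otimes>\<^bsub>base A\<^esub> g')),
       one = (\<one>\<^bsub>top_grp B\<^esub>, \<one>\<^bsub>base A\<^esub>) \<rparr>"

lemma semidirect_simps:
  "carrier semidirect = carrier (top_grp B) \<times> carrier (base A)"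
  "(h, g) \<otimes>\<^bsub>semidirect\<^esub> (h', g') =
     (h \<otimes>\<^bsub>top_grp B\<^esub> ac B h' (inv\<^bsub>base B\<^esub> (c g)), g \<otimes>\<^bsub>base A\<^esub> g')"
  "\<one>\<^bsub>semidirect\<^esub> = (\<one>\<^bsub>top_grp B\<^esub>, \<one>\<^bsub>base A\<^esub>)"
  by (simp_all add: semidirect_def)

lemma weqD:
  "c \<in> hom (base A) (base B)" "continuous_map (base_top A) (base_top B) c"
  "d \<in> hom (top_grp A) (top_grp B)"
  "\<And>k. k \<in> carrier (top_grp A) \<Longrightarrow> c (bd A k) = bd B (d k)"
  "\<And>k g. k \<in> carrier (top_grp A) \<Longrightarrow> g \<in> carrier (base A) \<Longrightarrow> d (ac A k g) = ac B (d k) (c g)"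
  "\<And>g. g \<in> carrier (base B) \<Longrightarrow> \<exists>h\<in>carrier (top_grp B). \<exists>g'\<in>carrier (base A).
        g = bd B h \<otimes>\<^bsub>base B\<^esub> c g'"
  "homeomorphic_map (top_top A)
       (subtopology (prod_topology (top_top B) (base_top A)) {(h, g). bd B h = c g})
       (\<lambda>k. (d k, bd A k))"
  using weq unfolding group_weak_equivalence_def by blast+

sublocale c: group_hom "base A" "base B" c
  by unfold_locales (rule weqD)

sublocale d: group_hom "top_grp A" "top_grp B" d
  by unfold_locales (rule weqD)

lemma group_semidirect: "group semidirect"
proof (rule groupI)
  fix x assume "x \<in> carrier semidirect"
  then obtain h g where x: "x = (h, g)" "h \<in> carrier (top_grp B)" "g \<in> carrier (base A)"
    by (auto simp: semidirect_simps)
  show "\<exists>y\<in>carrier semidirect. y \<otimes>\<^bsub>semidirect\<^esub> x = \<one>\<^bsub>semidirect\<^esub>"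
    by (rule bexI[of _ "(inv\<^bsub>top_grp B\<^esub> (ac B h (c g)), inv\<^bsub>base A\<^esub> g)"])
      (simp_all add: semidirect_simps x)
qed (auto simp: semidirect_simps B.ac_mult B.ac_one B.ac_comp[symmetric] A.B.m_assoc B.H.m_assoc
    B.B.inv_mult_group)

sublocale M: group semidirect
  by (rule group_semidirect)

lemma inv_semidirect:
  assumes "h \<in> carrier (top_grp B)" "g \<in> carrier (base A)"
  shows "inv\<^bsub>semidirect\<^esub> (h, g) = (inv\<^bsub>top_grp B\<^esub> (ac B h (c g)), inv\<^bsub>base A\<^esub> g)"
  by (rule M.inv_equality) (simp_all add: semidirect_simps assms)

abbreviation "semidirect_top \<equiv> prod_topology (top_top B) (base_top A)"

lemma continuous_c_apply:
  "continuous_map X (base_top A) f \<Longrightarrow> continuous_map X (base_top B) (\<lambda>x. c (f x))"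
  by (rule continuous_map_apply[OF weqD(2)])

lemma topological_group_semidirect: "topological_group semidirect semidirect_top"
proof
  show "carrier semidirect = topspace semidirect_top"
    by (simp add: semidirect_simps A.B.carrier_eq B.H.carrier_eq)
  have "continuous_map (prod_topology semidirect_top semidirect_top) semidirect_top
      (\<lambda>p. (fst (fst p) \<otimes>\<^bsub>top_grp B\<^esub> ac B (fst (snd p)) (inv\<^bsub>base B\<^esub> (c (snd (fst p)))),
        snd (fst p) \<otimes>\<^bsub>base A\<^esub> snd (snd p)))"
    by (rule continuous_map_pairedI B.H.continuous_mult_apply A.B.continuous_mult_apply
        B.continuous_ac_apply B.B.continuous_inv_apply continuous_c_apply
        continuous_map_fst_apply continuous_map_snd_apply continuous_map_ident)+
  then show "continuous_map (prod_topology semidirect_top semidirect_top) semidirect_top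
      (\<lambda>(x, y). x \<otimes>\<^bsub>semidirect\<^esub> y)"
    by (rule continuous_map_eq) (auto simp: semidirect_simps)
  have "continuous_map semidirect_top semidirect_top
      (\<lambda>p. (inv\<^bsub>top_grp B\<^esub> (ac B (fst p) (c (snd p))), inv\<^bsub>base A\<^esub> (snd p)))"
    by (intro continuous_map_pairedI B.H.continuous_inv_apply A.B.continuous_inv_apply
        B.continuous_ac_apply continuous_c_apply continuous_map_fst continuous_map_snd)
  then show "continuous_map semidirect_top semidirect_top (m_inv semidirect)"
    by (rule continuous_map_eq)
      (auto simp: inv_semidirect A.B.carrier_eq[symmetric] B.H.carrier_eq[symmetric])
qed

definition \<alpha>1 :: "'h \<Rightarrow> 'l \<times> 'g" where "\<alpha>1 k = (inv\<^bsub>top_grp B\<^esub> (d k), bd A k)"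
definition \<beta>1 :: "'l \<Rightarrow> 'l \<times> 'g" where "\<beta>1 h = (h, \<one>\<^bsub>base A\<^esub>)"
definition \<beta>2 :: "'l \<times> 'g \<Rightarrow> 'k" where "\<beta>2 m = bd B (fst m) \<otimes>\<^bsub>base B\<^esub> c (snd m)"

lemma conjugate_eqI:
  assumes "m \<in> carrier semidirect" "x \<in> carrier semidirect" "y \<in> carrier semidirect"
    and "m \<otimes>\<^bsub>semidirect\<^esub> x = y \<otimes>\<^bsub>semidirect\<^esub> m"
  shows "x = inv\<^bsub>semidirect\<^esub> m \<otimes>\<^bsub>semidirect\<^esub> y \<otimes>\<^bsub>semidirect\<^esub> m"
  using assms by (metis M.inv_closed M.inv_solve_left M.m_assoc M.m_closed)

lemma ac_inv_bd:
  assumes "h \<in> carrier (top_grp B)" "k \<in> carrier (top_grp B)"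
  shows "ac B h (inv\<^bsub>base B\<^esub> (bd B k)) = k \<otimes>\<^bsub>top_grp B\<^esub> h \<otimes>\<^bsub>top_grp B\<^esub> inv\<^bsub>top_grp B\<^esub> k"
  using B.ac_bd[of "inv\<^bsub>top_grp B\<^esub> k" h] assms by simp

lemma \<beta>2_hom: "\<beta>2 \<in> hom semidirect (base B)"
proof (rule homI)
  fix x y assume "x \<in> carrier semidirect" "y \<in> carrier semidirect"
  then obtain h g h' g' where xy: "x = (h, g)" "h \<in> carrier (top_grp B)" "g \<in> carrier (base A)"
    "y = (h', g')" "h' \<in> carrier (top_grp B)" "g' \<in> carrier (base A)"
    by (auto simp: semidirect_simps)
  then show "\<beta>2 (x \<otimes>\<^bsub>semidirect\<^esub> y) = \<beta>2 x \<otimes>\<^bsub>base B\<^esub> \<beta>2 y"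
    by (simp add: \<beta>2_def semidirect_simps B.bd_ac B.B.m_assoc B.B.inv_mult_cancel)
qed (auto simp: \<beta>2_def semidirect_simps)

lemma extension_side_source:
  "extension_side A semidirect semidirect_top (kernel_set semidirect (base B) \<beta>2) \<alpha>1 snd"
  unfolding extension_side_def
proof (intro conjI ballI)
  show "\<alpha>1 \<in> hom (top_grp A) semidirect"
    by (rule homI)
      (simp_all add: \<alpha>1_def semidirect_simps weqD(4) ac_inv_bd B.H.inv_mult_group B.H.m_assoc
        B.H.inv_mult_cancel B.H.mult_inv_cancel)
  show snd_hom: "snd \<in> hom semidirect (base A)"
    by (rule homI) (auto simp: semidirect_simps)
  show "continuous_map semidirect_top (base_top A) snd" by (rule continuous_map_snd)
  show "snd ` carrier semidirect = carrier (base A)"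
    using B.H.one_closed by (force simp: semidirect_simps)
  show "snd (\<alpha>1 h) = bd A h" for h by (simp add: \<alpha>1_def)
  show "\<alpha>1 (ac A k (snd m)) = inv\<^bsub>semidirect\<^esub> m \<otimes>\<^bsub>semidirect\<^esub> \<alpha>1 k \<otimes>\<^bsub>semidirect\<^esub> m"
    if m: "m \<in> carrier semidirect" and k: "k \<in> carrier (top_grp A)" for m k
  proof (rule conjugate_eqI)
    obtain h g where hg: "m = (h, g)" "h \<in> carrier (top_grp B)" "g \<in> carrier (base A)"
      using m by (auto simp: semidirect_simps)
    have "ac B (inv\<^bsub>top_grp B\<^esub> ac B (d k) (c g)) (inv\<^bsub>base B\<^esub> c g) = inv\<^bsub>top_grp B\<^esub> d k"
      using k hg by (simp add: B.ac_inv[symmetric] B.ac_comp[symmetric] B.ac_one)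
    then show "m \<otimes>\<^bsub>semidirect\<^esub> \<alpha>1 (ac A k (snd m)) = \<alpha>1 k \<otimes>\<^bsub>semidirect\<^esub> m"
      using k hg
      by (simp add: \<alpha>1_def semidirect_simps weqD(4,5) A.bd_ac ac_inv_bd A.B.m_assoc B.H.m_assoc
          B.H.inv_mult_cancel A.B.mult_inv_cancel)
  qed (use m k in \<open>auto simp: \<alpha>1_def semidirect_simps\<close>)
  \<comment> \<open>\<open>e\<close> recovers an element of the top group of \<open>A\<close> from a point of the fibre product.\<close>
  note homeo = homeomorphic_map_inverse[OF weqD(7)]
  define e where "e = inv_into (topspace (top_top A)) (\<lambda>k. (d k, bd A k))"
  note e = homeo(1) homeo(2)[folded e_def] homeo(3)[folded e_def A.H.carrier_eq]
    homeo(4)[folded e_def]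
  have cd: "continuous_map (top_top A) (top_top B) d"
    using e(1) by (simp add: continuous_map_in_subtopology continuous_map_paired)
  have carr: "topspace semidirect_top = carrier (top_grp B) \<times> carrier (base A)"
    by (simp add: A.B.carrier_eq B.H.carrier_eq)
  have ker: "kernel_set semidirect (base B) \<beta>2 =
    {(h, g). h \<in> carrier (top_grp B) \<and> g \<in> carrier (base A) \<and> bd B (inv\<^bsub>top_grp B\<^esub> h) = c g}"
  proof -
    have "bd B h \<otimes>\<^bsub>base B\<^esub> c g = \<one>\<^bsub>base B\<^esub> \<longleftrightarrow> bd B (inv\<^bsub>top_grp B\<^esub> h) = c g"
      if "h \<in> carrier (top_grp B)" "g \<in> carrier (base A)" for h g
    proof -
      have "bd B h \<otimes>\<^bsub>base B\<^esub> c g = \<one>\<^bsub>base B\<^esub> \<longleftrightarrow> inv\<^bsub>base B\<^esub> (c g) = bd B h"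
        using that B.B.inv_equality[of "bd B h" "c g"] B.B.l_inv[of "c g"]
        by (metis c.hom_closed B.bd.hom_closed)
      also have "\<dots> \<longleftrightarrow> c g = inv\<^bsub>base B\<^esub> (bd B h)"
        using that by (metis B.B.inv_inv c.hom_closed B.bd.hom_closed)
      finally show ?thesis using that by auto
    qed
    then show ?thesis by (auto simp: kernel_set_def semidirect_simps \<beta>2_def)
  qed
  show img: "\<alpha>1 ` carrier (top_grp A) = kernel_set semidirect (base B) \<beta>2"
  proof
    show "\<alpha>1 ` carrier (top_grp A) \<subseteq> kernel_set semidirect (base B) \<beta>2"
      by (auto simp: ker \<alpha>1_def weqD(4))
    show "kernel_set semidirect (base B) \<beta>2 \<subseteq> \<alpha>1 ` carrier (top_grp A)"
    proof
      fix m assume "m \<in> kernel_set semidirect (base B) \<beta>2"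
      then obtain h g where hg: "m = (h, g)" "h \<in> carrier (top_grp B)" "g \<in> carrier (base A)"
        "bd B (inv\<^bsub>top_grp B\<^esub> h) = c g" by (auto simp: ker)
      let ?y = "(inv\<^bsub>top_grp B\<^esub> h, g)"
      have y: "?y \<in> topspace (subtopology semidirect_top {(h, g). bd B h = c g})"
        using hg carr by simp
      then have "e ?y \<in> carrier (top_grp A)"
        using continuous_map_point[OF e(2)] by (simp add: A.H.carrier_eq)
      moreover have "d (e ?y) = inv\<^bsub>top_grp B\<^esub> h" "bd A (e ?y) = g" using e(4)[OF y] by simp_all
      ultimately show "m \<in> \<alpha>1 ` carrier (top_grp A)"
        using hg by (intro image_eqI[of _ _ "e ?y"]) (simp_all add: \<alpha>1_def)
    qed
  qed
  show "embedding_map (top_top A) semidirect_top \<alpha>1"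
  proof (rule embedding_map_witness)
    show "continuous_map (top_top A) semidirect_top \<alpha>1"
      unfolding \<alpha>1_def
      by (intro continuous_map_pairedI B.H.continuous_inv_apply cd A.continuous_bd)
    show "e (inv\<^bsub>top_grp B\<^esub> (fst (\<alpha>1 x)), snd (\<alpha>1 x)) = x" if "x \<in> topspace (top_top A)" for x
      using that by (simp add: \<alpha>1_def A.H.carrier_eq[symmetric] e(3))
    have "continuous_map (subtopology semidirect_top (\<alpha>1 ` topspace (top_top A)))
      (subtopology semidirect_top {(h, g). bd B h = c g}) (\<lambda>m. (inv\<^bsub>top_grp B\<^esub> (fst m), snd m))"
      unfolding continuous_map_in_subtopology
    proof
      show "continuous_map (subtopology semidirect_top (\<alpha>1 ` topspace (top_top A))) semidirect_top
        (\<lambda>m. (inv\<^bsub>top_grp B\<^esub> (fst m), snd m))"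
        by (intro continuous_map_pairedI B.H.continuous_inv_apply continuous_map_from_subtopology
            continuous_map_fst continuous_map_snd)
      show "(\<lambda>m. (inv\<^bsub>top_grp B\<^esub> (fst m), snd m)) \<in>
        topspace (subtopology semidirect_top (\<alpha>1 ` topspace (top_top A))) \<rightarrow> {(h, g). bd B h = c g}"
        by (auto simp: \<alpha>1_def A.H.carrier_eq[symmetric] weqD(4))
    qed
    from continuous_map_apply[OF e(2) this]
    show "continuous_map (subtopology semidirect_top (\<alpha>1 ` topspace (top_top A))) (top_top A)
      (\<lambda>m. e (inv\<^bsub>top_grp B\<^esub> (fst m), snd m))" .
  qed
qed

lemma extension_side_target:
  "extension_side B semidirect semidirect_top (kernel_set semidirect (base A) snd) \<beta>1 \<beta>2"
  unfolding extension_side_def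
proof (intro conjI ballI)
  show "\<beta>1 \<in> hom (top_grp B) semidirect"
    by (rule homI) (simp_all add: \<beta>1_def semidirect_simps B.ac_one)
  show "embedding_map (top_top B) semidirect_top \<beta>1"
  proof (rule embedding_map_witness)
    show "continuous_map (top_top B) semidirect_top \<beta>1"
      using A.B.one_closed unfolding \<beta>1_def A.B.carrier_eq
      by (intro continuous_map_pairedI continuous_map_id[unfolded id_def]) simp
    show "continuous_map (subtopology semidirect_top (\<beta>1 ` topspace (top_top B))) (top_top B) fst"
      by (intro continuous_map_from_subtopology continuous_map_fst)
  qed (simp add: \<beta>1_def)
  show "\<beta>1 ` carrier (top_grp B) = kernel_set semidirect (base A) snd"
    by (auto simp: \<beta>1_def kernel_set_def semidirect_simps)
  show "\<beta>2 \<in> hom semidirect (base B)" by (rule \<beta>2_hom)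
  show "continuous_map semidirect_top (base_top B) \<beta>2"
    unfolding \<beta>2_def
    by (intro B.B.continuous_mult_apply continuous_map_apply[OF B.continuous_bd] continuous_c_apply
        continuous_map_fst continuous_map_snd)
  show "\<beta>2 ` carrier semidirect = carrier (base B)"
  proof
    show "\<beta>2 ` carrier semidirect \<subseteq> carrier (base B)" using \<beta>2_hom by (auto simp: hom_def)
    show "carrier (base B) \<subseteq> \<beta>2 ` carrier semidirect"
      using weqD(6) by (fastforce simp: \<beta>2_def semidirect_simps image_iff)
  qed
  show "\<beta>2 (\<beta>1 h) = bd B h" if "h \<in> carrier (top_grp B)" for h
    using that by (simp add: \<beta>1_def \<beta>2_def)
  show "\<beta>1 (ac B l (\<beta>2 m)) = inv\<^bsub>semidirect\<^esub> m \<otimes>\<^bsub>semidirect\<^esub> \<beta>1 l \<otimes>\<^bsub>semidirect\<^esub> m"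
    if m: "m \<in> carrier semidirect" and l: "l \<in> carrier (top_grp B)" for m l
  proof (rule conjugate_eqI)
    obtain h g where hg: "m = (h, g)" "h \<in> carrier (top_grp B)" "g \<in> carrier (base A)"
      using m by (auto simp: semidirect_simps)
    have "ac B (ac B l (\<beta>2 m)) (inv\<^bsub>base B\<^esub> c g) = ac B l (bd B h)"
      using l hg by (simp add: \<beta>2_def B.ac_comp[symmetric] B.B.m_assoc)
    moreover have "\<beta>2 m \<in> carrier (base B)" using hg by (simp add: \<beta>2_def)
    ultimately show "m \<otimes>\<^bsub>semidirect\<^esub> \<beta>1 (ac B l (\<beta>2 m)) = \<beta>1 l \<otimes>\<^bsub>semidirect\<^esub> m"
      using l hg
      by (simp add: \<beta>1_def semidirect_simps B.ac_bd B.ac_one B.H.m_assoc B.H.mult_inv_cancel)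
  qed (use m l hom_in_carrier[OF \<beta>2_hom m] in \<open>simp_all add: \<beta>1_def semidirect_simps\<close>)
qed

lemma group_crossed_extension_semidirect:
  "group_crossed_extension A B semidirect semidirect_top \<alpha>1 snd \<beta>1 \<beta>2"
  using topological_group_semidirect extension_side_source extension_side_target
  by (simp add: group_crossed_extension_def)

end

section \<open>Composition of crossed extensions\<close>

text \<open>The setting for composing a crossed extension \<open>M\<close> of \<open>A\<close> and \<open>B\<close> with a crossed extension \<open>N\<close>
  of \<open>B\<close> and a crossed module with base \<open>C\<close>. The group \<open>P\<close> is the fibre product of \<open>M\<close> and \<open>N\<close> over
  the base of \<open>B\<close>, and the fibres of \<open>f\<close> are the cosets of the top group of \<open>B\<close>, embedded by
  \<open>h \<mapsto> (\<beta>1 h, \<gamma>1 h)\<close>. The fibre product is given by projections \<open>p\<close> and \<open>r\<close> and a pairing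
  rather than as a set of pairs, so that the locale can be interpreted a second time with the
  roles of \<open>A\<close> and \<open>C\<close>, hence of \<open>M\<close> and \<open>N\<close>, exchanged but the same \<open>P\<close> and \<open>f\<close>. Each of the two
  interpretations provides one half of the composite extension.\<close>

locale composition = A: topological_group_xmod A + B: topological_group_xmod B +
    M: topological_group M TM + N: topological_group N TN + P: topological_group P TP
  for A :: "('g, 'h) group_xmod" and B :: "('k, 'l) group_xmod"
    and M :: "'m monoid" and TM and N :: "'n monoid" and TN and P :: "'p monoid" and TP +
  fixes \<alpha>1 :: "'h \<Rightarrow> 'm" and \<alpha>2 :: "'m \<Rightarrow> 'g" and \<beta>1 :: "'l \<Rightarrow> 'm" and \<beta>2 :: "'m \<Rightarrow> 'k"
    and \<gamma>1 :: "'l \<Rightarrow> 'n" and \<gamma>2 :: "'n \<Rightarrow> 'k" and C :: "'c monoid" and \<delta>2 :: "'n \<Rightarrow> 'c"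
    and p :: "'p \<Rightarrow> 'm" and r :: "'p \<Rightarrow> 'n" and pair :: "'m \<Rightarrow> 'n \<Rightarrow> 'p" and f :: "'p \<Rightarrow> 'q"
  assumes side_A: "extension_side A M TM (kernel_set M (base B) \<beta>2) \<alpha>1 \<alpha>2"
    and side_B: "extension_side B M TM (kernel_set M (base A) \<alpha>2) \<beta>1 \<beta>2"
    and side_B': "extension_side B N TN (kernel_set N C \<delta>2) \<gamma>1 \<gamma>2"
    and C: "group C" and \<delta>2: "\<delta>2 \<in> hom N C"
    and p: "p \<in> hom P M" and r: "r \<in> hom P N"
    and continuous_p: "continuous_map TP TM p" and continuous_r: "continuous_map TP TN r"
    and pullback_eq: "x \<in> carrier P \<Longrightarrow> \<beta>2 (p x) = \<gamma>2 (r x)"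
    and pair: "m \<in> carrier M \<Longrightarrow> n \<in> carrier N \<Longrightarrow> \<beta>2 m = \<gamma>2 n \<Longrightarrow>
      pair m n \<in> carrier P \<and> p (pair m n) = m \<and> r (pair m n) = n"
    and jointly_inj: "x \<in> carrier P \<Longrightarrow> y \<in> carrier P \<Longrightarrow> p x = p y \<Longrightarrow> r x = r y \<Longrightarrow> x = y"
    and continuous_pair: "continuous_map (subtopology (prod_topology TM TN) {(m, n). \<beta>2 m = \<gamma>2 n}) TP
      (\<lambda>(m, n). pair m n)"
    and f_eq_iff: "x \<in> carrier P \<Longrightarrow> y \<in> carrier P \<Longrightarrow>
      f x = f y \<longleftrightarrow> (\<exists>h\<in>carrier (top_grp B).
        p y = p x \<otimes>\<^bsub>M\<^esub> \<beta>1 h \<and> r y = r x \<otimes>\<^bsub>N\<^esub> \<gamma>1 h)"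
begin

sublocale p: group_hom P M p by unfold_locales (rule p)
sublocale r: group_hom P N r by unfold_locales (rule r)
sublocale \<delta>2: group_hom N C \<delta>2
  by (intro group_hom.intro group_hom_axioms.intro N.is_group C \<delta>2)

lemma A_side:
  "\<alpha>1 \<in> hom (top_grp A) M" "embedding_map (top_top A) TM \<alpha>1"
  "\<alpha>1 ` carrier (top_grp A) = kernel_set M (base B) \<beta>2"
  "\<alpha>2 \<in> hom M (base A)" "continuous_map TM (base_top A) \<alpha>2" "\<alpha>2 ` carrier M = carrier (base A)"
  "\<And>h. h \<in> carrier (top_grp A) \<Longrightarrow> \<alpha>2 (\<alpha>1 h) = bd A h"
  "\<And>m h. m \<in> carrier M \<Longrightarrow> h \<in> carrier (top_grp A) \<Longrightarrow>
      \<alpha>1 (ac A h (\<alpha>2 m)) = inv\<^bsub>M\<^esub> m \<otimes>\<^bsub>M\<^esub> \<alpha>1 h \<otimes>\<^bsub>M\<^esub> m"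
  using side_A unfolding extension_side_def by blast+

lemma B_side:
  "\<beta>1 \<in> hom (top_grp B) M" "embedding_map (top_top B) TM \<beta>1"
  "\<beta>1 ` carrier (top_grp B) = kernel_set M (base A) \<alpha>2"
  "\<beta>2 \<in> hom M (base B)" 
  "\<And>h. h \<in> carrier (top_grp B) \<Longrightarrow> \<beta>2 (\<beta>1 h) = bd B h"
  "\<And>m h. m \<in> carrier M \<Longrightarrow> h \<in> carrier (top_grp B) \<Longrightarrow>
      \<beta>1 (ac B h (\<beta>2 m)) = inv\<^bsub>M\<^esub> m \<otimes>\<^bsub>M\<^esub> \<beta>1 h \<otimes>\<^bsub>M\<^esub> m"
  using side_B unfolding extension_side_def by blast+

lemma B_side':
  "\<gamma>1 \<in> hom (top_grp B) N" "embedding_map (top_top B) TN \<gamma>1"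
  "\<gamma>1 ` carrier (top_grp B) = kernel_set N C \<delta>2"
  "\<gamma>2 \<in> hom N (base B)" "\<gamma>2 ` carrier N = carrier (base B)"
  "\<And>h. h \<in> carrier (top_grp B) \<Longrightarrow> \<gamma>2 (\<gamma>1 h) = bd B h"
  "\<And>m h. m \<in> carrier N \<Longrightarrow> h \<in> carrier (top_grp B) \<Longrightarrow>
      \<gamma>1 (ac B h (\<gamma>2 m)) = inv\<^bsub>N\<^esub> m \<otimes>\<^bsub>N\<^esub> \<gamma>1 h \<otimes>\<^bsub>N\<^esub> m"
  using side_B' unfolding extension_side_def by blast+

sublocale \<alpha>1: group_hom "top_grp A" M \<alpha>1 by unfold_locales (rule A_side)
sublocale \<alpha>2: group_hom M "base A" \<alpha>2 by unfold_locales (rule A_side)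
sublocale \<beta>1: group_hom "top_grp B" M \<beta>1 by unfold_locales (rule B_side)
sublocale \<beta>2: group_hom M "base B" \<beta>2 by unfold_locales (rule B_side)
sublocale \<gamma>1: group_hom "top_grp B" N \<gamma>1 by unfold_locales (rule B_side')
sublocale \<gamma>2: group_hom N "base B" \<gamma>2 by unfold_locales (rule B_side')

lemma kernel_simps:
  "h \<in> carrier (top_grp A) \<Longrightarrow> \<beta>2 (\<alpha>1 h) = \<one>\<^bsub>base B\<^esub>"
  "l \<in> carrier (top_grp B) \<Longrightarrow> \<alpha>2 (\<beta>1 l) = \<one>\<^bsub>base A\<^esub>"
  "l \<in> carrier (top_grp B) \<Longrightarrow> \<delta>2 (\<gamma>1 l) = \<one>\<^bsub>C\<^esub>"
  using A_side(3) B_side(3) B_side'(3) unfolding kernel_set_def by blast+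

lemma \<gamma>1_inj: "l \<in> carrier (top_grp B) \<Longrightarrow> \<gamma>1 l = \<one>\<^bsub>N\<^esub> \<Longrightarrow> l = \<one>\<^bsub>top_grp B\<^esub>"
  using inj_onD[OF embedding_map_inverse(2)[OF B_side'(2)], of l "\<one>\<^bsub>top_grp B\<^esub>"]
  by (simp add: B.H.carrier_eq[symmetric])

lemma f_eqI:
  "x \<in> carrier P \<Longrightarrow> y \<in> carrier P \<Longrightarrow> h \<in> carrier (top_grp B) \<Longrightarrow>
    p y = p x \<otimes>\<^bsub>M\<^esub> \<beta>1 h \<Longrightarrow> r y = r x \<otimes>\<^bsub>N\<^esub> \<gamma>1 h \<Longrightarrow> f x = f y"
  using f_eq_iff by blast

text \<open>The embedded top group of \<open>B\<close> is normal: conjugation by \<open>y\<close> in \<open>M\<close> and in \<open>N\<close> is given by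
  the action of \<open>\<beta>2 (p y)\<close> and of \<open>\<gamma>2 (r y)\<close>, which agree on the fibre product.\<close>

lemma congruence: "group_congruence P f"
  unfolding group_congruence_def
proof (intro ballI impI)
  fix x x' y assume x: "x \<in> carrier P" "x' \<in> carrier P" and y: "y \<in> carrier P" and "f x = f x'"
  then obtain h where h: "h \<in> carrier (top_grp B)"
    "p x' = p x \<otimes>\<^bsub>M\<^esub> \<beta>1 h" "r x' = r x \<otimes>\<^bsub>N\<^esub> \<gamma>1 h"
    using f_eq_iff by blast
  define k where "k = ac B h (\<beta>2 (p y))"
  have k: "k \<in> carrier (top_grp B)" using h y by (simp add: k_def)
  have "\<beta>1 k = inv\<^bsub>M\<^esub> p y \<otimes>\<^bsub>M\<^esub> \<beta>1 h \<otimes>\<^bsub>M\<^esub> p y"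
    using h y by (simp add: k_def B_side(6))
  moreover have "\<gamma>1 k = inv\<^bsub>N\<^esub> r y \<otimes>\<^bsub>N\<^esub> \<gamma>1 h \<otimes>\<^bsub>N\<^esub> r y"
    using h y by (simp add: k_def pullback_eq B_side'(7))
  ultimately have "f (x \<otimes>\<^bsub>P\<^esub> y) = f (x' \<otimes>\<^bsub>P\<^esub> y)"
    using x y h k
    by (intro f_eqI[of _ _ k]) (simp_all add: M.m_assoc N.m_assoc M.mult_inv_cancel N.mult_inv_cancel)
  moreover have "f (y \<otimes>\<^bsub>P\<^esub> x) = f (y \<otimes>\<^bsub>P\<^esub> x')"
    using x y h by (intro f_eqI[of _ _ h]) (simp_all add: M.m_assoc N.m_assoc)
  ultimately show "f (x \<otimes>\<^bsub>P\<^esub> y) = f (x' \<otimes>\<^bsub>P\<^esub> y) \<and> f (y \<otimes>\<^bsub>P\<^esub> x) = f (y \<otimes>\<^bsub>P\<^esub> x')" ..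
qed

abbreviation "Q \<equiv> image_group P f"
abbreviation "TQ \<equiv> coinduced TP f"
abbreviation "rep \<equiv> inv_into (carrier P) f"

lemma topological_group_Q: "topological_group Q TQ"
  by (rule P.image_group(1)[OF congruence])

sublocale Q: topological_group Q TQ by (rule topological_group_Q)
sublocale f: group_hom P Q f by unfold_locales (rule P.image_group(2)[OF congruence])

lemma rep: "x \<in> carrier P \<Longrightarrow> rep (f x) \<in> carrier P \<and> f (rep (f x)) = f x"
  by (simp add: inv_into_into f_inv_into_f)

lemma invariant_rep:
  assumes "x \<in> carrier P"
  shows "\<alpha>2 (p (rep (f x))) = \<alpha>2 (p x)" "\<delta>2 (r (rep (f x))) = \<delta>2 (r x)"
proof -
  have "rep (f x) \<in> carrier P" "f (rep (f x)) = f x" using rep[OF assms] by simp_all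
  then obtain h where h: "h \<in> carrier (top_grp B)" "p x = p (rep (f x)) \<otimes>\<^bsub>M\<^esub> \<beta>1 h"
      "r x = r (rep (f x)) \<otimes>\<^bsub>N\<^esub> \<gamma>1 h" "rep (f x) \<in> carrier P"
    using f_eq_iff assms by blast
  then show "\<alpha>2 (p (rep (f x))) = \<alpha>2 (p x)" "\<delta>2 (r (rep (f x))) = \<delta>2 (r x)"
    by (simp_all add: kernel_simps)
qed

text \<open>The structure maps of the composite: \<open>A\<close> sits in the quotient as the classes of pairs with
  trivial second component, and the projections to the outer bases do not see the subgroup
  divided out.\<close>

definition \<epsilon>1 :: "'h \<Rightarrow> 'q" where "\<epsilon>1 h = f (pair (\<alpha>1 h) \<one>\<^bsub>N\<^esub>)"
definition \<epsilon>2 :: "'q \<Rightarrow> 'g" where "\<epsilon>2 q = \<alpha>2 (p (rep q))"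
definition \<zeta>2 :: "'q \<Rightarrow> 'c" where "\<zeta>2 q = \<delta>2 (r (rep q))"

lemma \<epsilon>2_f: "x \<in> carrier P \<Longrightarrow> \<epsilon>2 (f x) = \<alpha>2 (p x)"
  and \<zeta>2_f: "x \<in> carrier P \<Longrightarrow> \<zeta>2 (f x) = \<delta>2 (r x)"
  by (simp_all add: \<epsilon>2_def \<zeta>2_def invariant_rep)

lemma pair_\<alpha>1:
  assumes "h \<in> carrier (top_grp A)"
  shows "pair (\<alpha>1 h) \<one>\<^bsub>N\<^esub> \<in> carrier P" "p (pair (\<alpha>1 h) \<one>\<^bsub>N\<^esub>) = \<alpha>1 h" "r (pair (\<alpha>1 h) \<one>\<^bsub>N\<^esub>) = \<one>\<^bsub>N\<^esub>"
  using pair[of "\<alpha>1 h" "\<one>\<^bsub>N\<^esub>"] assms by (simp_all add: kernel_simps)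

lemma \<epsilon>1_inj:
  assumes "h \<in> carrier (top_grp A)" "k \<in> carrier (top_grp A)" "\<epsilon>1 h = \<epsilon>1 k"
  shows "h = k"
proof -
  obtain l where l: "l \<in> carrier (top_grp B)" "\<alpha>1 k = \<alpha>1 h \<otimes>\<^bsub>M\<^esub> \<beta>1 l" "\<one>\<^bsub>N\<^esub> = \<one>\<^bsub>N\<^esub> \<otimes>\<^bsub>N\<^esub> \<gamma>1 l"
    using assms f_eq_iff[OF pair_\<alpha>1(1) pair_\<alpha>1(1)] unfolding \<epsilon>1_def by (auto simp: pair_\<alpha>1)
  then have "l = \<one>\<^bsub>top_grp B\<^esub>" by (intro \<gamma>1_inj) simp_all
  then have "\<alpha>1 k = \<alpha>1 h" using l assms by simp
  then show ?thesis
    using inj_onD[OF embedding_map_inverse(2)[OF A_side(2)], of k h] assms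
    by (simp add: A.H.carrier_eq[symmetric])
qed

text \<open>An element of the fibre product whose class lies in the kernel of the projection to \<open>C\<close> can
  be moved inside its class so that its second component becomes trivial; its first component then
  comes from the top group of \<open>A\<close>. Unlike a choice of representatives, this formula is visibly
  continuous.\<close>

definition lift :: "'p \<Rightarrow> 'h" where
  "lift x = inv_into (carrier (top_grp A)) \<alpha>1
     (p x \<otimes>\<^bsub>M\<^esub> inv\<^bsub>M\<^esub> \<beta>1 (inv_into (carrier (top_grp B)) \<gamma>1 (r x)))"

lemma lift:
  assumes x: "x \<in> carrier P" and ker: "\<delta>2 (r x) = \<one>\<^bsub>C\<^esub>"
  defines "l \<equiv> inv_into (carrier (top_grp B)) \<gamma>1 (r x)"
  shows "l \<in> carrier (top_grp B)" "\<gamma>1 l = r x"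
    "p x \<otimes>\<^bsub>M\<^esub> inv\<^bsub>M\<^esub> \<beta>1 l \<in> \<alpha>1 ` carrier (top_grp A)"
    "lift x \<in> carrier (top_grp A)" "\<epsilon>1 (lift x) = f x"
proof -
  have img: "r x \<in> \<gamma>1 ` carrier (top_grp B)"
    using x ker unfolding B_side'(3) kernel_set_def by simp
  show l: "l \<in> carrier (top_grp B)" "\<gamma>1 l = r x"
    unfolding l_def by (rule inv_into_into[OF img], rule f_inv_into_f[OF img])
  have "\<beta>2 (p x) = bd B l" using x l B_side'(6)[of l] by (simp add: pullback_eq)
  then show m: "p x \<otimes>\<^bsub>M\<^esub> inv\<^bsub>M\<^esub> \<beta>1 l \<in> \<alpha>1 ` carrier (top_grp A)"
    unfolding A_side(3) kernel_set_def using x l by (simp add: B_side(5))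
  then show k: "lift x \<in> carrier (top_grp A)"
    unfolding lift_def l_def by (rule inv_into_into)
  have \<alpha>1: "\<alpha>1 (lift x) = p x \<otimes>\<^bsub>M\<^esub> inv\<^bsub>M\<^esub> \<beta>1 l"
    using m unfolding lift_def l_def by (rule f_inv_into_f)
  show "\<epsilon>1 (lift x) = f x"
    unfolding \<epsilon>1_def
    using x l pair_\<alpha>1[OF k] by (intro f_eqI[of _ _ l]) (simp_all add: \<alpha>1 M.m_assoc)
qed

lemma image_\<epsilon>1: "\<epsilon>1 ` carrier (top_grp A) = kernel_set Q C \<zeta>2"
proof
  show "\<epsilon>1 ` carrier (top_grp A) \<subseteq> kernel_set Q C \<zeta>2"
    using pair_\<alpha>1 by (auto simp: kernel_set_def \<epsilon>1_def \<zeta>2_f)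
  show "kernel_set Q C \<zeta>2 \<subseteq> \<epsilon>1 ` carrier (top_grp A)"
  proof
    fix q assume "q \<in> kernel_set Q C \<zeta>2"
    then obtain x where "x \<in> carrier P" "q = f x" "\<delta>2 (r x) = \<one>\<^bsub>C\<^esub>"
      by (auto simp: kernel_set_def carrier_image_group \<zeta>2_f)
    then show "q \<in> \<epsilon>1 ` carrier (top_grp A)"
      using lift(4,5) by (intro image_eqI[of _ _ "lift x"]) auto
  qed
qed

lemma continuous_lift:
  "continuous_map (subtopology TP {x. \<delta>2 (r x) = \<one>\<^bsub>C\<^esub>}) (top_top A) lift"
proof -
  let ?S = "subtopology TP {x. \<delta>2 (r x) = \<one>\<^bsub>C\<^esub>}"
  have S: "x \<in> carrier P" "\<delta>2 (r x) = \<one>\<^bsub>C\<^esub>" if "x \<in> topspace ?S" for x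
    using that by (simp_all add: P.carrier_eq)
  note inv_\<gamma>1 = embedding_map_inverse(3)[OF B_side'(2), folded B.H.carrier_eq]
  note inv_\<alpha>1 = embedding_map_inverse(3)[OF A_side(2), folded A.H.carrier_eq]
  have cp: "continuous_map ?S TM p" and cr: "continuous_map ?S TN r"
    by (intro continuous_map_from_subtopology continuous_p continuous_r)+
  have "continuous_map ?S (subtopology TN (\<gamma>1 ` carrier (top_grp B))) r"
    unfolding continuous_map_in_subtopology
  proof (intro conjI cr Pi_I)
    fix x assume "x \<in> topspace ?S"
    then show "r x \<in> \<gamma>1 ` carrier (top_grp B)" using lift(1,2)[OF S] by (metis imageI)
  qed
  from continuous_map_apply[OF inv_\<gamma>1 this]
  have "continuous_map ?S (top_top B) (\<lambda>x. inv_into (carrier (top_grp B)) \<gamma>1 (r x))" .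
  from continuous_map_apply[OF embedding_map_inverse(1)[OF B_side(2)] this]
  have "continuous_map ?S TM (\<lambda>x. p x \<otimes>\<^bsub>M\<^esub> inv\<^bsub>M\<^esub> \<beta>1 (inv_into (carrier (top_grp B)) \<gamma>1 (r x)))"
    by (intro M.continuous_mult_apply M.continuous_inv_apply cp)
  then have "continuous_map ?S (subtopology TM (\<alpha>1 ` carrier (top_grp A)))
    (\<lambda>x. p x \<otimes>\<^bsub>M\<^esub> inv\<^bsub>M\<^esub> \<beta>1 (inv_into (carrier (top_grp B)) \<gamma>1 (r x)))"
    unfolding continuous_map_in_subtopology
    by (intro conjI Pi_I) (simp, rule lift(3)[OF S])
  from continuous_map_apply[OF inv_\<alpha>1 this]
  show ?thesis unfolding lift_def .
qed

text \<open>Since the quotient map is open, it remains a quotient map over the kernel of the projection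
  to \<open>C\<close>. There the inverse of \<open>\<epsilon>1\<close> is induced by the continuous map \<open>lift\<close>.\<close>

lemma embedding_\<epsilon>1: "embedding_map (top_top A) TQ \<epsilon>1"
proof (rule embedding_map_witness)
  have "continuous_map (top_top A) TP (\<lambda>h. pair (\<alpha>1 h) \<one>\<^bsub>N\<^esub>)"
  proof (rule continuous_map_binop[OF continuous_pair])
    show "continuous_map (top_top A) TM \<alpha>1" by (rule embedding_map_inverse(1)[OF A_side(2)])
    show "continuous_map (top_top A) TN (\<lambda>h. \<one>\<^bsub>N\<^esub>)" by (simp add: N.carrier_eq[symmetric])
  qed (simp add: A.H.carrier_eq[symmetric] kernel_simps)
  from continuous_map_apply[OF continuous_map_to_coinduced[where f = f] this]
  show "continuous_map (top_top A) TQ \<epsilon>1" by (simp add: \<epsilon>1_def[abs_def])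
  let ?g = "inv_into (carrier (top_grp A)) \<epsilon>1"
  have inj: "inj_on \<epsilon>1 (carrier (top_grp A))" using \<epsilon>1_inj by (intro inj_onI)
  then show "?g (\<epsilon>1 h) = h" if "h \<in> topspace (top_top A)" for h
    using that by (simp add: A.H.carrier_eq[symmetric])
  have img: "\<epsilon>1 ` topspace (top_top A) = kernel_set Q C \<zeta>2"
    using image_\<epsilon>1 by (simp add: A.H.carrier_eq)
  let ?S = "{x. \<delta>2 (r x) = \<one>\<^bsub>C\<^esub>}" and ?K = "kernel_set Q C \<zeta>2"
  have fS: "f x \<in> ?K \<longleftrightarrow> x \<in> ?S" if "x \<in> carrier P" for x
    using that by (simp add: kernel_set_def carrier_image_group \<zeta>2_f)
  have sat: "{x \<in> topspace TP. f x \<in> ?K} = topspace TP \<inter> ?S"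
    using fS by (auto simp: P.carrier_eq)
  have quot: "quotient_map (subtopology TP ?S) (subtopology TQ ?K) f"
  proof (rule continuous_open_imp_quotient_map)
    show "continuous_map (subtopology TP ?S) (subtopology TQ ?K) f"
      using fS P.carrier_eq
      by (auto simp: continuous_map_in_subtopology continuous_map_from_subtopology
          continuous_map_to_coinduced)
    have "open_map (subtopology TP (topspace TP \<inter> ?S)) (subtopology TQ ?K) f"
      by (rule open_map_restriction[OF P.image_group(3)[OF congruence] sat])
    then show "open_map (subtopology TP ?S) (subtopology TQ ?K) f"
      by (simp only: subtopology_restrict)
    show "f ` topspace (subtopology TP ?S) = topspace (subtopology TQ ?K)"
    proof
      show "f ` topspace (subtopology TP ?S) \<subseteq> topspace (subtopology TQ ?K)"
      proof
        fix q assume "q \<in> f ` topspace (subtopology TP ?S)"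
        then obtain x where x: "x \<in> topspace (subtopology TP ?S)" "q = f x" by (elim imageE)
        then have "x \<in> topspace TP" "f x \<in> ?K" using fS[of x] by (simp_all add: P.carrier_eq)
        then show "q \<in> topspace (subtopology TQ ?K)" using x by simp
      qed
      show "topspace (subtopology TQ ?K) \<subseteq> f ` topspace (subtopology TP ?S)"
      proof
        fix q assume "q \<in> topspace (subtopology TQ ?K)"
        then have q: "q \<in> f ` carrier P" "q \<in> ?K" by (simp_all add: P.carrier_eq)
        then obtain x where "x \<in> carrier P" "q = f x" by (elim imageE)
        then show "q \<in> f ` topspace (subtopology TP ?S)"
          using fS[of x] q by (intro image_eqI[of _ _ x]) (simp_all add: P.carrier_eq[symmetric])
      qed
    qed
  qed
  show "continuous_map (subtopology TQ (\<epsilon>1 ` topspace (top_top A))) (top_top A) ?g"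
    unfolding img
  proof (rule continuous_compose_quotient_map[OF quot])
    show "continuous_map (subtopology TP ?S) (top_top A) (?g \<circ> f)"
    proof (rule continuous_map_eq[OF continuous_lift])
      fix x assume "x \<in> topspace (subtopology TP ?S)"
      then have x: "x \<in> carrier P" "\<delta>2 (r x) = \<one>\<^bsub>C\<^esub>" by (simp_all add: P.carrier_eq)
      have "?g (\<epsilon>1 (lift x)) = lift x" by (rule inv_into_f_f[OF inj lift(4)[OF x]])
      then show "lift x = (?g \<circ> f) x" by (simp add: lift(5)[OF x])
    qed
  qed
qed

lemma composite_side: "extension_side A Q TQ (kernel_set Q C \<zeta>2) \<epsilon>1 \<epsilon>2"
  unfolding extension_side_def
proof (intro conjI ballI)
  show "\<epsilon>1 \<in> hom (top_grp A) Q"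
  proof (rule homI)
    show "\<epsilon>1 h \<in> carrier Q" if "h \<in> carrier (top_grp A)" for h
      using that by (simp add: \<epsilon>1_def pair_\<alpha>1)
    show "\<epsilon>1 (h \<otimes>\<^bsub>top_grp A\<^esub> k) = \<epsilon>1 h \<otimes>\<^bsub>Q\<^esub> \<epsilon>1 k"
      if "h \<in> carrier (top_grp A)" "k \<in> carrier (top_grp A)" for h k
    proof -
      have "pair (\<alpha>1 (h \<otimes>\<^bsub>top_grp A\<^esub> k)) \<one>\<^bsub>N\<^esub> = pair (\<alpha>1 h) \<one>\<^bsub>N\<^esub> \<otimes>\<^bsub>P\<^esub> pair (\<alpha>1 k) \<one>\<^bsub>N\<^esub>"
        using that by (intro jointly_inj) (simp_all add: pair_\<alpha>1 del: \<alpha>1.hom_mult, simp)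
      then show ?thesis using that by (simp add: \<epsilon>1_def pair_\<alpha>1 del: \<alpha>1.hom_mult)
    qed
  qed
  show "embedding_map (top_top A) TQ \<epsilon>1" by (rule embedding_\<epsilon>1)
  show "\<epsilon>1 ` carrier (top_grp A) = kernel_set Q C \<zeta>2" by (rule image_\<epsilon>1)
  show "\<epsilon>2 \<in> hom Q (base A)"
  proof (rule homI)
    fix x y assume "x \<in> carrier Q" "y \<in> carrier Q"
    then obtain a b where ab: "a \<in> carrier P" "b \<in> carrier P" "x = f a" "y = f b"
      by (auto simp: carrier_image_group)
    have "\<epsilon>2 (f (a \<otimes>\<^bsub>P\<^esub> b)) = \<epsilon>2 (f a) \<otimes>\<^bsub>base A\<^esub> \<epsilon>2 (f b)"
      using ab by (simp add: \<epsilon>2_f del: f.hom_mult)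
    then show "\<epsilon>2 (x \<otimes>\<^bsub>Q\<^esub> y) = \<epsilon>2 x \<otimes>\<^bsub>base A\<^esub> \<epsilon>2 y" using ab by simp
  qed (auto simp: carrier_image_group \<epsilon>2_f)
  show "continuous_map TQ (base_top A) \<epsilon>2"
  proof (rule continuous_map_from_coinduced)
    show "continuous_map TP (base_top A) (\<lambda>x. \<epsilon>2 (f x))"
      by (rule continuous_map_eq[OF continuous_map_apply[OF A_side(5) continuous_p]])
        (simp add: \<epsilon>2_f P.carrier_eq)
  qed
  show "\<epsilon>2 ` carrier Q = carrier (base A)"
  proof
    show "\<epsilon>2 ` carrier Q \<subseteq> carrier (base A)" by (auto simp: carrier_image_group \<epsilon>2_f)
    show "carrier (base A) \<subseteq> \<epsilon>2 ` carrier Q"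
    proof
      fix g assume "g \<in> carrier (base A)"
      then obtain m where m: "m \<in> carrier M" "g = \<alpha>2 m" using A_side(6) by blast
      then obtain n where n: "n \<in> carrier N" "\<beta>2 m = \<gamma>2 n" using B_side'(5) by (metis imageE \<beta>2.hom_closed)
      have "pair m n \<in> carrier P" "p (pair m n) = m" using pair m n by simp_all
      then show "g \<in> \<epsilon>2 ` carrier Q"
        using m by (intro image_eqI[of _ _ "f (pair m n)"]) (simp_all add: \<epsilon>2_f)
    qed
  qed
  show "\<epsilon>2 (\<epsilon>1 h) = bd A h" if "h \<in> carrier (top_grp A)" for h
    using that by (simp add: \<epsilon>1_def \<epsilon>2_f pair_\<alpha>1 A_side(7))
  show "\<epsilon>1 (ac A h (\<epsilon>2 q)) = inv\<^bsub>Q\<^esub> q \<otimes>\<^bsub>Q\<^esub> \<epsilon>1 h \<otimes>\<^bsub>Q\<^esub> q"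
    if q: "q \<in> carrier Q" and h: "h \<in> carrier (top_grp A)" for q h
  proof -
    obtain x where x: "x \<in> carrier P" "q = f x" using q by (auto simp: carrier_image_group)
    have k: "ac A h (\<alpha>2 (p x)) \<in> carrier (top_grp A)" using h x by simp
    have "pair (\<alpha>1 (ac A h (\<alpha>2 (p x)))) \<one>\<^bsub>N\<^esub> = inv\<^bsub>P\<^esub> x \<otimes>\<^bsub>P\<^esub> pair (\<alpha>1 h) \<one>\<^bsub>N\<^esub> \<otimes>\<^bsub>P\<^esub> x"
      using x h pair_\<alpha>1[OF k] pair_\<alpha>1[OF h] by (intro jointly_inj) (simp_all add: A_side(8))
    then have "\<epsilon>1 (ac A h (\<epsilon>2 q)) = f (inv\<^bsub>P\<^esub> x \<otimes>\<^bsub>P\<^esub> pair (\<alpha>1 h) \<one>\<^bsub>N\<^esub> \<otimes>\<^bsub>P\<^esub> x)"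
      using x by (simp add: \<epsilon>1_def \<epsilon>2_f)
    then show ?thesis
      using x h by (simp add: \<epsilon>1_def pair_\<alpha>1)
  qed
qed

end

text \<open>A canonical choice in each class of an equivalence relation, so that a quotient of a set of
  pairs still consists of pairs and can be encoded by the same injection.\<close>

lemma choice_eq_iff:
  assumes "x \<in> S" "y \<in> S" and refl: "\<And>x. x \<in> S \<Longrightarrow> rel x x"
    and sym: "\<And>x y. x \<in> S \<Longrightarrow> y \<in> S \<Longrightarrow> rel x y \<Longrightarrow> rel y x"
    and trans: "\<And>x y z. x \<in> S \<Longrightarrow> y \<in> S \<Longrightarrow> z \<in> S \<Longrightarrow> rel x y \<Longrightarrow> rel y z \<Longrightarrow> rel x z"
  shows "(SOME z. z \<in> S \<and> rel x z) = (SOME z. z \<in> S \<and> rel y z) \<longleftrightarrow> rel x y"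
proof
  assume eq: "(SOME z. z \<in> S \<and> rel x z) = (SOME z. z \<in> S \<and> rel y z)"
  have "(SOME z. z \<in> S \<and> rel x z) \<in> S \<and> rel x (SOME z. z \<in> S \<and> rel x z)"
    by (rule someI[of "\<lambda>z. z \<in> S \<and> rel x z" x]) (simp add: assms)
  moreover have "(SOME z. z \<in> S \<and> rel y z) \<in> S \<and> rel y (SOME z. z \<in> S \<and> rel y z)"
    by (rule someI[of "\<lambda>z. z \<in> S \<and> rel y z" y]) (simp add: assms)
  ultimately show "rel x y"
    using eq sym trans assms(1,2) by metis
next
  assume "rel x y"
  then have "(\<lambda>z. z \<in> S \<and> rel x z) = (\<lambda>z. z \<in> S \<and> rel y z)"
    using sym trans assms(1,2) by (intro ext) metis
  then show "(SOME z. z \<in> S \<and> rel x z) = (SOME z. z \<in> S \<and> rel y z)" by simp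
qed

lemma group_crossed_extension_trans:
  fixes M :: "'m monoid" and N :: "'n monoid" and e :: "'m \<times> 'n \<Rightarrow> 'q"
  assumes A: "topological_group_xmod A" and B: "topological_group_xmod B"
    and C: "topological_group_xmod C"
    and AB: "group_crossed_extension A B M TM \<alpha>1 \<alpha>2 \<beta>1 \<beta>2"
    and BC: "group_crossed_extension B C N TN \<gamma>1 \<gamma>2 \<delta>1 \<delta>2"
    and e: "inj e"
  shows "\<exists>(Q :: 'q monoid) TQ \<epsilon>1 \<epsilon>2 \<zeta>1 \<zeta>2. group_crossed_extension A C Q TQ \<epsilon>1 \<epsilon>2 \<zeta>1 \<zeta>2"
proof -
  interpret A: topological_group_xmod A by (rule A)
  interpret B: topological_group_xmod B by (rule B)
  interpret C: topological_group_xmod C by (rule C)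
  interpret M: topological_group M TM using AB by (simp add: group_crossed_extension_def)
  interpret N: topological_group N TN using BC by (simp add: group_crossed_extension_def)
  have sides: "extension_side A M TM (kernel_set M (base B) \<beta>2) \<alpha>1 \<alpha>2"
    "extension_side B M TM (kernel_set M (base A) \<alpha>2) \<beta>1 \<beta>2"
    "extension_side B N TN (kernel_set N (base C) \<delta>2) \<gamma>1 \<gamma>2"
    "extension_side C N TN (kernel_set N (base B) \<gamma>2) \<delta>1 \<delta>2"
    using AB BC by (simp_all add: group_crossed_extension_def)
  have homs: "\<alpha>2 \<in> hom M (base A)" "\<beta>1 \<in> hom (top_grp B) M" "\<beta>2 \<in> hom M (base B)"
      "\<gamma>1 \<in> hom (top_grp B) N" "\<gamma>2 \<in> hom N (base B)" "\<delta>2 \<in> hom N (base C)"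
    using sides by (simp_all add: extension_side_def)
  interpret \<beta>1: group_hom "top_grp B" M \<beta>1 by unfold_locales (rule homs)
  interpret \<beta>2: group_hom M "base B" \<beta>2 by unfold_locales (rule homs)
  interpret \<gamma>1: group_hom "top_grp B" N \<gamma>1 by unfold_locales (rule homs)
  interpret \<gamma>2: group_hom N "base B" \<gamma>2 by unfold_locales (rule homs)
  define S where "S = {x \<in> carrier M \<times> carrier N. \<beta>2 (fst x) = \<gamma>2 (snd x)}"
  define P where "P = (M \<times>\<times> N)\<lparr>carrier := S\<rparr>"
  define TP where "TP = subtopology (prod_topology TM TN) S"
  have subgroup: "subgroup S (M \<times>\<times> N)"
    by (rule group.subgroupI[OF DirProd_group[OF M.is_group N.is_group]])
      (auto simp: S_def intro!: exI[of _ "\<one>\<^bsub>M\<^esub>"] exI[of _ "\<one>\<^bsub>N\<^esub>"])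
  have P: "carrier P = S" "monoid.mult P = monoid.mult (M \<times>\<times> N)" "one P = one (M \<times>\<times> N)"
    by (simp_all add: P_def)
  have group_P: "group P"
    unfolding P_def
    by (rule subgroup.subgroup_is_group[OF subgroup DirProd_group[OF M.is_group N.is_group]])
  have inv_P: "inv\<^bsub>P\<^esub> x = (inv\<^bsub>M\<^esub> fst x, inv\<^bsub>N\<^esub> snd x)" if "x \<in> S" for x
  proof -
    have "inv\<^bsub>P\<^esub> x = inv\<^bsub>M \<times>\<times> N\<^esub> x"
      unfolding P_def
      by (rule group.m_inv_consistent[OF DirProd_group[OF M.is_group N.is_group] subgroup that])
    then show ?thesis
      using that inv_DirProd[OF M.is_group N.is_group, of "fst x" "snd x"] by (auto simp: S_def)
  qed
  have top_P: "topspace TP = S"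
    by (auto simp: TP_def S_def M.carrier_eq N.carrier_eq)
  have cont: "continuous_map TP TM fst" "continuous_map TP TN snd"
    by (simp_all add: TP_def continuous_map_subtopology_fst continuous_map_subtopology_snd)
  have into_TP: "continuous_map X TP \<phi>"
    if "continuous_map X TM (\<lambda>x. fst (\<phi> x))" "continuous_map X TN (\<lambda>x. snd (\<phi> x))"
      "\<And>x. x \<in> topspace X \<Longrightarrow> \<phi> x \<in> S" for X :: "'z topology" and \<phi>
    using that unfolding TP_def continuous_map_in_subtopology continuous_map_pairwise o_def by auto
  interpret P: topological_group P TP
  proof (intro topological_group.intro topological_group_axioms.intro group_P)
    show "carrier P = topspace TP" by (simp add: P top_P)
    note cc = continuous_map_apply[OF cont(1) continuous_map_fst] continuous_map_apply[OF cont(1) continuous_map_snd]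
      continuous_map_apply[OF cont(2) continuous_map_fst] continuous_map_apply[OF cont(2) continuous_map_snd]
    have "continuous_map (prod_topology TP TP) TP (\<lambda>p. fst p \<otimes>\<^bsub>P\<^esub> snd p)"
    proof (rule into_TP)
      show "continuous_map (prod_topology TP TP) TM (\<lambda>x. fst (fst x \<otimes>\<^bsub>P\<^esub> snd x))"
        unfolding P(2) mult_DirProd' fst_conv by (intro M.continuous_mult_apply cc)
      show "continuous_map (prod_topology TP TP) TN (\<lambda>x. snd (fst x \<otimes>\<^bsub>P\<^esub> snd x))"
        unfolding P(2) mult_DirProd' snd_conv by (intro N.continuous_mult_apply cc)
      show "fst x \<otimes>\<^bsub>P\<^esub> snd x \<in> S" if "x \<in> topspace (prod_topology TP TP)" for x
        using that group.is_monoid[OF group_P] by (auto simp: top_P P(1)[symmetric] monoid.m_closed)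
    qed
    then show "continuous_map (prod_topology TP TP) TP (\<lambda>(x, y). x \<otimes>\<^bsub>P\<^esub> y)"
      by (simp add: case_prod_unfold)
    have "continuous_map TP TP (\<lambda>x. (inv\<^bsub>M\<^esub> fst x, inv\<^bsub>N\<^esub> snd x))"
    proof (rule into_TP)
      show "(inv\<^bsub>M\<^esub> fst x, inv\<^bsub>N\<^esub> snd x) \<in> S" if "x \<in> topspace TP" for x
        using that by (auto simp: top_P S_def)
    qed (simp_all add: M.continuous_inv_apply N.continuous_inv_apply cont)
    then show "continuous_map TP TP (m_inv P)"
      by (rule continuous_map_eq) (simp add: inv_P top_P)
  qed
  define rel where "rel x y \<longleftrightarrow> (\<exists>h\<in>carrier (top_grp B).
    fst y = fst x \<otimes>\<^bsub>M\<^esub> \<beta>1 h \<and> snd y = snd x \<otimes>\<^bsub>N\<^esub> \<gamma>1 h)" for x y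
  define f where "f x = e (SOME y. y \<in> S \<and> rel x y)" for x
  have f_eq: "f x = f y \<longleftrightarrow> rel x y" if "x \<in> S" "y \<in> S" for x y
    unfolding f_def inj_eq[OF e]
  proof (rule choice_eq_iff[OF that])
    fix x assume x: "x \<in> S"
    then show "rel x x"
      unfolding rel_def by (intro bexI[of _ "\<one>\<^bsub>top_grp B\<^esub>"]) (auto simp: S_def)
    fix y assume y: "y \<in> S"
    show "rel y x" if xy: "rel x y"
    proof -
      obtain h where h: "h \<in> carrier (top_grp B)" "fst y = fst x \<otimes>\<^bsub>M\<^esub> \<beta>1 h" "snd y = snd x \<otimes>\<^bsub>N\<^esub> \<gamma>1 h"
        using xy unfolding rel_def by blast
      have "fst x \<in> carrier M" "snd x \<in> carrier N" using x by (auto simp: S_def)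
      then show ?thesis
        unfolding rel_def
        by (intro bexI[of _ "inv\<^bsub>top_grp B\<^esub> h"]) (simp_all add: h M.m_assoc N.m_assoc)
    qed
    fix z assume z: "z \<in> S"
    show "rel x z" if xy: "rel x y" and yz: "rel y z"
    proof -
      obtain h where h: "h \<in> carrier (top_grp B)" "fst y = fst x \<otimes>\<^bsub>M\<^esub> \<beta>1 h" "snd y = snd x \<otimes>\<^bsub>N\<^esub> \<gamma>1 h"
        using xy unfolding rel_def by blast
      obtain k where k: "k \<in> carrier (top_grp B)" "fst z = fst y \<otimes>\<^bsub>M\<^esub> \<beta>1 k" "snd z = snd y \<otimes>\<^bsub>N\<^esub> \<gamma>1 k"
        using yz unfolding rel_def by blast
      have "fst x \<in> carrier M" "snd x \<in> carrier N" using x by (auto simp: S_def)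
      then show ?thesis
        unfolding rel_def
        by (intro bexI[of _ "h \<otimes>\<^bsub>top_grp B\<^esub> k"]) (simp_all add: h k M.m_assoc N.m_assoc)
    qed
  qed
  have fst_hom: "fst \<in> hom P M" and snd_hom: "snd \<in> hom P N"
    by (rule homI; simp add: P S_def mult_DirProd' mem_Times_iff)+
  have cont_pair: "continuous_map (subtopology (prod_topology TM TN) {(m, n). \<beta>2 m = \<gamma>2 n}) TP
      (\<lambda>(m, n). (m, n))"
    by (rule into_TP)
      (auto simp: case_prod_unfold S_def M.carrier_eq N.carrier_eq continuous_map_subtopology_fst
        continuous_map_subtopology_snd)
  have cont_pair': "continuous_map (subtopology (prod_topology TN TM) {(n, m). \<gamma>2 n = \<beta>2 m}) TP
      (\<lambda>(n, m). (m, n))"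
    by (rule into_TP)
      (auto simp: case_prod_unfold S_def M.carrier_eq N.carrier_eq continuous_map_subtopology_fst
        continuous_map_subtopology_snd)
  interpret AC: composition A B M TM N TN P TP \<alpha>1 \<alpha>2 \<beta>1 \<beta>2 \<gamma>1 \<gamma>2 "base C" \<delta>2 fst snd Pair f
    by unfold_locales
      (use sides homs fst_hom snd_hom cont cont_pair f_eq in \<open>auto simp: P(1) S_def rel_def\<close>)
  \<comment> \<open>The same fibre product read from the other end.\<close>
  interpret CA: composition C B N TN M TM P TP \<delta>1 \<delta>2 \<gamma>1 \<gamma>2 \<beta>1 \<beta>2 "base A" \<alpha>2 snd fst "\<lambda>n m. (m, n)" f
    by unfold_locales
      (use sides homs fst_hom snd_hom cont cont_pair' f_eq in \<open>auto simp: P(1) S_def rel_def\<close>)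
  have "group_crossed_extension A C AC.Q AC.TQ AC.\<epsilon>1 AC.\<epsilon>2 CA.\<epsilon>1 CA.\<epsilon>2"
    unfolding group_crossed_extension_def
    using AC.topological_group_Q AC.composite_side CA.composite_side
    by (simp add: AC.\<zeta>2_def[abs_def] CA.\<zeta>2_def[abs_def] AC.\<epsilon>2_def[abs_def] CA.\<epsilon>2_def[abs_def])
  then show ?thesis by blast
qed

section \<open>Topological groupoids and their isotropy groups\<close>

context topological_groupoid
begin

lemma src_closed [simp]: "g \<in> arr G \<Longrightarrow> src G g \<in> obj G"
  by (rule continuous_map_point[OF continuous_src])

lemma tgt_closed [simp]: "g \<in> arr G \<Longrightarrow> tgt G g \<in> obj G"
  by (rule continuous_map_point[OF continuous_tgt])

lemma idn_closed [simp]: "x \<in> obj G \<Longrightarrow> idn G x \<in> arr G"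
  by (rule continuous_map_point[OF continuous_idn])

lemma inve_closed [simp]: "g \<in> arr G \<Longrightarrow> inve G g \<in> arr G"
  by (rule continuous_map_point[OF continuous_inve])

lemma composable_iff: "(g, f) \<in> composable G \<longleftrightarrow> g \<in> arr G \<and> f \<in> arr G \<and> src G g = tgt G f"
  by (simp add: composable_def)

lemma mult_closed [simp]:
  "g \<in> arr G \<Longrightarrow> f \<in> arr G \<Longrightarrow> src G g = tgt G f \<Longrightarrow> mult G g f \<in> arr G"
  using continuous_map_point[OF continuous_mult, of "(g, f)"] by (simp add: composable_iff)

lemma src_mult_arr [simp]:
  "g \<in> arr G \<Longrightarrow> f \<in> arr G \<Longrightarrow> src G g = tgt G f \<Longrightarrow> src G (mult G g f) = src G f"
  by (simp add: src_mult composable_iff)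

lemma tgt_mult_arr [simp]:
  "g \<in> arr G \<Longrightarrow> f \<in> arr G \<Longrightarrow> src G g = tgt G f \<Longrightarrow> tgt G (mult G g f) = tgt G g"
  by (simp add: tgt_mult composable_iff)

lemma mult_assoc_arr:
  "g \<in> arr G \<Longrightarrow> f \<in> arr G \<Longrightarrow> e \<in> arr G \<Longrightarrow> src G g = tgt G f \<Longrightarrow> src G f = tgt G e \<Longrightarrow>
    mult G (mult G g f) e = mult G g (mult G f e)"
  by (rule mult_assoc) (simp_all add: composable_iff)

declare src_idn [simp] tgt_idn [simp] src_inve [simp] tgt_inve [simp]
  mult_inve_left [simp] mult_inve_right [simp]

lemma mult_idn_left_arr [simp]: "g \<in> arr G \<Longrightarrow> x = tgt G g \<Longrightarrow> mult G (idn G x) g = g"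
  by (simp add: mult_idn_left)

lemma mult_idn_right_arr [simp]: "g \<in> arr G \<Longrightarrow> x = src G g \<Longrightarrow> mult G g (idn G x) = g"
  by (simp add: mult_idn_right)

lemma inve_mult_cancel [simp]:
  "g \<in> arr G \<Longrightarrow> f \<in> arr G \<Longrightarrow> src G g = tgt G f \<Longrightarrow> mult G (inve G g) (mult G g f) = f"
  by (subst mult_assoc_arr[symmetric]) simp_all

lemma mult_inve_cancel [simp]:
  "g \<in> arr G \<Longrightarrow> f \<in> arr G \<Longrightarrow> tgt G g = tgt G f \<Longrightarrow> mult G g (mult G (inve G g) f) = f"
  by (subst mult_assoc_arr[symmetric]) simp_all

lemma inve_unique:
  assumes "f \<in> arr G" "g \<in> arr G" "src G f = tgt G g" "mult G f g = idn G (src G g)"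
  shows "f = inve G g"
proof -
  have "mult G (mult G f g) (inve G g) = f"
    using assms(1-3) by (simp add: mult_assoc_arr)
  then show ?thesis using assms by simp
qed

lemma inve_idn [simp]: "x \<in> obj G \<Longrightarrow> inve G (idn G x) = idn G x"
  by (rule inve_unique[symmetric]) simp_all

lemma inve_inve [simp]: "g \<in> arr G \<Longrightarrow> inve G (inve G g) = g"
  by (rule inve_unique[symmetric]) simp_all

lemma inve_mult:
  "g \<in> arr G \<Longrightarrow> f \<in> arr G \<Longrightarrow> src G g = tgt G f \<Longrightarrow>
    inve G (mult G g f) = mult G (inve G f) (inve G g)"
  by (rule inve_unique[symmetric]) (simp_all add: mult_assoc_arr)

lemma mult_left_cancel:
  assumes "m \<in> arr G" "x \<in> arr G" "y \<in> arr G" "src G m = tgt G x" "src G m = tgt G y"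
    and "mult G m x = mult G m y"
  shows "x = y"
proof -
  have "x = mult G (inve G m) (mult G m x)"
    by (rule inve_mult_cancel[OF assms(1,2,4), symmetric])
  also have "\<dots> = y"
    unfolding assms(6) by (rule inve_mult_cancel[OF assms(1,3,5)])
  finally show ?thesis .
qed

lemma continuous_src_apply: "continuous_map X (Arr G) f \<Longrightarrow> continuous_map X (Obj G) (\<lambda>x. src G (f x))"
  by (rule continuous_map_apply[OF continuous_src])

lemma continuous_tgt_apply: "continuous_map X (Arr G) f \<Longrightarrow> continuous_map X (Obj G) (\<lambda>x. tgt G (f x))"
  by (rule continuous_map_apply[OF continuous_tgt])

lemma continuous_idn_apply: "continuous_map X (Obj G) f \<Longrightarrow> continuous_map X (Arr G) (\<lambda>x. idn G (f x))"
  by (rule continuous_map_apply[OF continuous_idn])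

lemma continuous_inve_apply: "continuous_map X (Arr G) f \<Longrightarrow> continuous_map X (Arr G) (\<lambda>x. inve G (f x))"
  by (rule continuous_map_apply[OF continuous_inve])

lemma continuous_gmult_apply:
  assumes "continuous_map X (Arr G) f" "continuous_map X (Arr G) g"
    and "\<And>x. x \<in> topspace X \<Longrightarrow> src G (f x) = tgt G (g x)"
  shows "continuous_map X (Arr G) (\<lambda>x. mult G (f x) (g x))"
  using assms continuous_map_point[OF assms(1)] continuous_map_point[OF assms(2)]
  by (intro continuous_map_binop[OF continuous_mult]) (auto simp: composable_iff)

end

lemma strict_morphismD:
  assumes "strict_morphism G H f0 f1"
  shows "continuous_map (Obj G) (Obj H) f0" "continuous_map (Arr G) (Arr H) f1"
    "g \<in> arr G \<Longrightarrow> src H (f1 g) = f0 (src G g)" "g \<in> arr G \<Longrightarrow> tgt H (f1 g) = f0 (tgt G g)"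
    "x \<in> obj G \<Longrightarrow> f1 (idn G x) = idn H (f0 x)"
    "g \<in> arr G \<Longrightarrow> f \<in> arr G \<Longrightarrow> src G g = tgt G f \<Longrightarrow> f1 (mult G g f) = mult H (f1 g) (f1 f)"
    "g \<in> arr G \<Longrightarrow> f1 g \<in> arr H" "x \<in> obj G \<Longrightarrow> f0 x \<in> obj H"
proof -
  have a: "continuous_map (Obj G) (Obj H) f0" "continuous_map (Arr G) (Arr H) f1"
    and b: "\<forall>g\<in>arr G. src H (f1 g) = f0 (src G g) \<and> tgt H (f1 g) = f0 (tgt G g)"
    and c: "\<forall>x\<in>obj G. f1 (idn G x) = idn H (f0 x)"
    and d: "\<forall>p\<in>composable G. case p of (g, f) \<Rightarrow> f1 (mult G g f) = mult H (f1 g) (f1 f)"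
    using assms unfolding strict_morphism_def by blast+
  show "continuous_map (Obj G) (Obj H) f0" "continuous_map (Arr G) (Arr H) f1" by (rule a)+
  show "g \<in> arr G \<Longrightarrow> f1 g \<in> arr H" "x \<in> obj G \<Longrightarrow> f0 x \<in> obj H"
    by (rule continuous_map_point[OF a(2)], assumption, rule continuous_map_point[OF a(1)])
  show "g \<in> arr G \<Longrightarrow> src H (f1 g) = f0 (src G g)" "g \<in> arr G \<Longrightarrow> tgt H (f1 g) = f0 (tgt G g)"
    "x \<in> obj G \<Longrightarrow> f1 (idn G x) = idn H (f0 x)"
    using b c by simp_all
  show "g \<in> arr G \<Longrightarrow> f \<in> arr G \<Longrightarrow> src G g = tgt G f \<Longrightarrow> f1 (mult G g f) = mult H (f1 g) (f1 f)"
    using bspec[OF d, of "(g, f)"] by (simp add: composable_def)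
qed

text \<open>Isotropy groups are kept inside the type of arrows, with the multiplication of the groupoid
  itself, so that formulas about arrows apply to them without translation.\<close>

definition isotropy :: "('x, 'g) tgrpd \<Rightarrow> 'x \<Rightarrow> 'g set" where
  "isotropy G x = {g \<in> arr G. src G g = x \<and> tgt G g = x}"

definition isotropy_group :: "('x, 'g) tgrpd \<Rightarrow> 'x \<Rightarrow> 'g monoid" where
  "isotropy_group G x = \<lparr> carrier = isotropy G x, monoid.mult = mult G, one = idn G x \<rparr>"

definition isotropy_top :: "('x, 'g) tgrpd \<Rightarrow> 'x \<Rightarrow> 'g topology" where
  "isotropy_top G x = subtopology (Arr G) (isotropy G x)"

lemma isotropy_group_simps [simp]:
  "carrier (isotropy_group G x) = isotropy G x"
  "monoid.mult (isotropy_group G x) = mult G"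
  "one (isotropy_group G x) = idn G x"
  by (simp_all add: isotropy_group_def)

lemma topspace_isotropy_top [simp]: "topspace (isotropy_top G x) = isotropy G x"
  by (auto simp: isotropy_top_def isotropy_def)

lemma continuous_map_into_isotropy:
  "continuous_map X (isotropy_top G x) f \<longleftrightarrow>
     continuous_map X (Arr G) f \<and> (\<forall>y\<in>topspace X. f y \<in> isotropy G x)"
  by (auto simp: isotropy_top_def continuous_map_in_subtopology)

lemma continuous_map_from_isotropy:
  "continuous_map (Arr G) Y f \<Longrightarrow> continuous_map (isotropy_top G x) Y f"
  by (simp add: isotropy_top_def continuous_map_from_subtopology)

context topological_groupoid
begin

lemma group_isotropy: "x \<in> obj G \<Longrightarrow> group (isotropy_group G x)"
proof (rule groupI)
  fix g assume "g \<in> carrier (isotropy_group G x)"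
  then show "\<exists>h\<in>carrier (isotropy_group G x). h \<otimes>\<^bsub>isotropy_group G x\<^esub> g = \<one>\<^bsub>isotropy_group G x\<^esub>"
    by (intro bexI[of _ "inve G g"]) (auto simp: isotropy_def)
qed (auto simp: isotropy_def mult_assoc_arr)

lemma m_inv_isotropy:
  assumes "x \<in> obj G" "g \<in> isotropy G x"
  shows "inv\<^bsub>isotropy_group G x\<^esub> g = inve G g"
  by (rule group.inv_equality[OF group_isotropy]) (use assms in \<open>auto simp: isotropy_def\<close>)

lemma topological_group_isotropy:
  assumes x: "x \<in> obj G"
  shows "topological_group (isotropy_group G x) (isotropy_top G x)"
proof (intro topological_group.intro topological_group_axioms.intro group_isotropy[OF x])
  let ?T = "isotropy_top G x"
  have "continuous_map (prod_topology ?T ?T) (Arr G) (\<lambda>p. mult G (fst p) (snd p))"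
  proof (rule continuous_gmult_apply)
    show "continuous_map (prod_topology ?T ?T) (Arr G) fst" "continuous_map (prod_topology ?T ?T) (Arr G) snd"
      using continuous_map_fst[of ?T ?T] continuous_map_snd[of ?T ?T]
      by (simp_all add: continuous_map_into_isotropy)
    show "src G (fst p) = tgt G (snd p)" if "p \<in> topspace (prod_topology ?T ?T)" for p
      using that by (auto simp: isotropy_def)
  qed
  then show "continuous_map (prod_topology ?T ?T) ?T (\<lambda>(g, f). g \<otimes>\<^bsub>isotropy_group G x\<^esub> f)"
    by (auto simp: continuous_map_into_isotropy case_prod_unfold isotropy_def)
  have "continuous_map ?T ?T (inve G)"
    using continuous_inve
    by (auto simp: continuous_map_into_isotropy continuous_map_from_isotropy isotropy_def)
  then show "continuous_map ?T ?T (m_inv (isotropy_group G x))"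
    by (rule continuous_map_eq) (simp add: m_inv_isotropy x)
qed simp

end

section \<open>Groupoid crossed modules and their isotropy\<close>

context crossed_module
begin

sublocale G: topological_groupoid "Grpd \<GG>" by (rule groupoid_Grpd)
sublocale H: group_bundle "Bundle \<GG>" by (rule bundle_Bundle)
sublocale action: groupoid_action "Grpd \<GG>" "Bundle \<GG>" "act \<GG>" by (rule action)

lemma obj_Bundle [simp]: "Obj (Bundle \<GG>) = Obj (Grpd \<GG>)" by (rule same_units)

lemma tgt_Bundle [simp]: "h \<in> arr (Bundle \<GG>) \<Longrightarrow> tgt (Bundle \<GG>) h = src (Bundle \<GG>) h"
  by (simp add: H.src_eq_tgt)

lemma src_obj [simp]: "h \<in> arr (Bundle \<GG>) \<Longrightarrow> src (Bundle \<GG>) h \<in> obj (Grpd \<GG>)"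
  using H.src_closed by simp

lemma fibre_iff: "h \<in> fibre (Bundle \<GG>) x \<longleftrightarrow> h \<in> arr (Bundle \<GG>) \<and> src (Bundle \<GG>) h = x"
  by (simp add: fibre_def)

lemma isotropy_Bundle: "isotropy (Bundle \<GG>) x = fibre (Bundle \<GG>) x"
  by (auto simp: isotropy_def fibre_def)

lemma bdry_simps [simp]:
  assumes "h \<in> arr (Bundle \<GG>)"
  shows "bdry \<GG> h \<in> arr (Grpd \<GG>)" "src (Grpd \<GG>) (bdry \<GG> h) = src (Bundle \<GG>) h"
    "tgt (Grpd \<GG>) (bdry \<GG> h) = src (Bundle \<GG>) h"
proof -
  have "continuous_map (Arr (Bundle \<GG>)) (Arr (Grpd \<GG>)) (bdry \<GG>)"
    using bdry_morphism by (simp add: strict_morphism_def)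
  from continuous_map_point[OF this assms] show "bdry \<GG> h \<in> arr (Grpd \<GG>)" .
  show "src (Grpd \<GG>) (bdry \<GG> h) = src (Bundle \<GG>) h"
    "tgt (Grpd \<GG>) (bdry \<GG> h) = src (Bundle \<GG>) h"
    using bdry_morphism assms by (simp_all add: strict_morphism_def)
qed

lemma continuous_bdry: "continuous_map (Arr (Bundle \<GG>)) (Arr (Grpd \<GG>)) (bdry \<GG>)"
  using bdry_morphism by (simp add: strict_morphism_def)

lemma continuous_bdry_apply:
  "continuous_map X (Arr (Bundle \<GG>)) f \<Longrightarrow> continuous_map X (Arr (Grpd \<GG>)) (\<lambda>x. bdry \<GG> (f x))"
  by (rule continuous_map_apply[OF continuous_bdry])

lemma bdry_idn [simp]: "x \<in> obj (Grpd \<GG>) \<Longrightarrow> bdry \<GG> (idn (Bundle \<GG>) x) = idn (Grpd \<GG>) x"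
  using bdry_morphism by (simp add: strict_morphism_def)

lemma bdry_mult:
  "h \<in> arr (Bundle \<GG>) \<Longrightarrow> k \<in> arr (Bundle \<GG>) \<Longrightarrow> src (Bundle \<GG>) h = src (Bundle \<GG>) k \<Longrightarrow>
    bdry \<GG> (mult (Bundle \<GG>) h k) = mult (Grpd \<GG>) (bdry \<GG> h) (bdry \<GG> k)"
  using strict_morphismD(6)[OF bdry_morphism, of h k] by simp

lemma bdry_inve:
  assumes "h \<in> arr (Bundle \<GG>)"
  shows "bdry \<GG> (inve (Bundle \<GG>) h) = inve (Grpd \<GG>) (bdry \<GG> h)"
proof (rule G.inve_unique)
  have "bdry \<GG> (mult (Bundle \<GG>) (inve (Bundle \<GG>) h) h) =
    mult (Grpd \<GG>) (bdry \<GG> (inve (Bundle \<GG>) h)) (bdry \<GG> h)"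
    using assms by (intro bdry_mult) simp_all
  then show "mult (Grpd \<GG>) (bdry \<GG> (inve (Bundle \<GG>) h)) (bdry \<GG> h) =
    idn (Grpd \<GG>) (src (Grpd \<GG>) (bdry \<GG> h))"
    using assms by simp
qed (use assms in simp_all)

lemma act_closed [simp]:
  assumes "h \<in> arr (Bundle \<GG>)" "g \<in> arr (Grpd \<GG>)" "src (Bundle \<GG>) h = tgt (Grpd \<GG>) g"
  shows "act \<GG> h g \<in> arr (Bundle \<GG>)" "src (Bundle \<GG>) (act \<GG> h g) = src (Grpd \<GG>) g"
proof -
  have "act \<GG> h g \<in> topspace (subtopology (Arr (Bundle \<GG>)) (fibre (Bundle \<GG>) (src (Grpd \<GG>) g)))"
    using continuous_map_point[OF homeomorphic_imp_continuous_map[OF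
        action.homeomorphic_act[OF assms(2)]], of h] assms
    by (simp add: fibre_iff)
  then show "act \<GG> h g \<in> arr (Bundle \<GG>)" "src (Bundle \<GG>) (act \<GG> h g) = src (Grpd \<GG>) g"
    by (simp_all add: fibre_iff)
qed

lemma act_mult:
  "h \<in> arr (Bundle \<GG>) \<Longrightarrow> k \<in> arr (Bundle \<GG>) \<Longrightarrow> g \<in> arr (Grpd \<GG>) \<Longrightarrow>
    src (Bundle \<GG>) h = tgt (Grpd \<GG>) g \<Longrightarrow> src (Bundle \<GG>) k = tgt (Grpd \<GG>) g \<Longrightarrow>
    act \<GG> (mult (Bundle \<GG>) h k) g = mult (Bundle \<GG>) (act \<GG> h g) (act \<GG> k g)"
  by (rule action.act_mult) (simp_all add: fibre_iff)

lemma act_comp: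
  "h \<in> arr (Bundle \<GG>) \<Longrightarrow> g \<in> arr (Grpd \<GG>) \<Longrightarrow> f \<in> arr (Grpd \<GG>) \<Longrightarrow>
    src (Bundle \<GG>) h = tgt (Grpd \<GG>) g \<Longrightarrow> src (Grpd \<GG>) g = tgt (Grpd \<GG>) f \<Longrightarrow>
    act \<GG> h (mult (Grpd \<GG>) g f) = act \<GG> (act \<GG> h g) f"
  by (rule action.act_comp) (simp_all add: fibre_iff composable_def)

lemma act_idn [simp]:
  "h \<in> arr (Bundle \<GG>) \<Longrightarrow> x = src (Bundle \<GG>) h \<Longrightarrow> act \<GG> h (idn (Grpd \<GG>) x) = h"
  using action.act_idn[of "src (Bundle \<GG>) h" h] by (simp add: fibre_iff)

lemma idn_act [simp]:
  assumes "g \<in> arr (Grpd \<GG>)" "x = tgt (Grpd \<GG>) g"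
  shows "act \<GG> (idn (Bundle \<GG>) x) g = idn (Bundle \<GG>) (src (Grpd \<GG>) g)"
proof -
  let ?h = "act \<GG> (idn (Bundle \<GG>) x) g"
  have x: "x \<in> obj (Grpd \<GG>)" using assms by simp
  then have i: "idn (Bundle \<GG>) x \<in> arr (Bundle \<GG>)" "src (Bundle \<GG>) (idn (Bundle \<GG>) x) = x"
    using H.idn_closed H.src_idn by simp_all
  have h: "?h \<in> arr (Bundle \<GG>)" "src (Bundle \<GG>) ?h = src (Grpd \<GG>) g"
    using assms i by simp_all
  have "mult (Bundle \<GG>) ?h ?h = ?h"
    using act_mult[of "idn (Bundle \<GG>) x" "idn (Bundle \<GG>) x" g] assms i by simp
  then have "mult (Bundle \<GG>) ?h ?h = mult (Bundle \<GG>) ?h (idn (Bundle \<GG>) (src (Grpd \<GG>) g))"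
    using h by simp
  moreover have "idn (Bundle \<GG>) (src (Grpd \<GG>) g) \<in> arr (Bundle \<GG>)"
    "tgt (Bundle \<GG>) (idn (Bundle \<GG>) (src (Grpd \<GG>) g)) = src (Grpd \<GG>) g"
    using assms H.tgt_idn[of "src (Grpd \<GG>) g"] H.idn_closed[of "src (Grpd \<GG>) g"] by simp_all
  ultimately show ?thesis
    using H.mult_left_cancel[of ?h ?h "idn (Bundle \<GG>) (src (Grpd \<GG>) g)"] h by simp
qed

lemma bdry_act_arr:
  "h \<in> arr (Bundle \<GG>) \<Longrightarrow> g \<in> arr (Grpd \<GG>) \<Longrightarrow> src (Bundle \<GG>) h = tgt (Grpd \<GG>) g \<Longrightarrow>
    bdry \<GG> (act \<GG> h g) = mult (Grpd \<GG>) (mult (Grpd \<GG>) (inve (Grpd \<GG>) g) (bdry \<GG> h)) g"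
  by (rule bdry_act) (simp_all add: fibre_iff)

lemma act_bdry:
  "h \<in> arr (Bundle \<GG>) \<Longrightarrow> k \<in> arr (Bundle \<GG>) \<Longrightarrow> src (Bundle \<GG>) h = src (Bundle \<GG>) k \<Longrightarrow>
    act \<GG> k (bdry \<GG> h) = mult (Bundle \<GG>) (mult (Bundle \<GG>) (inve (Bundle \<GG>) h) k) h"
  by (rule peiffer[of _ "src (Bundle \<GG>) h"]) (simp_all add: fibre_iff)

lemma continuous_act_apply:
  "continuous_map X (Arr (Bundle \<GG>)) f \<Longrightarrow> continuous_map X (Arr (Grpd \<GG>)) g \<Longrightarrow>
    (\<And>x. x \<in> topspace X \<Longrightarrow> src (Bundle \<GG>) (f x) = tgt (Grpd \<GG>) (g x)) \<Longrightarrow>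
    continuous_map X (Arr (Bundle \<GG>)) (\<lambda>x. act \<GG> (f x) (g x))"
  by (rule continuous_map_binop[OF action.continuous_act]) simp_all

end

definition isotropy_xmod :: "('x, 'g, 'h) xmod \<Rightarrow> 'x \<Rightarrow> ('g, 'h) group_xmod" where
  "isotropy_xmod \<GG> x =
     \<lparr> base = isotropy_group (Grpd \<GG>) x, base_top = isotropy_top (Grpd \<GG>) x,
       top_grp = isotropy_group (Bundle \<GG>) x, top_top = isotropy_top (Bundle \<GG>) x,
       bd = bdry \<GG>, ac = act \<GG> \<rparr>"

lemma isotropy_xmod_simps [simp]:
  "base (isotropy_xmod \<GG> x) = isotropy_group (Grpd \<GG>) x"
  "base_top (isotropy_xmod \<GG> x) = isotropy_top (Grpd \<GG>) x"
  "top_grp (isotropy_xmod \<GG> x) = isotropy_group (Bundle \<GG>) x"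
  "top_top (isotropy_xmod \<GG> x) = isotropy_top (Bundle \<GG>) x"
  "bd (isotropy_xmod \<GG> x) = bdry \<GG>"
  "ac (isotropy_xmod \<GG> x) = act \<GG>"
  by (simp_all add: isotropy_xmod_def)

lemma (in crossed_module) topological_group_xmod_isotropy:
  assumes x: "x \<in> obj (Grpd \<GG>)"
  shows "topological_group_xmod (isotropy_xmod \<GG> x)"
proof (intro topological_group_xmod.intro)
  have xB: "x \<in> obj (Bundle \<GG>)" using x by simp
  note iso = isotropy_def[of "Grpd \<GG>" x] isotropy_Bundle fibre_iff
  show "topological_group (base (isotropy_xmod \<GG> x)) (base_top (isotropy_xmod \<GG> x))"
    using G.topological_group_isotropy[OF x] by simp
  show "topological_group (top_grp (isotropy_xmod \<GG> x)) (top_top (isotropy_xmod \<GG> x))"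
    using H.topological_group_isotropy[OF xB] by simp
  show "bd (isotropy_xmod \<GG> x) \<in> hom (top_grp (isotropy_xmod \<GG> x)) (base (isotropy_xmod \<GG> x))"
    by (rule homI) (simp_all add: iso bdry_mult)
  show "continuous_map (top_top (isotropy_xmod \<GG> x)) (base_top (isotropy_xmod \<GG> x))
    (bd (isotropy_xmod \<GG> x))"
    using continuous_bdry
    by (simp add: continuous_map_into_isotropy continuous_map_from_isotropy) (simp add: iso)
  let ?HT = "isotropy_top (Bundle \<GG>) x" and ?GT = "isotropy_top (Grpd \<GG>) x"
  have "continuous_map (prod_topology ?HT ?GT) (Arr (Bundle \<GG>)) (\<lambda>p. act \<GG> (fst p) (snd p))"
  proof (rule continuous_act_apply)
    show "continuous_map (prod_topology ?HT ?GT) (Arr (Bundle \<GG>)) fst"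
      "continuous_map (prod_topology ?HT ?GT) (Arr (Grpd \<GG>)) snd"
      using continuous_map_fst[of ?HT ?GT] continuous_map_snd[of ?HT ?GT]
      by (simp_all add: continuous_map_into_isotropy)
    show "src (Bundle \<GG>) (fst p) = tgt (Grpd \<GG>) (snd p)" if "p \<in> topspace (prod_topology ?HT ?GT)" for p
      using that by (auto simp: iso)
  qed
  then show "continuous_map
     (prod_topology (top_top (isotropy_xmod \<GG> x)) (base_top (isotropy_xmod \<GG> x)))
     (top_top (isotropy_xmod \<GG> x)) (\<lambda>(h, g). ac (isotropy_xmod \<GG> x) h g)"
    by (auto simp: continuous_map_into_isotropy case_prod_unfold iso)
next
  have inv: "inv\<^bsub>isotropy_group (Grpd \<GG>) x\<^esub> g = inve (Grpd \<GG>) g" if "g \<in> isotropy (Grpd \<GG>) x" for g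
    by (rule G.m_inv_isotropy[OF x that])
  have inv': "inv\<^bsub>isotropy_group (Bundle \<GG>) x\<^esub> h = inve (Bundle \<GG>) h"
    if "h \<in> isotropy (Bundle \<GG>) x" for h
    using H.m_inv_isotropy[OF _ that] x by simp
  fix h k g f
  assume "h \<in> carrier (top_grp (isotropy_xmod \<GG> x))"
  then have h: "h \<in> arr (Bundle \<GG>)" "src (Bundle \<GG>) h = x" "h \<in> isotropy (Bundle \<GG>) x"
    by (simp_all add: isotropy_Bundle fibre_iff)
  show "ac (isotropy_xmod \<GG> x) h \<one>\<^bsub>base (isotropy_xmod \<GG> x)\<^esub> = h" using h by simp
  show "ac (isotropy_xmod \<GG> x) k (bd (isotropy_xmod \<GG> x) h) =
      inv\<^bsub>top_grp (isotropy_xmod \<GG> x)\<^esub> h \<otimes>\<^bsub>top_grp (isotropy_xmod \<GG> x)\<^esub> k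
        \<otimes>\<^bsub>top_grp (isotropy_xmod \<GG> x)\<^esub> h"
    if "k \<in> carrier (top_grp (isotropy_xmod \<GG> x))"
    using that h by (simp add: inv' act_bdry isotropy_Bundle fibre_iff)
  assume "g \<in> carrier (base (isotropy_xmod \<GG> x))"
  then have g: "g \<in> arr (Grpd \<GG>)" "src (Grpd \<GG>) g = x" "tgt (Grpd \<GG>) g = x"
    "g \<in> isotropy (Grpd \<GG>) x"
    by (simp_all add: isotropy_def)
  show "bd (isotropy_xmod \<GG> x) (ac (isotropy_xmod \<GG> x) h g) =
      inv\<^bsub>base (isotropy_xmod \<GG> x)\<^esub> g \<otimes>\<^bsub>base (isotropy_xmod \<GG> x)\<^esub> bd (isotropy_xmod \<GG> x) h
        \<otimes>\<^bsub>base (isotropy_xmod \<GG> x)\<^esub> g"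
    using h g by (simp add: inv bdry_act_arr)
  show "ac (isotropy_xmod \<GG> x) h (g \<otimes>\<^bsub>base (isotropy_xmod \<GG> x)\<^esub> f) =
      ac (isotropy_xmod \<GG> x) (ac (isotropy_xmod \<GG> x) h g) f"
    if "f \<in> carrier (base (isotropy_xmod \<GG> x))"
    using that h g by (simp add: act_comp isotropy_def)
  show "ac (isotropy_xmod \<GG> x) (h \<otimes>\<^bsub>top_grp (isotropy_xmod \<GG> x)\<^esub> k) g =
      ac (isotropy_xmod \<GG> x) h g \<otimes>\<^bsub>top_grp (isotropy_xmod \<GG> x)\<^esub> ac (isotropy_xmod \<GG> x) k g"
    if "k \<in> carrier (top_grp (isotropy_xmod \<GG> x))"
    using that h g by (simp add: act_mult isotropy_Bundle fibre_iff)
qed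

section \<open>Hypercovers\<close>

definition connected_by :: "('x, 'g) tgrpd \<Rightarrow> 'x \<Rightarrow> 'x \<Rightarrow> bool" where
  "connected_by G x y \<longleftrightarrow> (\<exists>g\<in>arr G. src G g = x \<and> tgt G g = y)"

context topological_groupoid
begin

lemma connected_by_obj: "connected_by G x y \<Longrightarrow> x \<in> obj G \<and> y \<in> obj G"
  by (auto simp: connected_by_def)

lemma connected_by_refl: "x \<in> obj G \<Longrightarrow> connected_by G x x"
  unfolding connected_by_def by (intro bexI[of _ "idn G x"]) simp_all

lemma connected_by_sym:
  assumes "connected_by G x y" shows "connected_by G y x"
proof -
  obtain g where "g \<in> arr G" "src G g = x" "tgt G g = y" using assms unfolding connected_by_def by blast
  then show ?thesis unfolding connected_by_def by (intro bexI[of _ "inve G g"]) simp_all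
qed

lemma connected_by_trans:
  assumes "connected_by G x y" "connected_by G y z" shows "connected_by G x z"
proof -
  obtain f where f: "f \<in> arr G" "src G f = x" "tgt G f = y"
    using assms(1) unfolding connected_by_def by blast
  obtain g where g: "g \<in> arr G" "src G g = y" "tgt G g = z"
    using assms(2) unfolding connected_by_def by blast
  show ?thesis unfolding connected_by_def using f g by (intro bexI[of _ "mult G g f"]) simp_all
qed

text \<open>Essential surjectivity depends only on the set of orbits met by \<open>\<sigma>\<close>.\<close>

lemma essentially_surjective_iff:
  "essentially_surjective Z \<sigma> G \<longleftrightarrow> (\<forall>x\<in>obj G. \<exists>z\<in>topspace Z. connected_by G x (\<sigma> z))"
proof -
  have "(\<lambda>(z, \<gamma>). src G \<gamma>) ` {(z, \<gamma>). z \<in> topspace Z \<and> \<gamma> \<in> arr G \<and> \<sigma> z = tgt G \<gamma>} =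
      {x. \<exists>z\<in>topspace Z. connected_by G x (\<sigma> z)}"
    by (force simp: connected_by_def image_iff)
  moreover have "{x. \<exists>z\<in>topspace Z. connected_by G x (\<sigma> z)} \<subseteq> obj G"
    using connected_by_obj by blast
  ultimately show ?thesis unfolding essentially_surjective_def by auto
qed

lemma orbit_representatives:
  obtains W where "W \<subseteq> obj G" "\<And>x. x \<in> obj G \<Longrightarrow> \<exists>w\<in>W. connected_by G x w"
    "\<And>w w'. w \<in> W \<Longrightarrow> w' \<in> W \<Longrightarrow> connected_by G w w' \<Longrightarrow> w = w'"
proof
  define r where "r x = (SOME x'. connected_by G x x')" for x
  have r: "connected_by G x (r x)" if "x \<in> obj G" for x
    unfolding r_def by (rule someI[of _ x]) (rule connected_by_refl[OF that])
  have r_eq: "r x = r y" if "connected_by G x y" for x y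
  proof -
    have "connected_by G x = connected_by G y"
      using that connected_by_sym connected_by_trans by blast
    then show ?thesis by (simp add: r_def)
  qed
  show "r ` obj G \<subseteq> obj G" using r connected_by_obj by blast
  show "\<exists>w\<in>r ` obj G. connected_by G x w" if "x \<in> obj G" for x using r[OF that] that by blast
  fix w w' assume w: "w \<in> r ` obj G" "w' \<in> r ` obj G" "connected_by G w w'"
  have "r w = w" if "w \<in> r ` obj G" for w using that r r_eq by (metis imageE)
  then show "w = w'" using r_eq[OF w(3)] w(1,2) by metis
qed

end

text \<open>The 2-arrows of the associated 2-groupoid and their targets, in terms of the crossed
  module alone.\<close>

definition arrows2 :: "('x, 'g, 'h) xmod \<Rightarrow> ('h \<times> 'g) topology" where
  "arrows2 \<GG> = subtopology (prod_topology (Arr (Bundle \<GG>)) (Arr (Grpd \<GG>)))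
     {(h, g). h \<in> fibre (Bundle \<GG>) (tgt (Grpd \<GG>) g)}"

definition target2 :: "('x, 'g, 'h) xmod \<Rightarrow> 'h \<times> 'g \<Rightarrow> 'g" where
  "target2 \<GG> b = mult (Grpd \<GG>) (bdry \<GG> (fst b)) (snd b)"

lemma assoc_two_grpd_simps:
  "Hor (assoc_two_grpd \<GG>) = Grpd \<GG>"
  "Obj (Ver (assoc_two_grpd \<GG>)) = Arr (Grpd \<GG>)"
  "Arr (Ver (assoc_two_grpd \<GG>)) = arrows2 \<GG>"
  "src (Ver (assoc_two_grpd \<GG>)) = snd"
  "tgt (Ver (assoc_two_grpd \<GG>)) = target2 \<GG>"
  "idn (Ver (assoc_two_grpd \<GG>)) = (\<lambda>g. (idn (Bundle \<GG>) (tgt (Grpd \<GG>) g), g))"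
  "mult (Ver (assoc_two_grpd \<GG>)) = (\<lambda>b a. (mult (Bundle \<GG>) (fst b) (fst a), snd a))"
  "inve (Ver (assoc_two_grpd \<GG>)) = (\<lambda>b. (inve (Bundle \<GG>) (fst b), target2 \<GG> b))"
  "hcomp (assoc_two_grpd \<GG>) = (\<lambda>b a.
     (mult (Bundle \<GG>) (fst b) (act \<GG> (fst a) (inve (Grpd \<GG>) (snd b))), mult (Grpd \<GG>) (snd b) (snd a)))"
  by (simp_all add: assoc_two_grpd_def Let_def arrows2_def fun_eq_iff target2_def split: prod.splits)

text \<open>The second and third conditions on a weak equivalence, read for crossed modules: every arrow
  between images is isomorphic by a 2-arrow to the image of an arrow with the prescribed ends, and
  2-arrows form a pullback.\<close>

definition fullness :: "('x, 'g, 'h) xmod \<Rightarrow> ('y, 'k, 'l) xmod \<Rightarrow> ('x \<Rightarrow> 'y) \<Rightarrow> ('g \<Rightarrow> 'k) \<Rightarrow> bool" where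
  "fullness \<GG>1 \<GG>2 \<chi>0 \<chi>G \<longleftrightarrow>
     (\<forall>z1\<in>obj (Grpd \<GG>1). \<forall>z2\<in>obj (Grpd \<GG>1). \<forall>g\<in>arr (Grpd \<GG>2).
        tgt (Grpd \<GG>2) g = \<chi>0 z1 \<and> src (Grpd \<GG>2) g = \<chi>0 z2 \<longrightarrow>
        (\<exists>f\<in>arr (Grpd \<GG>1). \<exists>h\<in>fibre (Bundle \<GG>2) (tgt (Grpd \<GG>2) g).
           tgt (Grpd \<GG>1) f = z1 \<and> src (Grpd \<GG>1) f = z2 \<and> \<chi>G f = mult (Grpd \<GG>2) (bdry \<GG>2 h) g))"

definition faithfulness ::
    "('x, 'g, 'h) xmod \<Rightarrow> ('y, 'k, 'l) xmod \<Rightarrow> ('g \<Rightarrow> 'k) \<Rightarrow> ('h \<Rightarrow> 'l) \<Rightarrow> bool" where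
  "faithfulness \<GG>1 \<GG>2 \<chi>G \<chi>H \<longleftrightarrow>
     homeomorphic_map (arrows2 \<GG>1)
       (subtopology (prod_topology (arrows2 \<GG>2) (prod_topology (Arr (Grpd \<GG>1)) (Arr (Grpd \<GG>1))))
          {(b, g, g'). snd b = \<chi>G g \<and> target2 \<GG>2 b = \<chi>G g'})
       (\<lambda>a. (map_prod \<chi>H \<chi>G a, snd a, target2 \<GG>1 a))"

lemma topspace_arrows2: "topspace (arrows2 \<GG>) =
    {(h, g). h \<in> fibre (Bundle \<GG>) (tgt (Grpd \<GG>) g) \<and> g \<in> arr (Grpd \<GG>)}"
  by (auto simp: arrows2_def fibre_def)

lemma arr_pullback_grpd: "arr (pullback_grpd Z \<sigma> G) =
    {(z1, g, z2). z1 \<in> topspace Z \<and> z2 \<in> topspace Z \<and> g \<in> arr G \<and> tgt G g = \<sigma> z1 \<and> src G g = \<sigma> z2}"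
  by (auto simp: pullback_grpd_def)

text \<open>A 2-arrow has parallel source and target, so the canonical map always takes values in the
  pullback, and only surjectivity has content.\<close>

lemma fullness_iff:
  assumes "crossed_module \<GG>2" and "strict_morphism (Grpd \<GG>1) (Grpd \<GG>2) \<chi>0 \<chi>G"
    and G1: "topological_groupoid (Grpd \<GG>1)"
  shows "(\<lambda>(g, b). (tgt (Grpd \<GG>1) g, snd b, src (Grpd \<GG>1) g)) `
         {(g, b). g \<in> arr (Grpd \<GG>1) \<and> b \<in> topspace (arrows2 \<GG>2) \<and> \<chi>G g = target2 \<GG>2 b}
       = arr (pullback_grpd (Obj (Grpd \<GG>1)) \<chi>0 (Grpd \<GG>2)) \<longleftrightarrow> fullness \<GG>1 \<GG>2 \<chi>0 \<chi>G"
    (is "?f ` ?S = ?P \<longleftrightarrow> _")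
proof -
  interpret G2: crossed_module \<GG>2 by fact
  interpret G1: topological_groupoid "Grpd \<GG>1" by (rule G1)
  have "?f ` ?S \<subseteq> ?P"
  proof (intro image_subsetI)
    fix p assume "p \<in> ?S"
    then obtain f h g where p: "p = (f, (h, g))" "f \<in> arr (Grpd \<GG>1)" "g \<in> arr (Grpd \<GG>2)"
      "h \<in> arr (Bundle \<GG>2)" "src (Bundle \<GG>2) h = tgt (Grpd \<GG>2) g"
      "\<chi>G f = mult (Grpd \<GG>2) (bdry \<GG>2 h) g"
      by (auto simp: topspace_arrows2 G2.fibre_iff target2_def)
    have "src (Grpd \<GG>2) (\<chi>G f) = \<chi>0 (src (Grpd \<GG>1) f)" "tgt (Grpd \<GG>2) (\<chi>G f) = \<chi>0 (tgt (Grpd \<GG>1) f)"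
      using assms(2) p(2) by (simp_all add: strict_morphism_def)
    then show "?f p \<in> ?P" using p by (simp add: arr_pullback_grpd)
  qed
  moreover have "?P \<subseteq> ?f ` ?S \<longleftrightarrow> fullness \<GG>1 \<GG>2 \<chi>0 \<chi>G"
  proof
    assume sub: "?P \<subseteq> ?f ` ?S"
    show "fullness \<GG>1 \<GG>2 \<chi>0 \<chi>G"
      unfolding fullness_def
    proof (intro ballI impI)
      fix z1 z2 g assume "z1 \<in> obj (Grpd \<GG>1)" "z2 \<in> obj (Grpd \<GG>1)" "g \<in> arr (Grpd \<GG>2)"
        "tgt (Grpd \<GG>2) g = \<chi>0 z1 \<and> src (Grpd \<GG>2) g = \<chi>0 z2"
      then have "(z1, g, z2) \<in> ?P" by (simp add: arr_pullback_grpd)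
      then have "(z1, g, z2) \<in> ?f ` ?S" using sub by blast
      then obtain p where p: "p \<in> ?S" "(z1, g, z2) = ?f p" by (rule imageE)
      then show "\<exists>f\<in>arr (Grpd \<GG>1). \<exists>h\<in>fibre (Bundle \<GG>2) (tgt (Grpd \<GG>2) g).
           tgt (Grpd \<GG>1) f = z1 \<and> src (Grpd \<GG>1) f = z2 \<and> \<chi>G f = mult (Grpd \<GG>2) (bdry \<GG>2 h) g"
        by (intro bexI[of _ "fst p"] bexI[of _ "fst (snd p)"])
          (auto simp: topspace_arrows2 target2_def)
    qed
  next
    assume full: "fullness \<GG>1 \<GG>2 \<chi>0 \<chi>G"
    show "?P \<subseteq> ?f ` ?S"
    proof
      fix q assume "q \<in> ?P"
      then obtain z1 g z2 where q: "q = (z1, g, z2)" "z1 \<in> obj (Grpd \<GG>1)" "z2 \<in> obj (Grpd \<GG>1)"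
        "g \<in> arr (Grpd \<GG>2)" "tgt (Grpd \<GG>2) g = \<chi>0 z1" "src (Grpd \<GG>2) g = \<chi>0 z2"
        by (auto simp: arr_pullback_grpd)
      then obtain f h where f: "f \<in> arr (Grpd \<GG>1)" "h \<in> fibre (Bundle \<GG>2) (tgt (Grpd \<GG>2) g)"
        "tgt (Grpd \<GG>1) f = z1" "src (Grpd \<GG>1) f = z2" "\<chi>G f = mult (Grpd \<GG>2) (bdry \<GG>2 h) g"
        using full unfolding fullness_def by metis
      then show "q \<in> ?f ` ?S"
        using q by (intro image_eqI[of _ _ "(f, (h, g))"]) (auto simp: topspace_arrows2 target2_def)
    qed
  qed
  ultimately show ?thesis by blast
qed

lemma hypercoverD:
  assumes "hypercover \<GG>1 \<GG>2 \<chi>0 \<chi>G \<chi>H" and "crossed_module \<GG>1" "crossed_module \<GG>2"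
  shows "strict_xmod_morphism \<GG>1 \<GG>2 \<chi>0 \<chi>G \<chi>H"
    and "essentially_surjective (Obj (Grpd \<GG>1)) \<chi>0 (Grpd \<GG>2)"
    and "fullness \<GG>1 \<GG>2 \<chi>0 \<chi>G"
    and "faithfulness \<GG>1 \<GG>2 \<chi>G \<chi>H"
proof -
  have w: "weak_equivalence (assoc_two_grpd \<GG>1) (assoc_two_grpd \<GG>2) \<chi>0 \<chi>G (map_prod \<chi>H \<chi>G)"
    and m: "strict_xmod_morphism \<GG>1 \<GG>2 \<chi>0 \<chi>G \<chi>H"
    using assms(1) by (simp_all add: hypercover_def)
  show "strict_xmod_morphism \<GG>1 \<GG>2 \<chi>0 \<chi>G \<chi>H" by (rule m)
  then have s: "strict_morphism (Grpd \<GG>1) (Grpd \<GG>2) \<chi>0 \<chi>G" by (simp add: strict_xmod_morphism_def)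
  note w' = w[unfolded weak_equivalence_def assoc_two_grpd_simps
    fullness_iff[OF assms(3) s crossed_module.groupoid_Grpd[OF assms(2)]]]
  show "essentially_surjective (Obj (Grpd \<GG>1)) \<chi>0 (Grpd \<GG>2)" "fullness \<GG>1 \<GG>2 \<chi>0 \<chi>G"
    using w' by blast+
  show "faithfulness \<GG>1 \<GG>2 \<chi>G \<chi>H"
    unfolding faithfulness_def using w' by blast
qed

section \<open>Hypercovers on isotropy\<close>

lemma faithfulnessD:
  assumes "faithfulness \<GG>1 \<GG>2 \<chi>G \<chi>H"
  defines "E \<equiv> inv_into (topspace (arrows2 \<GG>1)) (\<lambda>a. (map_prod \<chi>H \<chi>G a, snd a, target2 \<GG>1 a))"
    and "Y \<equiv> subtopology (prod_topology (arrows2 \<GG>2) (prod_topology (Arr (Grpd \<GG>1)) (Arr (Grpd \<GG>1))))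
          {(b, g, g'). snd b = \<chi>G g \<and> target2 \<GG>2 b = \<chi>G g'}"
  shows "continuous_map Y (arrows2 \<GG>1) E"
    and "\<And>h g. h \<in> fibre (Bundle \<GG>1) (tgt (Grpd \<GG>1) g) \<Longrightarrow> g \<in> arr (Grpd \<GG>1) \<Longrightarrow>
      E ((\<chi>H h, \<chi>G g), g, target2 \<GG>1 (h, g)) = (h, g)"
    and "\<And>b g g'. b \<in> topspace (arrows2 \<GG>2) \<Longrightarrow> g \<in> arr (Grpd \<GG>1) \<Longrightarrow> g' \<in> arr (Grpd \<GG>1) \<Longrightarrow>
      snd b = \<chi>G g \<Longrightarrow> target2 \<GG>2 b = \<chi>G g' \<Longrightarrow>
      \<exists>h. E (b, g, g') = (h, g) \<and> h \<in> fibre (Bundle \<GG>1) (tgt (Grpd \<GG>1) g) \<and>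
        b = (\<chi>H h, \<chi>G g) \<and> g' = target2 \<GG>1 (h, g)"
proof -
  have hom: "homeomorphic_map (arrows2 \<GG>1) Y (\<lambda>a. (map_prod \<chi>H \<chi>G a, snd a, target2 \<GG>1 a))"
    using assms(1) by (simp add: faithfulness_def Y_def)
  note inv = homeomorphic_map_inverse[OF hom, folded E_def]
  show "continuous_map Y (arrows2 \<GG>1) E" by (rule inv(2))
  show "E ((\<chi>H h, \<chi>G g), g, target2 \<GG>1 (h, g)) = (h, g)"
    if "h \<in> fibre (Bundle \<GG>1) (tgt (Grpd \<GG>1) g)" "g \<in> arr (Grpd \<GG>1)" for h g
    using inv(3)[of "(h, g)"] that by (simp add: topspace_arrows2)
  show "\<exists>h. E (b, g, g') = (h, g) \<and> h \<in> fibre (Bundle \<GG>1) (tgt (Grpd \<GG>1) g) \<and>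
        b = (\<chi>H h, \<chi>G g) \<and> g' = target2 \<GG>1 (h, g)"
    if b: "b \<in> topspace (arrows2 \<GG>2)" "g \<in> arr (Grpd \<GG>1)" "g' \<in> arr (Grpd \<GG>1)"
      "snd b = \<chi>G g" "target2 \<GG>2 b = \<chi>G g'" for b g g'
  proof -
    have y: "(b, g, g') \<in> topspace Y" using b by (simp add: Y_def)
    obtain h f where hf: "E (b, g, g') = (h, f)" by (rule prod.exhaust)
    have "(h, f) \<in> topspace (arrows2 \<GG>1)" using continuous_map_point[OF inv(2) y] hf by simp
    moreover have "b = (\<chi>H h, \<chi>G f)" "f = g" "g' = target2 \<GG>1 (h, f)"
      using inv(4)[OF y] hf by auto
    ultimately show ?thesis using hf by (auto simp: topspace_arrows2)
  qed
qed

text \<open>An arrow \<open>\<gamma>\<close> from \<open>\<chi>0 x\<close> to \<open>y\<close> carries the isotropy at \<open>\<chi>0 x\<close> to the isotropy at \<open>y\<close>: by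
  conjugation on arrows, by the action of the inverse of \<open>\<gamma>\<close> on the bundle. Fullness, applied to
  loops, and faithfulness, applied to the 2-arrows that start at the identity of \<open>x\<close>, then become the
  two conditions on a weak equivalence of crossed modules of groups.\<close>

lemma hypercover_isotropy:
  fixes \<GG>1 :: "('x, 'g, 'h) xmod" and \<GG>2 :: "('y, 'k, 'l) xmod"
  assumes X1: "crossed_module \<GG>1" and X2: "crossed_module \<GG>2"
    and cover: "hypercover \<GG>1 \<GG>2 \<chi>0 \<chi>G \<chi>H" and x: "x \<in> obj (Grpd \<GG>1)"
    and \<gamma>: "\<gamma> \<in> arr (Grpd \<GG>2)" "src (Grpd \<GG>2) \<gamma> = \<chi>0 x" "tgt (Grpd \<GG>2) \<gamma> = y"
  shows "group_weak_equivalence (isotropy_xmod \<GG>1 x) (isotropy_xmod \<GG>2 y)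
    (\<lambda>g. mult (Grpd \<GG>2) (mult (Grpd \<GG>2) \<gamma> (\<chi>G g)) (inve (Grpd \<GG>2) \<gamma>))
    (\<lambda>h. act \<GG>2 (\<chi>H h) (inve (Grpd \<GG>2) \<gamma>))"
    (is "group_weak_equivalence ?A ?B ?c ?d")
proof -
  interpret X1: crossed_module \<GG>1 by (rule X1)
  interpret X2: crossed_module \<GG>2 by (rule X2)
  let ?G1 = "Grpd \<GG>1" and ?G2 = "Grpd \<GG>2" and ?H1 = "Bundle \<GG>1" and ?H2 = "Bundle \<GG>2"
  note cover = hypercoverD[OF cover X1 X2]
  have mG: "strict_morphism ?G1 ?G2 \<chi>0 \<chi>G" and mH: "strict_morphism ?H1 ?H2 \<chi>0 \<chi>H"
    and chi_bdry: "\<And>h. h \<in> arr ?H1 \<Longrightarrow> \<chi>G (bdry \<GG>1 h) = bdry \<GG>2 (\<chi>H h)"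
    and chi_act: "\<And>g h. g \<in> arr ?G1 \<Longrightarrow> h \<in> fibre ?H1 (tgt ?G1 g) \<Longrightarrow>
        \<chi>H (act \<GG>1 h g) = act \<GG>2 (\<chi>H h) (\<chi>G g)"
    using cover(1) unfolding strict_xmod_morphism_def by blast+
  note sG = strict_morphismD[OF mG] and sH = strict_morphismD[OF mH]
  have y: "y \<in> obj ?G2" using \<gamma> by auto
  interpret A: topological_group_xmod ?A by (rule X1.topological_group_xmod_isotropy[OF x])
  interpret B: topological_group_xmod ?B by (rule X2.topological_group_xmod_isotropy[OF y])
  have G1: "g \<in> isotropy ?G1 x \<longleftrightarrow> g \<in> arr ?G1 \<and> src ?G1 g = x \<and> tgt ?G1 g = x" for g
    by (simp add: isotropy_def)
  have G2: "g \<in> isotropy ?G2 y \<longleftrightarrow> g \<in> arr ?G2 \<and> src ?G2 g = y \<and> tgt ?G2 g = y" for g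
    by (simp add: isotropy_def)
  have H1: "h \<in> isotropy ?H1 x \<longleftrightarrow> h \<in> arr ?H1 \<and> src ?H1 h = x" for h
    by (simp add: X1.isotropy_Bundle X1.fibre_iff)
  have H2: "h \<in> isotropy ?H2 y \<longleftrightarrow> h \<in> arr ?H2 \<and> src ?H2 h = y" for h
    by (simp add: X2.isotropy_Bundle X2.fibre_iff)
  note iso = G1 G2 H1 H2
  have act_\<gamma>: "act \<GG>2 (act \<GG>2 h (inve ?G2 \<gamma>)) \<gamma> = h" if "h \<in> arr ?H2" "src ?H2 h = \<chi>0 x" for h
    using that \<gamma> by (simp add: X2.act_comp[symmetric])
  have act_\<gamma>': "act \<GG>2 (act \<GG>2 h \<gamma>) (inve ?G2 \<gamma>) = h" if "h \<in> arr ?H2" "src ?H2 h = y" for h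
    using that \<gamma> by (simp add: X2.act_comp[symmetric])
  have c_hom: "?c \<in> hom (base ?A) (base ?B)"
    by (rule homI) (use \<gamma> in \<open>simp_all add: iso sG X2.G.mult_assoc_arr\<close>)
  have d_hom: "?d \<in> hom (top_grp ?A) (top_grp ?B)"
    by (rule homI) (use \<gamma> in \<open>simp_all add: iso sH X2.act_mult\<close>)
  have cont_c: "continuous_map (isotropy_top ?G1 x) (isotropy_top ?G2 y) ?c"
    unfolding continuous_map_into_isotropy
  proof (intro conjI ballI)
    have "\<gamma> \<in> topspace (Arr ?G2)" using \<gamma> by simp
    then show "continuous_map (isotropy_top ?G1 x) (Arr ?G2) ?c"
      by (intro X2.G.continuous_gmult_apply continuous_map_from_isotropy[OF sG(2)])
        (use \<gamma> in \<open>simp_all add: iso sG\<close>)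
  qed (use \<gamma> in \<open>simp_all add: iso sG\<close>)
  have cont_d: "continuous_map (isotropy_top ?H1 x) (isotropy_top ?H2 y) ?d"
    unfolding continuous_map_into_isotropy
  proof (intro conjI ballI)
    show "continuous_map (isotropy_top ?H1 x) (Arr ?H2) ?d"
      by (intro X2.continuous_act_apply continuous_map_from_isotropy[OF sH(2)])
        (use \<gamma> in \<open>simp_all add: iso sH\<close>)
  qed (use \<gamma> in \<open>simp_all add: iso sH\<close>)
  have c_bd: "?c (bdry \<GG>1 k) = bdry \<GG>2 (?d k)" if "k \<in> isotropy ?H1 x" for k
    using that \<gamma> by (simp add: iso sH X2.bdry_act_arr chi_bdry)
  have d_ac: "?d (act \<GG>1 k g) = act \<GG>2 (?d k) (?c g)" if "k \<in> isotropy ?H1 x" "g \<in> isotropy ?G1 x" for k g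
  proof -
    have "act \<GG>2 (?d k) (?c g) =
        act \<GG>2 (act \<GG>2 (act \<GG>2 (act \<GG>2 (\<chi>H k) (inve ?G2 \<gamma>)) \<gamma>) (\<chi>G g)) (inve ?G2 \<gamma>)"
      using that \<gamma> by (simp add: iso sH sG X2.act_comp)
    then show ?thesis
      using that by (simp add: iso sH act_\<gamma> chi_act X1.fibre_iff)
  qed
  have surj: "\<exists>h\<in>isotropy ?H2 y. \<exists>g'\<in>isotropy ?G1 x. g = mult ?G2 (bdry \<GG>2 h) (?c g')"
    if g: "g \<in> isotropy ?G2 y" for g
  proof -
    let ?g = "mult ?G2 (mult ?G2 (inve ?G2 \<gamma>) g) \<gamma>"
    have g': "?g \<in> arr ?G2" "tgt ?G2 ?g = \<chi>0 x" "src ?G2 ?g = \<chi>0 x" using g \<gamma> by (simp_all add: iso)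
    then obtain f h where f: "f \<in> arr ?G1" "h \<in> fibre ?H2 (tgt ?G2 ?g)" "tgt ?G1 f = x" "src ?G1 f = x"
        "\<chi>G f = mult ?G2 (bdry \<GG>2 h) ?g"
      using cover(3) x unfolding fullness_def by blast
    have h: "h \<in> arr ?H2" "src ?H2 h = \<chi>0 x" using f(2) g' by (simp_all add: X2.fibre_iff)
    \<comment> \<open>Fullness puts the correction \<open>h\<close> on the other side of the equation, hence the inverse.\<close>
    let ?h = "act \<GG>2 (inve ?H2 h) (inve ?G2 \<gamma>)"
    have ih: "inve ?H2 h \<in> arr ?H2" "src ?H2 (inve ?H2 h) = \<chi>0 x" using h by simp_all
    have "mult ?G2 (bdry \<GG>2 ?h) (?c f) = g"
      using g \<gamma> h ih f(5)
      by (simp add: iso X2.bdry_act_arr X2.bdry_inve X2.G.mult_assoc_arr)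
    moreover have "?h \<in> isotropy ?H2 y" using ih \<gamma> by (simp add: iso)
    moreover have "f \<in> isotropy ?G1 x" using f by (simp add: iso)
    ultimately show ?thesis by blast
  qed
  define E where "E = inv_into (topspace (arrows2 \<GG>1)) (\<lambda>a. (map_prod \<chi>H \<chi>G a, snd a, target2 \<GG>1 a))"
  note faithful = faithfulnessD[OF cover(4), folded E_def]
  define Y where "Y = subtopology (prod_topology (isotropy_top ?H2 y) (isotropy_top ?G1 x))
    {(h, g). bdry \<GG>2 h = ?c g}"
  \<comment> \<open>A point of the fibre product of groups becomes a 2-arrow from the identity of \<open>\<chi>0 x\<close> to
    the image of a loop at \<open>x\<close>, which faithfulness lifts.\<close>
  define a where "a p = ((act \<GG>2 (fst p) \<gamma>, idn ?G2 (\<chi>0 x)), idn ?G1 x, snd p)" for p :: "'l \<times> 'g"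
  have idn: "\<chi>G (idn ?G1 x) = idn ?G2 (\<chi>0 x)" using sG(5) x by simp
  have chi_x: "\<chi>0 x \<in> obj ?G2" using sG(8) x by simp
  have b: "(act \<GG>2 h \<gamma>, idn ?G2 (\<chi>0 x)) \<in> topspace (arrows2 \<GG>2)"
      "target2 \<GG>2 (act \<GG>2 h \<gamma>, idn ?G2 (\<chi>0 x)) = \<chi>G g"
    if "h \<in> isotropy ?H2 y" "g \<in> isotropy ?G1 x" "bdry \<GG>2 h = ?c g" for h g
  proof -
    show "(act \<GG>2 h \<gamma>, idn ?G2 (\<chi>0 x)) \<in> topspace (arrows2 \<GG>2)"
      using that \<gamma> chi_x by (simp add: topspace_arrows2 X2.fibre_iff iso)
    show "target2 \<GG>2 (act \<GG>2 h \<gamma>, idn ?G2 (\<chi>0 x)) = \<chi>G g"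
      using that \<gamma> chi_x by (simp add: target2_def iso X2.bdry_act_arr sG X2.G.mult_assoc_arr)
  qed
  have homeo: "homeomorphic_map (isotropy_top ?H1 x) Y (\<lambda>k. (?d k, bdry \<GG>1 k))"
  proof (rule homeomorphic_map_witness[where g = "\<lambda>p. fst (E (a p))"])
    show "continuous_map (isotropy_top ?H1 x) Y (\<lambda>k. (?d k, bdry \<GG>1 k))"
      using cont_d A.continuous_bd c_bd
      by (auto simp: Y_def continuous_map_in_subtopology continuous_map_paired)
    have iso2: "p \<in> topspace Y \<Longrightarrow> fst p \<in> isotropy ?H2 y \<and> snd p \<in> isotropy ?G1 x \<and> bdry \<GG>2 (fst p) = ?c (snd p)" for p
      by (auto simp: Y_def)
    have iso3: "fst p \<in> arr ?H2 \<and> src ?H2 (fst p) = y \<and> snd p \<in> arr ?G1" if "p \<in> topspace Y" for p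
      using iso2[OF that] by (simp add: iso)
    have fst_Y: "continuous_map Y (Arr ?H2) fst" and snd_Y: "continuous_map Y (Arr ?G1) snd"
      using continuous_map_subtopology_fst[of "isotropy_top ?H2 y" "isotropy_top ?G1 x"]
        continuous_map_subtopology_snd[of "isotropy_top ?H2 y" "isotropy_top ?G1 x"]
      unfolding continuous_map_into_isotropy Y_def by blast+
    have "continuous_map Y (Arr ?H2) (\<lambda>p. act \<GG>2 (fst p) \<gamma>)"
      by (rule X2.continuous_act_apply[OF fst_Y]) (use \<gamma> iso3 in simp_all)
    then have "continuous_map Y (arrows2 \<GG>2) (\<lambda>p. (act \<GG>2 (fst p) \<gamma>, idn ?G2 (\<chi>0 x)))"
      unfolding arrows2_def continuous_map_in_subtopology continuous_map_paired
      using \<gamma> chi_x iso3 by (simp add: X2.fibre_iff)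
    then have "continuous_map Y (subtopology (prod_topology (arrows2 \<GG>2) (prod_topology (Arr ?G1) (Arr ?G1)))
          {(b, g, g'). snd b = \<chi>G g \<and> target2 \<GG>2 b = \<chi>G g'}) a"
      unfolding continuous_map_in_subtopology a_def continuous_map_paired
      using snd_Y iso2 x b(2) by (simp add: idn)
    from continuous_map_apply[OF faithful(1) this]
    have "continuous_map Y (Arr ?H1) (\<lambda>p. fst (E (a p)))"
      unfolding arrows2_def continuous_map_in_subtopology by (intro continuous_map_fst_apply) blast
    moreover have inv: "fst (E (a p)) \<in> isotropy ?H1 x \<and> ?d (fst (E (a p))) = fst p \<and>
        bdry \<GG>1 (fst (E (a p))) = snd p" if p: "p \<in> topspace Y" for p
    proof -
      note q = iso2[OF p]
      have snd_p: "snd p \<in> arr ?G1" and ix: "idn ?G1 x \<in> arr ?G1" using q x by (simp_all add: iso)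
      have bp: "(act \<GG>2 (fst p) \<gamma>, idn ?G2 (\<chi>0 x)) \<in> topspace (arrows2 \<GG>2)"
        "target2 \<GG>2 (act \<GG>2 (fst p) \<gamma>, idn ?G2 (\<chi>0 x)) = \<chi>G (snd p)"
        using b[of "fst p" "snd p"] q by blast+
      have "\<exists>h. E (a p) = (h, idn ?G1 x) \<and> h \<in> fibre ?H1 (tgt ?G1 (idn ?G1 x)) \<and>
        (act \<GG>2 (fst p) \<gamma>, idn ?G2 (\<chi>0 x)) = (\<chi>H h, \<chi>G (idn ?G1 x)) \<and>
        snd p = target2 \<GG>1 (h, idn ?G1 x)"
        unfolding a_def by (rule faithful(3)[OF bp(1) ix snd_p _ bp(2)]) (simp add: idn)
      then obtain h where h: "E (a p) = (h, idn ?G1 x)" "h \<in> fibre ?H1 (tgt ?G1 (idn ?G1 x))"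
        "(act \<GG>2 (fst p) \<gamma>, idn ?G2 (\<chi>0 x)) = (\<chi>H h, \<chi>G (idn ?G1 x))"
        "snd p = target2 \<GG>1 (h, idn ?G1 x)" by blast
      have "h \<in> isotropy ?H1 x" using h(2) x by (simp add: iso X1.fibre_iff)
      moreover from this have "bdry \<GG>1 h = snd p" using h(4) x by (simp add: target2_def iso)
      moreover have "?d h = fst p" using act_\<gamma>'[of "fst p"] h(3) q by (simp add: iso)
      ultimately show ?thesis using h(1) by simp
    qed
    ultimately show "continuous_map Y (isotropy_top ?H1 x) (\<lambda>p. fst (E (a p)))"
      by (simp add: continuous_map_into_isotropy)
    show "(?d (fst (E (a p))), bdry \<GG>1 (fst (E (a p)))) = p" if "p \<in> topspace Y" for p
      using inv[OF that] by simp
    show "fst (E (a (?d k, bdry \<GG>1 k))) = k" if "k \<in> topspace (isotropy_top ?H1 x)" for k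
    proof -
      have k: "k \<in> arr ?H1" "src ?H1 k = x" using that by (simp_all add: iso)
      have "a (?d k, bdry \<GG>1 k) = ((\<chi>H k, \<chi>G (idn ?G1 x)), idn ?G1 x, target2 \<GG>1 (k, idn ?G1 x))"
        using k x by (simp add: a_def act_\<gamma> sH idn target2_def)
      then show ?thesis using faithful(2)[of k "idn ?G1 x"] k x by (simp add: X1.fibre_iff)
    qed
  qed
  show ?thesis
    unfolding group_weak_equivalence_def
    using c_hom d_hom cont_c c_bd d_ac surj homeo[unfolded Y_def] by simp
qed

section \<open>Morita equivalence on isotropy\<close>

text \<open>The type of the elements of the extending group is recorded as an argument, because along a
  zigzag all of the extensions have to live in the same type.\<close>

definition isotropy_extension ::
    "'u itself \<Rightarrow> ('x, 'g, 'h) xmod \<Rightarrow> 'x \<Rightarrow> ('y, 'k, 'l) xmod \<Rightarrow> 'y \<Rightarrow> bool" where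
  "isotropy_extension _ \<GG>1 x \<GG>2 y \<longleftrightarrow>
     (\<exists>(M :: 'u monoid) T \<alpha>1 \<alpha>2 \<beta>1 \<beta>2.
        group_crossed_extension (isotropy_xmod \<GG>1 x) (isotropy_xmod \<GG>2 y) M T \<alpha>1 \<alpha>2 \<beta>1 \<beta>2)"

text \<open>What survives of a hypercover along a zigzag: a correspondence of objects that matches orbits
  bijectively and relates only objects whose isotropy crossed modules have a crossed extension.
  Unlike the existence of a hypercover, the existence of such a correspondence is symmetric and
  transitive.\<close>

definition linking ::
    "('u, 'u, 'u) xmod \<Rightarrow> ('u, 'u, 'u) xmod \<Rightarrow> ('u \<Rightarrow> 'u \<Rightarrow> bool) \<Rightarrow> bool" where
  "linking \<GG>1 \<GG>2 \<rho> \<longleftrightarrow>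
     (\<forall>x\<in>obj (Grpd \<GG>1). \<exists>y. \<rho> x y) \<and> (\<forall>y\<in>obj (Grpd \<GG>2). \<exists>x. \<rho> x y) \<and>
     (\<forall>x y x' y'. \<rho> x y \<longrightarrow> \<rho> x' y' \<longrightarrow> connected_by (Grpd \<GG>1) x x' = connected_by (Grpd \<GG>2) y y') \<and>
     (\<forall>x y. \<rho> x y \<longrightarrow> x \<in> obj (Grpd \<GG>1) \<and> y \<in> obj (Grpd \<GG>2) \<and>
        isotropy_extension TYPE('u) \<GG>1 x \<GG>2 y)"

lemma linkingD:
  fixes \<GG>1 \<GG>2 :: "('u, 'u, 'u) xmod"
  assumes "linking \<GG>1 \<GG>2 \<rho>"
  shows "x \<in> obj (Grpd \<GG>1) \<Longrightarrow> \<exists>y. \<rho> x y" "y \<in> obj (Grpd \<GG>2) \<Longrightarrow> \<exists>x. \<rho> x y"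
    "\<rho> x y \<Longrightarrow> \<rho> x' y' \<Longrightarrow> connected_by (Grpd \<GG>1) x x' = connected_by (Grpd \<GG>2) y y'"
    "\<rho> x y \<Longrightarrow> x \<in> obj (Grpd \<GG>1)" "\<rho> x y \<Longrightarrow> y \<in> obj (Grpd \<GG>2)"
    "\<rho> x y \<Longrightarrow> isotropy_extension TYPE('u) \<GG>1 x \<GG>2 y"
proof -
  note l = assms[unfolded linking_def]
  show "x \<in> obj (Grpd \<GG>1) \<Longrightarrow> \<exists>y. \<rho> x y" using l[THEN conjunct1] by simp
  show "y \<in> obj (Grpd \<GG>2) \<Longrightarrow> \<exists>x. \<rho> x y" using l[THEN conjunct2, THEN conjunct1] by simp
  show "\<rho> x y \<Longrightarrow> \<rho> x' y' \<Longrightarrow> connected_by (Grpd \<GG>1) x x' = connected_by (Grpd \<GG>2) y y'"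
    using l[THEN conjunct2, THEN conjunct2, THEN conjunct1] by simp
  show "\<rho> x y \<Longrightarrow> x \<in> obj (Grpd \<GG>1)" "\<rho> x y \<Longrightarrow> y \<in> obj (Grpd \<GG>2)"
    "\<rho> x y \<Longrightarrow> isotropy_extension TYPE('u) \<GG>1 x \<GG>2 y"
    using l[THEN conjunct2, THEN conjunct2, THEN conjunct2] by simp_all
qed

lemma linking_sym:
  fixes \<GG>1 \<GG>2 :: "('u, 'u, 'u) xmod"
  assumes "linking \<GG>1 \<GG>2 \<rho>"
  shows "linking \<GG>2 \<GG>1 (\<lambda>y x. \<rho> x y)"
  unfolding linking_def
proof (intro conjI allI impI ballI)
  show "isotropy_extension TYPE('u) \<GG>2 y \<GG>1 x" if "\<rho> x y" for x y
    using linkingD(6)[OF assms that] group_crossed_extension_sym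
    unfolding isotropy_extension_def by blast
qed (use linkingD[OF assms] in auto)

lemma linking_trans:
  fixes \<GG>1 \<GG>2 \<GG>3 :: "('u, 'u, 'u) xmod" and e :: "'u \<times> 'u \<Rightarrow> 'u"
  assumes X: "crossed_module \<GG>1" "crossed_module \<GG>2" "crossed_module \<GG>3"
    and e: "inj e" and 12: "linking \<GG>1 \<GG>2 \<rho>" and 23: "linking \<GG>2 \<GG>3 \<rho>'"
  shows "linking \<GG>1 \<GG>3 (\<lambda>x z. \<exists>y. \<rho> x y \<and> \<rho>' y z)"
  unfolding linking_def
proof (intro conjI allI impI ballI)
  show "\<exists>z y. \<rho> x y \<and> \<rho>' y z" if "x \<in> obj (Grpd \<GG>1)" for x
    using linkingD(1)[OF 12 that] linkingD(5)[OF 12] linkingD(1)[OF 23] by blast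
  show "\<exists>x y. \<rho> x y \<and> \<rho>' y z" if "z \<in> obj (Grpd \<GG>3)" for z
    using linkingD(2)[OF 23 that] linkingD(4)[OF 23] linkingD(2)[OF 12] by blast
  show "connected_by (Grpd \<GG>1) x x' = connected_by (Grpd \<GG>3) z z'"
    if "\<exists>y. \<rho> x y \<and> \<rho>' y z" "\<exists>y. \<rho> x' y \<and> \<rho>' y z'" for x x' z z'
    using that linkingD(3)[OF 12] linkingD(3)[OF 23] by blast
  fix x z assume "\<exists>y. \<rho> x y \<and> \<rho>' y z"
  then obtain y where y: "\<rho> x y" "\<rho>' y z" by blast
  note obj = linkingD(4,5)[OF 12 y(1)] linkingD(5)[OF 23 y(2)]
  show "x \<in> obj (Grpd \<GG>1)" "z \<in> obj (Grpd \<GG>3)" by (rule obj)+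
  obtain M :: "'u monoid" and TM \<alpha>1 \<alpha>2 \<beta>1 \<beta>2 where M: "group_crossed_extension
      (isotropy_xmod \<GG>1 x) (isotropy_xmod \<GG>2 y) M TM \<alpha>1 \<alpha>2 \<beta>1 \<beta>2"
    using linkingD(6)[OF 12 y(1)] unfolding isotropy_extension_def by blast
  obtain N :: "'u monoid" and TN \<gamma>1 \<gamma>2 \<delta>1 \<delta>2 where N: "group_crossed_extension
      (isotropy_xmod \<GG>2 y) (isotropy_xmod \<GG>3 z) N TN \<gamma>1 \<gamma>2 \<delta>1 \<delta>2"
    using linkingD(6)[OF 23 y(2)] unfolding isotropy_extension_def by blast
  show "isotropy_extension TYPE('u) \<GG>1 x \<GG>3 z"
    unfolding isotropy_extension_def
    by (rule group_crossed_extension_trans[OF _ _ _ M N e])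
      (intro crossed_module.topological_group_xmod_isotropy X obj)+
qed

lemma isotropy_extension_of_weq:
  fixes e :: "'l \<times> 'g \<Rightarrow> 'u" and \<GG>1 :: "('x, 'g, 'h) xmod" and \<GG>2 :: "('y, 'k, 'l) xmod"
  assumes A: "topological_group_xmod (isotropy_xmod \<GG>1 x)"
    and B: "topological_group_xmod (isotropy_xmod \<GG>2 y)" and e: "inj e"
    and weq: "group_weak_equivalence (isotropy_xmod \<GG>1 x) (isotropy_xmod \<GG>2 y) c d"
  shows "isotropy_extension TYPE('u) \<GG>1 x \<GG>2 y"
proof -
  interpret group_weq "isotropy_xmod \<GG>1 x" "isotropy_xmod \<GG>2 y" c d
    by (intro group_weq.intro group_weq_axioms.intro A B weq)
  show ?thesis
    unfolding isotropy_extension_def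
    using group_crossed_extension_image[OF group_crossed_extension_semidirect A B
        inj_on_subset[OF e subset_UNIV]] by blast
qed

text \<open>The identity of a crossed module of groups is a weak equivalence. This starts the induction
  along a zigzag and settles zigzags of length one.\<close>

lemma linking_refl:
  fixes \<GG> :: "('u, 'u, 'u) xmod" and e :: "'u \<times> 'u \<Rightarrow> 'u"
  assumes X: "crossed_module \<GG>" and e: "inj e"
  shows "linking \<GG> \<GG> (\<lambda>x y. x = y \<and> x \<in> obj (Grpd \<GG>))"
  unfolding linking_def
proof (intro conjI allI impI ballI)
  fix x y assume xy: "x = y \<and> x \<in> obj (Grpd \<GG>)"
  then have x: "x \<in> obj (Grpd \<GG>)" and y: "y = x" by auto
  note A = crossed_module.topological_group_xmod_isotropy[OF X x]
  interpret A: topological_group_xmod "isotropy_xmod \<GG> x" by (rule A)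
  have "homeomorphic_map (top_top (isotropy_xmod \<GG> x))
      (subtopology (prod_topology (top_top (isotropy_xmod \<GG> x)) (base_top (isotropy_xmod \<GG> x)))
        {(h, g). bd (isotropy_xmod \<GG> x) h = g}) (\<lambda>k. (k, bd (isotropy_xmod \<GG> x) k))"
    by (rule homeomorphic_map_witness[where g = fst])
      (auto simp: continuous_map_in_subtopology continuous_map_paired A.continuous_bd
        continuous_map_ident continuous_map_subtopology_fst simp del: isotropy_xmod_simps)
  moreover have "\<exists>h\<in>carrier (top_grp (isotropy_xmod \<GG> x)). \<exists>g'\<in>carrier (base (isotropy_xmod \<GG> x)).
      g = bd (isotropy_xmod \<GG> x) h \<otimes>\<^bsub>base (isotropy_xmod \<GG> x)\<^esub> g'"
    if "g \<in> carrier (base (isotropy_xmod \<GG> x))" for g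
    using that A.H.one_closed A.bd.hom_one A.B.l_one by metis
  ultimately have "group_weak_equivalence (isotropy_xmod \<GG> x) (isotropy_xmod \<GG> x) (\<lambda>g. g) (\<lambda>h. h)"
    unfolding group_weak_equivalence_def
    by (simp add: hom_def continuous_map_ident del: isotropy_xmod_simps)
  then show "isotropy_extension TYPE('u) \<GG> x \<GG> y"
    unfolding y by (rule isotropy_extension_of_weq[OF A A e])
qed auto

lemma hypercover_linking:
  fixes \<GG>1 \<GG>2 :: "('u, 'u, 'u) xmod" and e :: "'u \<times> 'u \<Rightarrow> 'u"
  assumes X1: "crossed_module \<GG>1" and X2: "crossed_module \<GG>2" and e: "inj e"
    and cover: "hypercover \<GG>1 \<GG>2 \<chi>0 \<chi>G \<chi>H"
  shows "linking \<GG>1 \<GG>2 (\<lambda>x y. x \<in> obj (Grpd \<GG>1) \<and> connected_by (Grpd \<GG>2) (\<chi>0 x) y)"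
  unfolding linking_def
proof (intro conjI allI impI ballI)
  interpret X1: crossed_module \<GG>1 by (rule X1)
  interpret X2: crossed_module \<GG>2 by (rule X2)
  note cov = hypercoverD[OF cover X1 X2]
  have mG: "strict_morphism (Grpd \<GG>1) (Grpd \<GG>2) \<chi>0 \<chi>G"
    using cov(1) by (simp add: strict_xmod_morphism_def)
  note s = strict_morphismD[OF mG]
  show "\<exists>y. x \<in> obj (Grpd \<GG>1) \<and> connected_by (Grpd \<GG>2) (\<chi>0 x) y" if "x \<in> obj (Grpd \<GG>1)" for x
    using that X2.G.connected_by_refl s(8) by blast
  show "\<exists>x. x \<in> obj (Grpd \<GG>1) \<and> connected_by (Grpd \<GG>2) (\<chi>0 x) y" if "y \<in> obj (Grpd \<GG>2)" for y
    using cov(2) that X2.G.connected_by_sym unfolding X2.G.essentially_surjective_iff by blast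
  show "connected_by (Grpd \<GG>1) x x' = connected_by (Grpd \<GG>2) y y'"
    if xy: "x \<in> obj (Grpd \<GG>1) \<and> connected_by (Grpd \<GG>2) (\<chi>0 x) y"
      and xy': "x' \<in> obj (Grpd \<GG>1) \<and> connected_by (Grpd \<GG>2) (\<chi>0 x') y'" for x y x' y'
  proof -
    have "connected_by (Grpd \<GG>1) x x' \<longleftrightarrow> connected_by (Grpd \<GG>2) (\<chi>0 x) (\<chi>0 x')"
    proof
      assume "connected_by (Grpd \<GG>1) x x'"
      then obtain f where "f \<in> arr (Grpd \<GG>1)" "src (Grpd \<GG>1) f = x" "tgt (Grpd \<GG>1) f = x'"
        unfolding connected_by_def by blast
      then show "connected_by (Grpd \<GG>2) (\<chi>0 x) (\<chi>0 x')"
        unfolding connected_by_def using s(3,4,7) by (intro bexI[of _ "\<chi>G f"]) simp_all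
    next
      assume "connected_by (Grpd \<GG>2) (\<chi>0 x) (\<chi>0 x')"
      then obtain g where "g \<in> arr (Grpd \<GG>2)" "src (Grpd \<GG>2) g = \<chi>0 x" "tgt (Grpd \<GG>2) g = \<chi>0 x'"
        unfolding connected_by_def by blast
      then have "\<exists>f\<in>arr (Grpd \<GG>1). tgt (Grpd \<GG>1) f = x' \<and> src (Grpd \<GG>1) f = x"
        using cov(3) xy xy' unfolding fullness_def by blast
      then show "connected_by (Grpd \<GG>1) x x'" unfolding connected_by_def by blast
    qed
    also have "\<dots> \<longleftrightarrow> connected_by (Grpd \<GG>2) y y'"
      using xy xy' X2.G.connected_by_sym X2.G.connected_by_trans by blast
    finally show ?thesis .
  qed
  fix x y assume xy: "x \<in> obj (Grpd \<GG>1) \<and> connected_by (Grpd \<GG>2) (\<chi>0 x) y"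
  then show x: "x \<in> obj (Grpd \<GG>1)" and y: "y \<in> obj (Grpd \<GG>2)"
    using X2.G.connected_by_obj by blast+
  obtain \<gamma> where \<gamma>: "\<gamma> \<in> arr (Grpd \<GG>2)" "src (Grpd \<GG>2) \<gamma> = \<chi>0 x" "tgt (Grpd \<GG>2) \<gamma> = y"
    using xy unfolding connected_by_def by blast
  show "isotropy_extension TYPE('u) \<GG>1 x \<GG>2 y"
    by (rule isotropy_extension_of_weq[OF X1.topological_group_xmod_isotropy[OF x]
          X2.topological_group_xmod_isotropy[OF y] e hypercover_isotropy[OF X1 X2 cover x \<gamma>]])
qed

lemma morita_equivalent_linking:
  fixes \<GG>1 \<GG>2 :: "('u, 'u, 'u) xmod" and e :: "'u \<times> 'u \<Rightarrow> 'u"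
  assumes "morita_equivalent \<GG>1 \<GG>2" and e: "inj e"
  shows "\<exists>\<rho>. linking \<GG>1 \<GG>2 \<rho>"
proof -
  obtain \<GG>s where s: "\<GG>s \<noteq> []" "hd \<GG>s = \<GG>1" "last \<GG>s = \<GG>2" "\<forall>\<GG>\<in>set \<GG>s. crossed_module \<GG>"
    and step: "\<And>i. Suc i < length \<GG>s \<Longrightarrow>
           (\<exists>\<chi>0 \<chi>G \<chi>H. hypercover (\<GG>s ! i) (\<GG>s ! Suc i) \<chi>0 \<chi>G \<chi>H) \<or>
           (\<exists>\<chi>0 \<chi>G \<chi>H. hypercover (\<GG>s ! Suc i) (\<GG>s ! i) \<chi>0 \<chi>G \<chi>H)"
    using assms(1) unfolding morita_equivalent_def by blast
  have "\<exists>\<rho>. linking \<GG>1 (\<GG>s ! i) \<rho>" if "i < length \<GG>s" for i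
    using that
  proof (induction i)
    case 0
    then have "\<GG>s ! 0 = \<GG>1" using s(1,2) by (simp add: hd_conv_nth)
    moreover have "crossed_module \<GG>1" using s(1,2,4) hd_in_set by metis
    ultimately show ?case using linking_refl[OF _ e] by metis
  next
    case (Suc i)
    then obtain \<rho> where \<rho>: "linking \<GG>1 (\<GG>s ! i) \<rho>" by auto
    have X: "crossed_module (\<GG>s ! i)" "crossed_module (\<GG>s ! Suc i)" "crossed_module \<GG>1"
      using s(1,2,4) Suc.prems hd_in_set[OF s(1)] by auto
    have "\<exists>\<rho>'. linking (\<GG>s ! i) (\<GG>s ! Suc i) \<rho>'"
      using step[OF Suc.prems] hypercover_linking[OF X(1,2) e] hypercover_linking[OF X(2,1) e]
        linking_sym by blast
    then show ?case using linking_trans[OF X(3,1,2) e \<rho>] by blast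
  qed
  from this[of "length \<GG>s - 1"] show ?thesis
    using s(1,3) by (simp add: last_conv_nth)
qed

section \<open>Sums of topological groups over a discrete unit space\<close>

lemma continuous_map_fibrewise:
  assumes c: "continuous_map X (discrete_topology I) c"
    and f: "\<And>i. i \<in> I \<Longrightarrow> continuous_map (subtopology X {x. c x = i}) Y f"
  shows "continuous_map X Y f"
proof (rule pasting_lemma[where I = I and T = "\<lambda>i. {x \<in> topspace X. c x = i}" and f = "\<lambda>_. f"])
  fix i assume i: "i \<in> I"
  have "openin X {x \<in> topspace X. c x \<in> {i}}"
    by (rule openin_continuous_map_preimage[OF c]) (simp add: i)
  then show "openin X {x \<in> topspace X. c x = i}" by simp
  have "{x \<in> topspace X. c x = i} = topspace X \<inter> {x. c x = i}" by blast
  then have "subtopology X {x \<in> topspace X. c x = i} = subtopology X {x. c x = i}"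
    by (simp only: subtopology_restrict)
  then show "continuous_map (subtopology X {x \<in> topspace X. c x = i}) Y f"
    using f[OF i] by simp
next
  fix x assume "x \<in> topspace X"
  then show "\<exists>j. j \<in> I \<and> x \<in> {x \<in> topspace X. c x = j} \<and> f x = f x"
    using continuous_map_point[OF c] by simp
qed simp

lemma continuous_map_sum_index: "continuous_map (sum_topology T Z) (discrete_topology Z) fst"
proof -
  have "openin (sum_topology T Z) {p \<in> topspace (sum_topology T Z). fst p \<in> U}" if "U \<subseteq> Z" for U
  proof -
    have "{p \<in> topspace (sum_topology T Z). fst p \<in> U} = Sigma Z (\<lambda>z. if z \<in> U then topspace (T z) else {})"
      using that by (auto split: if_splits)
    then show ?thesis by (simp add: openin_disjoint_union)
  qed
  then show ?thesis by (auto simp: continuous_map_def)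
qed

lemma continuous_map_sum_component:
  assumes "z \<in> Z"
  shows "continuous_map (subtopology (sum_topology T Z) {p. fst p = z}) (T z) snd"
  unfolding continuous_map_def
proof (intro conjI allI impI)
  show "snd \<in> topspace (subtopology (sum_topology T Z) {p. fst p = z}) \<rightarrow> topspace (T z)" by auto
  fix U assume U: "openin (T z) U"
  have "openin (sum_topology T Z) (Sigma Z (\<lambda>i. if i = z then U else {}))"
    using U by (subst openin_disjoint_union) simp
  moreover have "{p \<in> topspace (subtopology (sum_topology T Z) {p. fst p = z}). snd p \<in> U} =
      Sigma Z (\<lambda>i. if i = z then U else {}) \<inter> {p. fst p = z}"
    using assms openin_subset[OF U] by (auto split: if_splits)
  ultimately show "openin (subtopology (sum_topology T Z) {p. fst p = z})
      {p \<in> topspace (subtopology (sum_topology T Z) {p. fst p = z}). snd p \<in> U}"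
    by (auto simp: openin_subtopology)
qed

text \<open>The disjoint union of a family of topological groups, as a groupoid with discrete unit space
  and no arrows between different objects. Its arrows are encoded by \<open>e\<close>.\<close>

definition group_sum :: "('z \<Rightarrow> 'm monoid) \<Rightarrow> ('z \<Rightarrow> 'm topology) \<Rightarrow> 'z set \<Rightarrow> ('z \<times> 'm \<Rightarrow> 'a) \<Rightarrow> ('z, 'a) tgrpd" where
  "group_sum M T Z e =
     \<lparr> Obj = discrete_topology Z,
       Arr = coinduced (sum_topology T Z) e,
       src = (\<lambda>u. fst (inv_into UNIV e u)),
       tgt = (\<lambda>u. fst (inv_into UNIV e u)),
       idn = (\<lambda>z. e (z, \<one>\<^bsub>M z\<^esub>)),
       mult = (\<lambda>u v. let z = fst (inv_into UNIV e u) in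
          e (z, snd (inv_into UNIV e u) \<otimes>\<^bsub>M z\<^esub> snd (inv_into UNIV e v))),
       inve = (\<lambda>u. let z = fst (inv_into UNIV e u) in
          e (z, inv\<^bsub>M z\<^esub> snd (inv_into UNIV e u))) \<rparr>"

locale group_sum_data =
  fixes M :: "'z \<Rightarrow> 'm monoid" and T :: "'z \<Rightarrow> 'm topology" and Z :: "'z set"
    and e :: "'z \<times> 'm \<Rightarrow> 'a"
  assumes inj_e: "inj e"
    and groups: "z \<in> Z \<Longrightarrow> topological_group (M z) (T z)"
begin

abbreviation "S \<equiv> group_sum M T Z e"

definition d :: "'a \<Rightarrow> 'z \<times> 'm" where "d = inv_into UNIV e"

lemma d_e [simp]: "d (e p) = p"
  by (simp add: d_def inj_e)

lemma group_z: "z \<in> Z \<Longrightarrow> group (M z)"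
  using groups by (simp add: topological_group_def)

lemma carrier_M: "z \<in> Z \<Longrightarrow> carrier (M z) = topspace (T z)"
  using groups by (simp add: topological_group.carrier_eq)

lemma S_simps:
  "Obj S = discrete_topology Z" "Arr S = coinduced (sum_topology T Z) e"
  "src S u = fst (d u)" "tgt S u = fst (d u)" "idn S z = e (z, \<one>\<^bsub>M z\<^esub>)"
  "mult S u v = e (fst (d u), snd (d u) \<otimes>\<^bsub>M (fst (d u))\<^esub> snd (d v))"
  "inve S u = e (fst (d u), inv\<^bsub>M (fst (d u))\<^esub> snd (d u))"
  by (simp_all add: group_sum_def d_def Let_def)

lemma arr_S: "u \<in> arr S \<longleftrightarrow> (\<exists>z m. u = e (z, m) \<and> z \<in> Z \<and> m \<in> carrier (M z))"
proof -
  have "Sigma Z (topspace \<circ> T) = Sigma Z (\<lambda>z. carrier (M z))"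
    by (rule Sigma_cong) (simp_all add: carrier_M)
  then have "arr S = e ` Sigma Z (\<lambda>z. carrier (M z))" by (simp add: S_simps(2))
  then show ?thesis by blast
qed

lemma arr_SE:
  assumes "u \<in> arr S"
  obtains z m where "u = e (z, m)" "z \<in> Z" "m \<in> carrier (M z)"
  using assms arr_S by blast

lemma e_arr [simp]: "e (z, m) \<in> arr S \<longleftrightarrow> z \<in> Z \<and> m \<in> carrier (M z)"
  using inj_e by (auto simp: arr_S inj_eq)

lemma continuous_d: "continuous_map (Arr S) (sum_topology T Z) d"
  unfolding S_simps by (rule continuous_map_decode) simp

lemma continuous_index: "continuous_map (Arr S) (discrete_topology Z) (\<lambda>u. fst (d u))"
  by (rule continuous_map_apply[OF continuous_map_sum_index continuous_d])

lemma continuous_inclusion: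
  assumes "z \<in> Z" "continuous_map X (T z) f"
  shows "continuous_map X (Arr S) (\<lambda>x. e (z, f x))"
  unfolding S_simps
  by (intro continuous_map_apply[OF continuous_map_to_coinduced]
      continuous_map_apply[OF continuous_map_component_injection[OF assms(1), of T]] assms(2))

lemma continuous_component:
  assumes "z \<in> Z" "continuous_map X (Arr S) f" "\<And>x. x \<in> topspace X \<Longrightarrow> fst (d (f x)) = z"
  shows "continuous_map X (T z) (\<lambda>x. snd (d (f x)))"
proof -
  have "continuous_map X (subtopology (sum_topology T Z) {p. fst p = z}) (\<lambda>x. d (f x))"
    using continuous_map_apply[OF continuous_d assms(2)] assms(3)
    by (auto simp: continuous_map_in_subtopology)
  from continuous_map_apply[OF continuous_map_sum_component[OF assms(1)] this] show ?thesis .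
qed

lemma topological_groupoid_S: "topological_groupoid S"
proof
  show "continuous_map (Arr S) (Obj S) (src S)" "continuous_map (Arr S) (Obj S) (tgt S)"
    using continuous_index by (simp_all add: S_simps(1,3,4)[abs_def])
  show "continuous_map (Obj S) (Arr S) (idn S)"
    using group_z by (auto simp: S_simps(1) S_simps(5) monoid.one_closed group.is_monoid)
  show "continuous_map (Arr S) (Arr S) (inve S)"
  proof (rule continuous_map_fibrewise[OF continuous_index])
    fix z assume z: "z \<in> Z"
    interpret topological_group "M z" "T z" by (rule groups[OF z])
    let ?X = "subtopology (Arr S) {u. fst (d u) = z}"
    have "continuous_map ?X (Arr S) (\<lambda>u. e (z, inv\<^bsub>M z\<^esub> snd (d u)))"
      by (intro continuous_inclusion[OF z] continuous_inv_apply continuous_component[OF z]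
          continuous_map_from_subtopology[OF continuous_map_ident]) simp
    then show "continuous_map ?X (Arr S) (inve S)"
      by (rule continuous_map_eq) (simp add: S_simps(7))
  qed
  have fst_c: "continuous_map (subtopology (prod_topology (Arr S) (Arr S)) (composable S)) (Arr S) fst"
    and snd_c: "continuous_map (subtopology (prod_topology (Arr S) (Arr S)) (composable S)) (Arr S) snd"
    by (rule continuous_map_subtopology_fst, rule continuous_map_subtopology_snd)
  show "continuous_map (subtopology (prod_topology (Arr S) (Arr S)) (composable S)) (Arr S)
     (\<lambda>(g, f). mult S g f)"
  proof (rule continuous_map_fibrewise[OF continuous_map_apply[OF continuous_index fst_c]])
    fix z assume z: "z \<in> Z"
    interpret topological_group "M z" "T z" by (rule groups[OF z])
    let ?X = "subtopology (subtopology (prod_topology (Arr S) (Arr S)) (composable S)) {p. fst (d (fst p)) = z}"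
    have "continuous_map ?X (Arr S) (\<lambda>p. e (z, snd (d (fst p)) \<otimes>\<^bsub>M z\<^esub> snd (d (snd p))))"
    proof (intro continuous_inclusion[OF z] continuous_mult_apply continuous_component[OF z]
          continuous_map_from_subtopology[OF fst_c] continuous_map_from_subtopology[OF snd_c])
      show "fst (d (snd p)) = z" if "p \<in> topspace ?X" for p
        using that by (auto simp: composable_def S_simps(3,4))
    qed simp
    then show "continuous_map ?X (Arr S) (\<lambda>(g, f). mult S g f)"
      by (rule continuous_map_eq) (auto simp: S_simps(6))
  qed
  fix g f h assume "(g, f) \<in> composable S" and "(f, h) \<in> composable S"
  then have gfh: "g \<in> arr S" "f \<in> arr S" "h \<in> arr S" "fst (d g) = fst (d f)" "fst (d f) = fst (d h)"
    by (simp_all add: composable_def S_simps(3,4))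
  obtain z a where g: "g = e (z, a)" "z \<in> Z" "a \<in> carrier (M z)" using gfh(1) by (rule arr_SE)
  obtain z' b where f: "f = e (z', b)" "b \<in> carrier (M z')" using gfh(2) by (rule arr_SE)
  obtain z'' c where h: "h = e (z'', c)" "c \<in> carrier (M z'')" using gfh(3) by (rule arr_SE)
  have z: "z \<in> Z" "g = e (z, a)" "f = e (z, b)" "h = e (z, c)"
    "a \<in> carrier (M z)" "b \<in> carrier (M z)" "c \<in> carrier (M z)"
    using g f h gfh(4,5) by simp_all
  interpret group "M z" by (rule group_z[OF z(1)])
  show "mult S (mult S g f) h = mult S g (mult S f h)"
    using z by (simp add: S_simps(6) m_assoc)
next
  fix g assume "g \<in> arr S"
  then obtain z a where z: "g = e (z, a)" "z \<in> Z" "a \<in> carrier (M z)" by (rule arr_SE)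
  interpret group "M z" by (rule group_z[OF z(2)])
  show "mult S (idn S (tgt S g)) g = g" "mult S g (idn S (src S g)) = g"
    "mult S (inve S g) g = idn S (src S g)" "mult S g (inve S g) = idn S (tgt S g)"
    "src S (inve S g) = tgt S g" "tgt S (inve S g) = src S g"
    using z by (simp_all add: S_simps(3-7))
qed (simp_all add: S_simps(1,3-6) composable_def)

end

section \<open>Crossed extensions of sums\<close>

text \<open>As for groups, a crossed extension is split into two symmetric halves, \<open>K\<close> being the kernel of
  the projection to the other groupoid.\<close>

definition groupoid_side ::
    "('x, 'g, 'h) xmod \<Rightarrow> ('z, 'm) tgrpd \<Rightarrow> ('z \<Rightarrow> 'x) \<Rightarrow> 'm set \<Rightarrow>
     ('z \<times> 'h \<Rightarrow> 'm) \<Rightarrow> ('m \<Rightarrow> 'z \<times> 'g \<times> 'z) \<Rightarrow> bool" where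
  "groupoid_side \<GG> M \<tau> K \<alpha>1 \<alpha>2 \<longleftrightarrow>
     (let \<PP> = pullback_xmod (Obj M) \<tau> \<GG> in
      continuous_map (Obj M) (Obj (Grpd \<GG>)) \<tau> \<and>
      strict_morphism (Bundle \<PP>) M (\<lambda>z. z) \<alpha>1 \<and>
      strict_morphism M (Grpd \<PP>) (\<lambda>z. z) \<alpha>2 \<and>
      (\<forall>h\<in>arr (Bundle \<PP>). \<alpha>2 (\<alpha>1 h) = bdry \<PP> h) \<and>
      embedding_map (Arr (Bundle \<PP>)) (Arr M) \<alpha>1 \<and>
      \<alpha>2 ` arr M = arr (Grpd \<PP>) \<and>
      \<alpha>1 ` arr (Bundle \<PP>) = K \<and>
      (\<forall>m\<in>arr M. \<forall>h\<in>fibre (Bundle \<PP>) (tgt M m).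
         \<alpha>1 (act \<PP> h (\<alpha>2 m)) = mult M (mult M (inve M m) (\<alpha>1 h)) m))"

definition unit_kernel :: "('z, 'm) tgrpd \<Rightarrow> ('z \<Rightarrow> 'x) \<Rightarrow> ('x, 'g, 'h) xmod \<Rightarrow> ('m \<Rightarrow> 'z \<times> 'g \<times> 'z) \<Rightarrow> 'm set" where
  "unit_kernel M \<tau> \<GG> \<alpha>2 = {m \<in> arr M. \<alpha>2 m \<in> units (pullback_grpd (Obj M) \<tau> (Grpd \<GG>))}"

lemma pullback_xmod_simps:
  "Grpd (pullback_xmod Z \<sigma> \<GG>) = pullback_grpd Z \<sigma> (Grpd \<GG>)"
  "Bundle (pullback_xmod Z \<sigma> \<GG>) = pullback_bundle Z \<sigma> (Bundle \<GG>)"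
  "bdry (pullback_xmod Z \<sigma> \<GG>) = (\<lambda>(z, h). (z, bdry \<GG> h, z))"
  "act (pullback_xmod Z \<sigma> \<GG>) = (\<lambda>(_, h) (_, g, z2). (z2, act \<GG> h g))"
  by (simp_all add: pullback_xmod_def)

lemma crossed_extension_iff:
  "crossed_extension \<GG>1 \<GG>2 M \<tau> \<sigma> \<alpha>1 \<alpha>2 \<beta>1 \<beta>2 \<longleftrightarrow>
     topological_groupoid M \<and>
     groupoid_side \<GG>1 M \<tau> (unit_kernel M \<sigma> \<GG>2 \<beta>2) \<alpha>1 \<alpha>2 \<and>
     groupoid_side \<GG>2 M \<sigma> (unit_kernel M \<tau> \<GG>1 \<alpha>2) \<beta>1 \<beta>2"
  (is "?L \<longleftrightarrow> ?R")
proof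
  assume ?L
  then show ?R
    unfolding crossed_extension_def crossing_def groupoid_extension_def groupoid_side_def
      unit_kernel_def Let_def pullback_xmod_simps
    by (elim conjE, intro conjI) assumption+
next
  assume R: ?R
  have 1: "\<beta>2 (\<alpha>1 h) \<in> units (pullback_grpd (Obj M) \<sigma> (Grpd \<GG>2))"
    if "h \<in> arr (pullback_bundle (Obj M) \<tau> (Bundle \<GG>1))" for h
  proof -
    have "\<alpha>1 ` arr (pullback_bundle (Obj M) \<tau> (Bundle \<GG>1)) = unit_kernel M \<sigma> \<GG>2 \<beta>2"
      using R unfolding groupoid_side_def Let_def pullback_xmod_simps by (elim conjE)
    then show ?thesis using that unfolding unit_kernel_def by blast
  qed
  have 2: "\<alpha>2 (\<beta>1 h) \<in> units (pullback_grpd (Obj M) \<tau> (Grpd \<GG>1))"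
    if "h \<in> arr (pullback_bundle (Obj M) \<sigma> (Bundle \<GG>2))" for h
  proof -
    have "\<beta>1 ` arr (pullback_bundle (Obj M) \<sigma> (Bundle \<GG>2)) = unit_kernel M \<tau> \<GG>1 \<alpha>2"
      using R unfolding groupoid_side_def Let_def pullback_xmod_simps by (elim conjE)
    then show ?thesis using that unfolding unit_kernel_def by blast
  qed
  show ?L
    using R 1 2
    unfolding crossed_extension_def crossing_def groupoid_extension_def groupoid_side_def
      unit_kernel_def Let_def pullback_xmod_simps
    by (elim conjE, intro conjI ballI) (assumption | simp)+
qed

lemma arr_pullback_bundle: "arr (pullback_bundle Z \<sigma> H) = {(z, h). z \<in> topspace Z \<and> h \<in> fibre H (\<sigma> z)}"
  by (auto simp: pullback_bundle_def fibre_def)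

lemma pullback_bundle_simps:
  "Obj (pullback_bundle Z \<sigma> H) = Z"
  "Arr (pullback_bundle Z \<sigma> H) = subtopology (prod_topology Z (Arr H)) {(z, h). h \<in> fibre H (\<sigma> z)}"
  "src (pullback_bundle Z \<sigma> H) = fst" "tgt (pullback_bundle Z \<sigma> H) = fst"
  "idn (pullback_bundle Z \<sigma> H) z = (z, idn H (\<sigma> z))"
  "mult (pullback_bundle Z \<sigma> H) p q = (fst p, mult H (snd p) (snd q))"
  by (simp_all add: pullback_bundle_def case_prod_unfold)

lemma continuous_map_into_pullback_bundle:
  "continuous_map X (Arr (pullback_bundle Z \<sigma> H)) f \<longleftrightarrow>
     continuous_map X Z (\<lambda>x. fst (f x)) \<and> continuous_map X (Arr H) (\<lambda>x. snd (f x)) \<and>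
     (\<forall>x\<in>topspace X. snd (f x) \<in> fibre H (\<sigma> (fst (f x))))"
  by (auto simp: pullback_bundle_simps continuous_map_in_subtopology continuous_map_pairwise o_def
      Pi_iff case_prod_unfold)

lemma pullback_grpd_simps:
  "Obj (pullback_grpd Z \<sigma> G) = Z"
  "Arr (pullback_grpd Z \<sigma> G) = subtopology (prod_topology Z (prod_topology (Arr G) Z))
     {(z1, g, z2). \<sigma> z1 = tgt G g \<and> src G g = \<sigma> z2}"
  "src (pullback_grpd Z \<sigma> G) (z1, g, z2) = z2" "tgt (pullback_grpd Z \<sigma> G) (z1, g, z2) = z1"
  "idn (pullback_grpd Z \<sigma> G) z = (z, idn G (\<sigma> z), z)"
  "mult (pullback_grpd Z \<sigma> G) (z1, g, z2) (z2', f, z3) = (z1, mult G g f, z3)"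
  by (simp_all add: pullback_grpd_def)

context group_sum_data
begin

text \<open>Halves of extensions of isotropy groups, in pairwise different orbits, form a half of an
  extension of the groupoid. As an arrow between chosen objects is a loop, loops suffice to make the projection to the pullback surjective. Continuity can be checked over each object
  separately, because the unit space is discrete.\<close>

lemma groupoid_side_sum:
  fixes \<GG> :: "('x, 'g, 'h) xmod"
  assumes X: "crossed_module \<GG>" and \<tau>: "\<And>z. z \<in> Z \<Longrightarrow> \<tau> z \<in> obj (Grpd \<GG>)"
    and separated: "\<And>z z'. z \<in> Z \<Longrightarrow> z' \<in> Z \<Longrightarrow> connected_by (Grpd \<GG>) (\<tau> z) (\<tau> z') \<Longrightarrow> z = z'"
    and side: "\<And>z. z \<in> Z \<Longrightarrow> extension_side (isotropy_xmod \<GG> (\<tau> z)) (M z) (T z) (K z) (\<alpha> z) (\<alpha>' z)"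
  shows "groupoid_side \<GG> S \<tau> {e (z, m) |z m. z \<in> Z \<and> m \<in> K z} (\<lambda>p. e (fst p, \<alpha> (fst p) (snd p)))
    (\<lambda>u. (fst (d u), \<alpha>' (fst (d u)) (snd (d u)), fst (d u)))"
    (is "groupoid_side \<GG> S \<tau> ?K ?\<alpha>1 ?\<alpha>2")
proof -
  interpret X: crossed_module \<GG> by (rule X)
  interpret S: topological_groupoid S by (rule topological_groupoid_S)
  let ?G = "Grpd \<GG>" and ?H = "Bundle \<GG>"
  let ?PG = "pullback_grpd (discrete_topology Z) \<tau> ?G" and ?PH = "pullback_bundle (discrete_topology Z) \<tau> ?H"
  have isoH: "isotropy ?H x = fibre ?H x" for x by (rule X.isotropy_Bundle)
  have s: "\<alpha> z \<in> hom (isotropy_group ?H (\<tau> z)) (M z)" "embedding_map (isotropy_top ?H (\<tau> z)) (T z) (\<alpha> z)"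
    "\<alpha> z ` fibre ?H (\<tau> z) = K z"
    "\<alpha>' z \<in> hom (M z) (isotropy_group ?G (\<tau> z))" "continuous_map (T z) (isotropy_top ?G (\<tau> z)) (\<alpha>' z)"
    "\<alpha>' z ` carrier (M z) = isotropy ?G (\<tau> z)"
    "\<And>h. h \<in> fibre ?H (\<tau> z) \<Longrightarrow> \<alpha>' z (\<alpha> z h) = bdry \<GG> h"
    "\<And>m h. m \<in> carrier (M z) \<Longrightarrow> h \<in> fibre ?H (\<tau> z) \<Longrightarrow>
      \<alpha> z (act \<GG> h (\<alpha>' z m)) = inv\<^bsub>M z\<^esub> m \<otimes>\<^bsub>M z\<^esub> \<alpha> z h \<otimes>\<^bsub>M z\<^esub> m" if "z \<in> Z" for z
    using side[OF that] unfolding extension_side_def by (simp_all add: isoH)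
  have hom\<alpha>: "group_hom (isotropy_group ?H (\<tau> z)) (M z) (\<alpha> z)"
    and hom\<alpha>': "group_hom (M z) (isotropy_group ?G (\<tau> z)) (\<alpha>' z)" if "z \<in> Z" for z
    using that \<tau> X.H.group_isotropy X.G.group_isotropy group_z s(1,4)
    by (simp_all add: group_hom_def group_hom_axioms_def)
  have \<alpha>: "\<alpha> z h \<in> carrier (M z)" if "z \<in> Z" "h \<in> fibre ?H (\<tau> z)" for z h
    using group_hom.hom_closed[OF hom\<alpha>[OF that(1)], of h] that by (simp add: isoH)
  have \<alpha>': "\<alpha>' z m \<in> arr ?G" "src ?G (\<alpha>' z m) = \<tau> z" "tgt ?G (\<alpha>' z m) = \<tau> z"
    if "z \<in> Z" "m \<in> carrier (M z)" for z m
    using group_hom.hom_closed[OF hom\<alpha>'[OF that(1)] that(2)] by (simp_all add: isotropy_def)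
  have arrH: "p \<in> arr ?PH \<longleftrightarrow> fst p \<in> Z \<and> snd p \<in> fibre ?H (\<tau> (fst p))" for p
    by (auto simp: arr_pullback_bundle)
  have fst_H: "continuous_map (Arr ?PH) (discrete_topology Z) fst" and snd_H: "continuous_map (Arr ?PH) (Arr ?H) snd"
    unfolding pullback_bundle_simps by (rule continuous_map_subtopology_fst, rule continuous_map_subtopology_snd)
  have cont1: "continuous_map (Arr ?PH) (Arr S) ?\<alpha>1"
  proof (rule continuous_map_fibrewise[OF fst_H])
    fix z assume z: "z \<in> Z"
    let ?X = "subtopology (Arr ?PH) {p. fst p = z}"
    have "continuous_map ?X (isotropy_top ?H (\<tau> z)) snd"
      unfolding continuous_map_into_isotropy
      using continuous_map_from_subtopology[OF snd_H] by (auto simp: arrH isoH)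
    from continuous_inclusion[OF z continuous_map_apply[OF embedding_map_inverse(1)[OF s(2)[OF z]] this]]
    show "continuous_map ?X (Arr S) ?\<alpha>1"
      by (rule continuous_map_eq) simp
  qed
  have m1: "strict_morphism ?PH S (\<lambda>z. z) ?\<alpha>1"
    unfolding strict_morphism_def
  proof (intro conjI ballI cont1)
    show "continuous_map (Obj ?PH) (Obj S) (\<lambda>z. z)"
      by (simp add: pullback_bundle_simps S_simps(1) continuous_map_ident)
    show "?\<alpha>1 (idn ?PH z) = idn S z" if "z \<in> obj ?PH" for z
      using group_hom.hom_one[OF hom\<alpha>, of z] that by (simp add: pullback_bundle_simps S_simps(5))
    show "case x of (p, q) \<Rightarrow> ?\<alpha>1 (mult ?PH p q) = mult S (?\<alpha>1 p) (?\<alpha>1 q)" if "x \<in> composable ?PH" for x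
    proof -
      obtain p q where x: "x = (p, q)" by (rule prod.exhaust)
      have pq: "fst p \<in> Z" "snd p \<in> fibre ?H (\<tau> (fst p))" "fst q = fst p" "snd q \<in> fibre ?H (\<tau> (fst p))"
        using that unfolding x composable_def by (auto simp: pullback_bundle_simps(3,4) arrH)
      then show ?thesis
        using group_hom.hom_mult[OF hom\<alpha>[OF pq(1)], of "snd p" "snd q"]
        by (simp add: x pullback_bundle_simps(6) S_simps(6) isoH)
    qed
  qed (simp_all add: pullback_bundle_simps(3,4) S_simps(3,4))
  have cont2: "continuous_map (Arr S) (Arr ?G) (\<lambda>u. \<alpha>' (fst (d u)) (snd (d u)))"
  proof (rule continuous_map_fibrewise[OF continuous_index])
    fix z assume z: "z \<in> Z"
    let ?X = "subtopology (Arr S) {u. fst (d u) = z}"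
    have "continuous_map ?X (T z) (\<lambda>u. snd (d u))"
      by (intro continuous_component[OF z] continuous_map_from_subtopology[OF continuous_map_ident]) simp
    from continuous_map_apply[OF s(5)[OF z] this]
    have "continuous_map ?X (Arr ?G) (\<lambda>u. \<alpha>' z (snd (d u)))" by (simp add: continuous_map_into_isotropy)
    then show "continuous_map ?X (Arr ?G) (\<lambda>u. \<alpha>' (fst (d u)) (snd (d u)))"
      by (rule continuous_map_eq) simp
  qed
  have m2: "strict_morphism S ?PG (\<lambda>z. z) ?\<alpha>2"
    unfolding strict_morphism_def
  proof (intro conjI ballI)
    show "continuous_map (Obj S) (Obj ?PG) (\<lambda>z. z)"
      by (simp add: pullback_grpd_simps S_simps(1) continuous_map_ident)
    have "?\<alpha>2 u \<in> {(z1, g, z2). \<tau> z1 = tgt ?G g \<and> src ?G g = \<tau> z2}" if "u \<in> arr S" for u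
      using that \<alpha>' by (auto simp: arr_S)
    then show "continuous_map (Arr S) (Arr ?PG) ?\<alpha>2"
      unfolding pullback_grpd_simps continuous_map_in_subtopology continuous_map_paired
      using cont2 continuous_index by blast
    show "?\<alpha>2 (idn S z) = idn ?PG z" if "z \<in> obj S" for z
      using group_hom.hom_one[OF hom\<alpha>', of z] that by (simp add: pullback_grpd_simps S_simps(1,5))
    show "case x of (u, v) \<Rightarrow> ?\<alpha>2 (mult S u v) = mult ?PG (?\<alpha>2 u) (?\<alpha>2 v)" if "x \<in> composable S" for x
    proof -
      obtain u v where x: "x = (u, v)" by (rule prod.exhaust)
      have uv: "u \<in> arr S" "v \<in> arr S" "fst (d u) = fst (d v)"
        using that unfolding x by (simp_all add: composable_def S_simps(3,4))
      obtain z a where u: "u = e (z, a)" "z \<in> Z" "a \<in> carrier (M z)" using uv(1) by (rule arr_SE)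
      obtain z' b where v: "v = e (z', b)" "b \<in> carrier (M z')" using uv(2) by (rule arr_SE)
      have "z' = z" using uv(3) u v by simp
      then show ?thesis
        using group_hom.hom_mult[OF hom\<alpha>'[OF u(2)], of a b] u v
        by (simp add: x S_simps(6) pullback_grpd_simps)
    qed
  qed (simp_all add: pullback_grpd_simps S_simps(3,4))
  have img: "?\<alpha>1 ` arr ?PH = ?K"
  proof
    show "?\<alpha>1 ` arr ?PH \<subseteq> ?K"
    proof
      fix u assume "u \<in> ?\<alpha>1 ` arr ?PH"
      then obtain p where p: "p \<in> arr ?PH" "u = ?\<alpha>1 p" by (elim imageE)
      then show "u \<in> ?K" using s(3)[of "fst p"] by (auto simp: arrH)
    qed
    show "?K \<subseteq> ?\<alpha>1 ` arr ?PH"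
    proof
      fix u assume "u \<in> ?K"
      then obtain z m where u: "u = e (z, m)" "z \<in> Z" "m \<in> K z" by blast
      then obtain h where "h \<in> fibre ?H (\<tau> z)" "m = \<alpha> z h" using s(3)[of z] by blast
      then show "u \<in> ?\<alpha>1 ` arr ?PH" using u by (intro image_eqI[of _ _ "(z, h)"]) (simp_all add: arrH)
    qed
  qed
  have inv: "inv_into (fibre ?H (\<tau> z)) (\<alpha> z) (\<alpha> z h) = h" if "z \<in> Z" "h \<in> fibre ?H (\<tau> z)" for z h
    using embedding_map_inverse(2)[OF s(2)[OF that(1)]] that(2) by (simp add: isoH)
  have emb: "embedding_map (Arr ?PH) (Arr S) ?\<alpha>1"
  proof (rule embedding_map_witness[OF cont1])
    let ?g = "\<lambda>u. (fst (d u), inv_into (fibre ?H (\<tau> (fst (d u)))) (\<alpha> (fst (d u))) (snd (d u)))"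
    show "?g (?\<alpha>1 p) = p" if "p \<in> topspace (Arr ?PH)" for p
      using that by (simp add: arrH inv)
    let ?I = "subtopology (Arr S) (?\<alpha>1 ` arr ?PH)"
    have index: "continuous_map ?I (discrete_topology Z) (\<lambda>u. fst (d u))"
      by (rule continuous_map_from_subtopology[OF continuous_index])
    have c: "continuous_map ?I (Arr ?H)
        (\<lambda>u. inv_into (fibre ?H (\<tau> (fst (d u)))) (\<alpha> (fst (d u))) (snd (d u)))"
    proof (rule continuous_map_fibrewise[OF index])
      fix z assume z: "z \<in> Z"
      let ?X = "subtopology ?I {u. fst (d u) = z}"
      have "continuous_map ?X (T z) (\<lambda>u. snd (d u))"
        by (intro continuous_component[OF z] continuous_map_from_subtopology continuous_map_ident) simp
      then have "continuous_map ?X (subtopology (T z) (\<alpha> z ` fibre ?H (\<tau> z))) (\<lambda>u. snd (d u))"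
        unfolding continuous_map_in_subtopology by (auto simp: arrH)
      from continuous_map_apply[OF embedding_map_inverse(3)[OF s(2)[OF z], unfolded topspace_isotropy_top isoH] this]
      have "continuous_map ?X (Arr ?H) (\<lambda>u. inv_into (fibre ?H (\<tau> z)) (\<alpha> z) (snd (d u)))"
        by (simp add: continuous_map_into_isotropy)
      then show "continuous_map ?X (Arr ?H)
          (\<lambda>u. inv_into (fibre ?H (\<tau> (fst (d u)))) (\<alpha> (fst (d u))) (snd (d u)))"
        by (rule continuous_map_eq) simp
    qed
    have g: "?g u \<in> {(z, h). h \<in> fibre ?H (\<tau> z)}" if "u \<in> topspace ?I" for u
      using that by (auto simp: arrH inv)
    show "continuous_map ?I (Arr ?PH) ?g"
      unfolding continuous_map_into_pullback_bundle fst_conv snd_conv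
      using index c g by blast
  qed
  have surj: "?\<alpha>2 ` arr S = arr ?PG"
  proof
    show "?\<alpha>2 ` arr S \<subseteq> arr ?PG" using strict_morphismD(7)[OF m2] by blast
    show "arr ?PG \<subseteq> ?\<alpha>2 ` arr S"
    proof
      fix p assume "p \<in> arr ?PG"
      then obtain z1 g z2 where p: "p = (z1, g, z2)" "z1 \<in> Z" "z2 \<in> Z" "g \<in> arr ?G"
        "tgt ?G g = \<tau> z1" "src ?G g = \<tau> z2" by (auto simp: arr_pullback_grpd)
      have "connected_by ?G (\<tau> z2) (\<tau> z1)"
        unfolding connected_by_def using p by (intro bexI[of _ g]) simp_all
      then have z: "z2 = z1" using separated p by blast
      then have "g \<in> isotropy ?G (\<tau> z1)" using p by (simp add: isotropy_def)
      then obtain m where "m \<in> carrier (M z1)" "g = \<alpha>' z1 m" using s(6)[OF p(2)] by blast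
      then show "p \<in> ?\<alpha>2 ` arr S" using p z by (intro image_eqI[of _ _ "e (z1, m)"]) simp_all
    qed
  qed
  have equi: "?\<alpha>1 ((\<lambda>(_, h) (_, g, z2). (z2, act \<GG> h g)) p (?\<alpha>2 u)) =
      mult S (mult S (inve S u) (?\<alpha>1 p)) u" if u: "u \<in> arr S" and p: "p \<in> fibre ?PH (tgt S u)" for u p
  proof -
    obtain z m where z: "u = e (z, m)" "z \<in> Z" "m \<in> carrier (M z)" using u by (rule arr_SE)
    define h where "h = snd p"
    have "fst p = z" "h \<in> fibre ?H (\<tau> (fst p))"
      using p z by (auto simp: fibre_def[of ?PH] arrH pullback_bundle_simps(3) S_simps(4) h_def)
    then have h: "p = (z, h)" "h \<in> fibre ?H (\<tau> z)" by (auto simp: h_def prod_eq_iff)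
    show ?thesis using z h s(8)[OF z(2,3) h(2)] by (simp add: S_simps(6,7))
  qed
  have bd: "?\<alpha>2 (?\<alpha>1 p) = (\<lambda>(z, h). (z, bdry \<GG> h, z)) p" if "p \<in> arr ?PH" for p
    using that by (simp add: arrH s(7) case_prod_unfold)
  have "continuous_map (discrete_topology Z) (Obj ?G) \<tau>" using \<tau> by auto
  then show ?thesis
    unfolding groupoid_side_def Let_def pullback_xmod_simps S_simps(1)
    using m1 m2 bd emb surj img equi by blast
qed

lemma unit_kernel_sum:
  "unit_kernel S \<sigma> \<GG> (\<lambda>u. (fst (d u), \<beta> (fst (d u)) (snd (d u)), fst (d u))) =
    {e (z, m) |z m. z \<in> Z \<and> m \<in> kernel_set (M z) (base (isotropy_xmod \<GG> (\<sigma> z))) (\<beta> z)}"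
proof -
  have "(z, g, z) \<in> units (pullback_grpd (discrete_topology Z) \<sigma> (Grpd \<GG>)) \<longleftrightarrow> z \<in> Z \<and> g = idn (Grpd \<GG>) (\<sigma> z)"
    for z g by (auto simp: units_def pullback_grpd_simps)
  then show ?thesis
    unfolding unit_kernel_def S_simps(1) kernel_set_def arr_S by (auto simp: inj_eq[OF inj_e])
qed

end

text \<open>One object \<open>z\<close> is chosen in each orbit of \<open>\<GG>1\<close>, together with a related object \<open>\<sigma> z\<close> of \<open>\<GG>2\<close>. As
  the relation matches orbits, the objects \<open>\<sigma> z\<close> lie in different orbits and meet all of them, so
  both halves of the sum are instances of the same lemma.\<close>

lemma linking_imp_crossed_extension:
  fixes \<GG>1 \<GG>2 :: "('u, 'u, 'u) xmod" and e :: "'u \<times> 'u \<Rightarrow> 'u"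
  assumes X1: "crossed_module \<GG>1" and X2: "crossed_module \<GG>2" and e: "inj e"
    and link: "linking \<GG>1 \<GG>2 \<rho>"
  shows "\<exists>(M :: ('u, 'u) tgrpd) \<tau> \<sigma> \<alpha>1 \<alpha>2 \<beta>1 \<beta>2.
            crossed_extension \<GG>1 \<GG>2 M \<tau> \<sigma> \<alpha>1 \<alpha>2 \<beta>1 \<beta>2 \<and>
            essentially_surjective (Obj M) \<tau> (Grpd \<GG>1) \<and>
            essentially_surjective (Obj M) \<sigma> (Grpd \<GG>2)"
proof -
  interpret X1: crossed_module \<GG>1 by (rule X1)
  interpret X2: crossed_module \<GG>2 by (rule X2)
  note link = linkingD[OF link]
  obtain Z where Z: "Z \<subseteq> obj (Grpd \<GG>1)"
      "\<And>x. x \<in> obj (Grpd \<GG>1) \<Longrightarrow> \<exists>z\<in>Z. connected_by (Grpd \<GG>1) x z"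
    and Z_sep: "\<And>z z'. z \<in> Z \<Longrightarrow> z' \<in> Z \<Longrightarrow> connected_by (Grpd \<GG>1) z z' \<Longrightarrow> z = z'"
    by (rule X1.G.orbit_representatives) blast
  have Z_obj: "z \<in> obj (Grpd \<GG>1)" if "z \<in> Z" for z
    using that Z(1) by blast
  have "\<forall>z\<in>Z. \<exists>y. \<rho> z y" using link(1) Z_obj by blast
  then obtain \<sigma> where \<sigma>: "\<And>z. z \<in> Z \<Longrightarrow> \<rho> z (\<sigma> z)" by metis
  have "\<forall>z\<in>Z. \<exists>M :: 'u monoid. \<exists>T \<alpha>1 \<alpha>2 \<beta>1 \<beta>2.
    group_crossed_extension (isotropy_xmod \<GG>1 z) (isotropy_xmod \<GG>2 (\<sigma> z)) M T \<alpha>1 \<alpha>2 \<beta>1 \<beta>2"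
    using link(6)[OF \<sigma>] unfolding isotropy_extension_def by blast
  from bchoice[OF this] obtain M :: "'u \<Rightarrow> 'u monoid" where "\<forall>z\<in>Z. \<exists>T \<alpha>1 \<alpha>2 \<beta>1 \<beta>2.
    group_crossed_extension (isotropy_xmod \<GG>1 z) (isotropy_xmod \<GG>2 (\<sigma> z)) (M z) T \<alpha>1 \<alpha>2 \<beta>1 \<beta>2" ..
  from bchoice[OF this] obtain T where "\<forall>z\<in>Z. \<exists>\<alpha>1 \<alpha>2 \<beta>1 \<beta>2.
    group_crossed_extension (isotropy_xmod \<GG>1 z) (isotropy_xmod \<GG>2 (\<sigma> z)) (M z) (T z) \<alpha>1 \<alpha>2 \<beta>1 \<beta>2" ..
  from bchoice[OF this] obtain \<alpha>1 where "\<forall>z\<in>Z. \<exists>\<alpha>2 \<beta>1 \<beta>2.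
    group_crossed_extension (isotropy_xmod \<GG>1 z) (isotropy_xmod \<GG>2 (\<sigma> z)) (M z) (T z) (\<alpha>1 z) \<alpha>2 \<beta>1 \<beta>2" ..
  from bchoice[OF this] obtain \<alpha>2 where "\<forall>z\<in>Z. \<exists>\<beta>1 \<beta>2.
    group_crossed_extension (isotropy_xmod \<GG>1 z) (isotropy_xmod \<GG>2 (\<sigma> z)) (M z) (T z) (\<alpha>1 z) (\<alpha>2 z) \<beta>1 \<beta>2" ..
  from bchoice[OF this] obtain \<beta>1 where "\<forall>z\<in>Z. \<exists>\<beta>2.
    group_crossed_extension (isotropy_xmod \<GG>1 z) (isotropy_xmod \<GG>2 (\<sigma> z)) (M z) (T z) (\<alpha>1 z) (\<alpha>2 z) (\<beta>1 z) \<beta>2" ..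
  from bchoice[OF this] obtain \<beta>2 where ext: "\<forall>z\<in>Z.
    group_crossed_extension (isotropy_xmod \<GG>1 z) (isotropy_xmod \<GG>2 (\<sigma> z)) (M z) (T z) (\<alpha>1 z) (\<alpha>2 z) (\<beta>1 z) (\<beta>2 z)" ..
  interpret D: group_sum_data M T Z e
    by (intro group_sum_data.intro) (use e ext in \<open>simp_all add: group_crossed_extension_def\<close>)
  let ?a = "\<lambda>u. (fst (D.d u), \<alpha>2 (fst (D.d u)) (snd (D.d u)), fst (D.d u))"
  let ?b = "\<lambda>u. (fst (D.d u), \<beta>2 (fst (D.d u)) (snd (D.d u)), fst (D.d u))"
  have side1: "groupoid_side \<GG>1 D.S (\<lambda>z. z) (unit_kernel D.S \<sigma> \<GG>2 ?b)
      (\<lambda>p. e (fst p, \<alpha>1 (fst p) (snd p))) ?a"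
    unfolding D.unit_kernel_sum
    by (rule D.groupoid_side_sum[OF X1])
      (use ext Z_obj Z_sep in \<open>simp_all add: group_crossed_extension_def\<close>)
  have sep2: "z = z'" if "z \<in> Z" "z' \<in> Z" "connected_by (Grpd \<GG>2) (\<sigma> z) (\<sigma> z')" for z z'
    using link(3)[OF \<sigma>[OF that(1)] \<sigma>[OF that(2)]] that Z_sep by blast
  have side2: "groupoid_side \<GG>2 D.S \<sigma> (unit_kernel D.S (\<lambda>z. z) \<GG>1 ?a)
      (\<lambda>p. e (fst p, \<beta>1 (fst p) (snd p))) ?b"
    unfolding D.unit_kernel_sum
    by (rule D.groupoid_side_sum[OF X2])
      (use ext link(5)[OF \<sigma>] sep2 in \<open>simp_all add: group_crossed_extension_def\<close>)
  have "crossed_extension \<GG>1 \<GG>2 D.S (\<lambda>z. z) \<sigma> (\<lambda>p. e (fst p, \<alpha>1 (fst p) (snd p))) ?a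
      (\<lambda>p. e (fst p, \<beta>1 (fst p) (snd p))) ?b"
    unfolding crossed_extension_iff using D.topological_groupoid_S side1 side2 by blast
  moreover have "essentially_surjective (Obj D.S) (\<lambda>z. z) (Grpd \<GG>1)"
    unfolding X1.G.essentially_surjective_iff D.S_simps(1) using Z(2) by simp
  moreover have "essentially_surjective (Obj D.S) \<sigma> (Grpd \<GG>2)"
    unfolding X2.G.essentially_surjective_iff D.S_simps(1) topspace_discrete_topology
  proof
    fix y assume "y \<in> obj (Grpd \<GG>2)"
    then obtain x where x: "\<rho> x y" using link(2) by blast
    then obtain z where z: "z \<in> Z" "connected_by (Grpd \<GG>1) x z" using Z(2) link(4) by blast
    then show "\<exists>z\<in>Z. connected_by (Grpd \<GG>2) y (\<sigma> z)" using link(3)[OF x \<sigma>[OF z(1)]] by blast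
  qed
  ultimately show ?thesis by blast
qed

section \<open>The associated 2-groupoid\<close>

context crossed_module
begin

abbreviation "TwoG \<equiv> assoc_two_grpd \<GG>"

lemma arrows2_iff: "b \<in> topspace (arrows2 \<GG>) \<longleftrightarrow>
    fst b \<in> arr (Bundle \<GG>) \<and> snd b \<in> arr (Grpd \<GG>) \<and> src (Bundle \<GG>) (fst b) = tgt (Grpd \<GG>) (snd b)"
  by (auto simp: topspace_arrows2 fibre_iff)

lemma continuous_map_into_arrows2:
  "continuous_map X (arrows2 \<GG>) f \<longleftrightarrow> continuous_map X (Arr (Bundle \<GG>)) (\<lambda>x. fst (f x)) \<and>
     continuous_map X (Arr (Grpd \<GG>)) (\<lambda>x. snd (f x)) \<and>
     (\<forall>x\<in>topspace X. fst (f x) \<in> fibre (Bundle \<GG>) (tgt (Grpd \<GG>) (snd (f x))))"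
  by (auto simp: arrows2_def continuous_map_in_subtopology continuous_map_pairwise o_def Pi_iff
      case_prod_unfold)

lemma continuous_fst_arrows2: "continuous_map (arrows2 \<GG>) (Arr (Bundle \<GG>)) fst"
  and continuous_snd_arrows2: "continuous_map (arrows2 \<GG>) (Arr (Grpd \<GG>)) snd"
  using continuous_map_into_arrows2[of "arrows2 \<GG>" "\<lambda>x. x"] continuous_map_ident by blast+

lemma target2_simps:
  assumes "b \<in> topspace (arrows2 \<GG>)"
  shows "target2 \<GG> b \<in> arr (Grpd \<GG>)" "src (Grpd \<GG>) (target2 \<GG> b) = src (Grpd \<GG>) (snd b)"
    "tgt (Grpd \<GG>) (target2 \<GG> b) = tgt (Grpd \<GG>) (snd b)"
  using assms by (simp_all add: arrows2_iff target2_def)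

lemma continuous_target2: "continuous_map (arrows2 \<GG>) (Arr (Grpd \<GG>)) (target2 \<GG>)"
  unfolding target2_def[abs_def]
  by (intro G.continuous_gmult_apply continuous_bdry_apply continuous_fst_arrows2 continuous_snd_arrows2)
    (simp add: arrows2_iff)

lemma topological_groupoid_Ver: "topological_groupoid (Ver TwoG)"
proof
  show "continuous_map (Arr (Ver TwoG)) (Obj (Ver TwoG)) (src (Ver TwoG))"
    "continuous_map (Arr (Ver TwoG)) (Obj (Ver TwoG)) (tgt (Ver TwoG))"
    unfolding assoc_two_grpd_simps by (rule continuous_snd_arrows2, rule continuous_target2)
  show "continuous_map (Obj (Ver TwoG)) (Arr (Ver TwoG)) (idn (Ver TwoG))"
    unfolding assoc_two_grpd_simps continuous_map_into_arrows2
  proof (intro conjI ballI)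
    have "continuous_map (Arr (Grpd \<GG>)) (Arr (Bundle \<GG>)) (\<lambda>g. idn (Bundle \<GG>) (tgt (Grpd \<GG>) g))"
      by (rule H.continuous_idn_apply) (simp add: G.continuous_tgt)
    then show "continuous_map (Arr (Grpd \<GG>)) (Arr (Bundle \<GG>)) (\<lambda>x. fst (idn (Bundle \<GG>) (tgt (Grpd \<GG>) x), x))"
      by simp
    show "fst (idn (Bundle \<GG>) (tgt (Grpd \<GG>) x), x) \<in> fibre (Bundle \<GG>)
        (tgt (Grpd \<GG>) (snd (idn (Bundle \<GG>) (tgt (Grpd \<GG>) x), x)))" if "x \<in> arr (Grpd \<GG>)" for x
      using that H.idn_closed[of "tgt (Grpd \<GG>) x"] H.src_idn[of "tgt (Grpd \<GG>) x"] by (simp add: fibre_iff)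
  qed (simp add: continuous_map_ident)
  show "continuous_map (Arr (Ver TwoG)) (Arr (Ver TwoG)) (inve (Ver TwoG))"
    unfolding assoc_two_grpd_simps continuous_map_into_arrows2 fst_conv snd_conv
    by (intro conjI H.continuous_inve_apply continuous_fst_arrows2 continuous_target2)
      (simp add: fibre_iff arrows2_iff target2_simps)
  let ?C = "subtopology (prod_topology (Arr (Ver TwoG)) (Arr (Ver TwoG))) (composable (Ver TwoG))"
  have comp: "fst p \<in> topspace (arrows2 \<GG>)" "snd p \<in> topspace (arrows2 \<GG>)" "snd (fst p) = target2 \<GG> (snd p)"
    if "p \<in> topspace ?C" for p
    using that by (auto simp: composable_def assoc_two_grpd_simps)
  have fst_C: "continuous_map ?C (arrows2 \<GG>) fst" and snd_C: "continuous_map ?C (arrows2 \<GG>) snd"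
    unfolding assoc_two_grpd_simps by (rule continuous_map_subtopology_fst, rule continuous_map_subtopology_snd)
  have "continuous_map ?C (arrows2 \<GG>) (\<lambda>p. (mult (Bundle \<GG>) (fst (fst p)) (fst (snd p)), snd (snd p)))"
    unfolding continuous_map_into_arrows2 fst_conv snd_conv
  proof (intro conjI ballI H.continuous_gmult_apply continuous_map_apply[OF continuous_fst_arrows2]
      continuous_map_apply[OF continuous_snd_arrows2] fst_C snd_C)
    fix p assume "p \<in> topspace ?C"
    note p = comp[OF this]
    then show "src (Bundle \<GG>) (fst (fst p)) = tgt (Bundle \<GG>) (fst (snd p))"
      by (simp add: arrows2_iff target2_def)
    then show "mult (Bundle \<GG>) (fst (fst p)) (fst (snd p)) \<in> fibre (Bundle \<GG>) (tgt (Grpd \<GG>) (snd (snd p)))"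
      using p by (simp add: fibre_iff arrows2_iff)
  qed
  then show "continuous_map ?C (Arr (Ver TwoG)) (\<lambda>(g, f). mult (Ver TwoG) g f)"
    unfolding assoc_two_grpd_simps by (simp add: case_prod_unfold)
  fix c b a assume "(c, b) \<in> composable (Ver TwoG)" "(b, a) \<in> composable (Ver TwoG)"
  then have "c \<in> topspace (arrows2 \<GG>)" "b \<in> topspace (arrows2 \<GG>)" "a \<in> topspace (arrows2 \<GG>)"
    "snd c = target2 \<GG> b" "snd b = target2 \<GG> a"
    by (simp_all add: composable_def assoc_two_grpd_simps)
  then show "mult (Ver TwoG) (mult (Ver TwoG) c b) a = mult (Ver TwoG) c (mult (Ver TwoG) b a)"
    unfolding assoc_two_grpd_simps by (simp add: arrows2_iff target2_def H.mult_assoc_arr)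
next
  fix b assume "b \<in> arr (Ver TwoG)"
  then have b: "b \<in> topspace (arrows2 \<GG>)" by (simp add: assoc_two_grpd_simps)
  show "mult (Ver TwoG) (idn (Ver TwoG) (tgt (Ver TwoG) b)) b = b"
    "mult (Ver TwoG) b (idn (Ver TwoG) (src (Ver TwoG) b)) = b"
    "src (Ver TwoG) (inve (Ver TwoG) b) = tgt (Ver TwoG) b"
    "tgt (Ver TwoG) (inve (Ver TwoG) b) = src (Ver TwoG) b"
    "mult (Ver TwoG) (inve (Ver TwoG) b) b = idn (Ver TwoG) (src (Ver TwoG) b)"
    "mult (Ver TwoG) b (inve (Ver TwoG) b) = idn (Ver TwoG) (tgt (Ver TwoG) b)"
    unfolding assoc_two_grpd_simps using b
    by (simp_all add: target2_simps(3) arrows2_iff) (simp_all add: target2_def bdry_inve)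
next
  fix g assume "g \<in> obj (Ver TwoG)"
  then have "g \<in> arr (Grpd \<GG>)" by (simp add: assoc_two_grpd_simps)
  then show "src (Ver TwoG) (idn (Ver TwoG) g) = g" "tgt (Ver TwoG) (idn (Ver TwoG) g) = g"
    unfolding assoc_two_grpd_simps by (simp_all add: target2_def)
next
  fix b a assume "(b, a) \<in> composable (Ver TwoG)"
  then have "b \<in> topspace (arrows2 \<GG>)" "a \<in> topspace (arrows2 \<GG>)" "snd b = target2 \<GG> a"
    by (simp_all add: composable_def assoc_two_grpd_simps)
  then show "src (Ver TwoG) (mult (Ver TwoG) b a) = src (Ver TwoG) a"
    "tgt (Ver TwoG) (mult (Ver TwoG) b a) = tgt (Ver TwoG) b"
    unfolding assoc_two_grpd_simps by (simp_all add: arrows2_iff target2_def bdry_mult G.mult_assoc_arr)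
qed

lemma act_inve_bdry:
  assumes "h \<in> arr (Bundle \<GG>)" "k \<in> arr (Bundle \<GG>)" "src (Bundle \<GG>) h = src (Bundle \<GG>) k"
  shows "act \<GG> k (inve (Grpd \<GG>) (bdry \<GG> h)) = mult (Bundle \<GG>) (mult (Bundle \<GG>) h k) (inve (Bundle \<GG>) h)"
  using act_bdry[of "inve (Bundle \<GG>) h" k] assms by (simp add: bdry_inve)

text \<open>The Peiffer identity enters once, in the interchange law: there an element is moved past a
  boundary.\<close>

lemma topological_two_groupoid_assoc: "topological_two_groupoid TwoG"
proof (intro topological_two_groupoid.intro)
  show "topological_groupoid (Hor TwoG)" unfolding assoc_two_grpd_simps by (rule groupoid_Grpd)
  show "topological_groupoid (Ver TwoG)" by (rule topological_groupoid_Ver)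
  show "Obj (Ver TwoG) = Arr (Hor TwoG)" by (simp add: assoc_two_grpd_simps)
  have hcomp_iff: "(b, a) \<in> hcomposable TwoG \<longleftrightarrow> b \<in> topspace (arrows2 \<GG>) \<and> a \<in> topspace (arrows2 \<GG>) \<and>
      src (Grpd \<GG>) (snd b) = tgt (Grpd \<GG>) (snd a)" for b a
    by (simp add: hcomposable_def src0_def tgt0_def assoc_two_grpd_simps)
  let ?C = "subtopology (prod_topology (Arr (Ver TwoG)) (Arr (Ver TwoG))) (hcomposable TwoG)"
  have comp: "fst p \<in> topspace (arrows2 \<GG>)" "snd p \<in> topspace (arrows2 \<GG>)"
    "src (Grpd \<GG>) (snd (fst p)) = tgt (Grpd \<GG>) (snd (snd p))" if "p \<in> topspace ?C" for p
    using that hcomp_iff[of "fst p" "snd p"] by simp_all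
  have fst_C: "continuous_map ?C (arrows2 \<GG>) fst" and snd_C: "continuous_map ?C (arrows2 \<GG>) snd"
    unfolding assoc_two_grpd_simps by (rule continuous_map_subtopology_fst, rule continuous_map_subtopology_snd)
  have "continuous_map ?C (arrows2 \<GG>) (\<lambda>p. (mult (Bundle \<GG>) (fst (fst p))
      (act \<GG> (fst (snd p)) (inve (Grpd \<GG>) (snd (fst p)))), mult (Grpd \<GG>) (snd (fst p)) (snd (snd p))))"
    unfolding continuous_map_into_arrows2 fst_conv snd_conv
    by (intro conjI ballI H.continuous_gmult_apply G.continuous_gmult_apply G.continuous_inve_apply
        continuous_act_apply continuous_map_apply[OF continuous_fst_arrows2]
        continuous_map_apply[OF continuous_snd_arrows2] fst_C snd_C)
      (use comp in \<open>simp_all add: arrows2_iff fibre_iff\<close>)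
  then show "continuous_map ?C (Arr (Ver TwoG)) (\<lambda>(b, a). hcomp TwoG b a)"
    unfolding assoc_two_grpd_simps by (simp add: case_prod_unfold)
  show "src (Hor TwoG) (tgt (Ver TwoG) b) = src0 TwoG b" "tgt (Hor TwoG) (tgt (Ver TwoG) b) = tgt0 TwoG b"
    "hcomp TwoG (idn (Ver TwoG) (idn (Hor TwoG) (tgt0 TwoG b))) b = b"
    "hcomp TwoG b (idn (Ver TwoG) (idn (Hor TwoG) (src0 TwoG b))) = b"
    if "b \<in> arr (Ver TwoG)" for b
  proof -
    have b: "b \<in> topspace (arrows2 \<GG>)" using that by (simp add: assoc_two_grpd_simps)
    then show "src (Hor TwoG) (tgt (Ver TwoG) b) = src0 TwoG b" "tgt (Hor TwoG) (tgt (Ver TwoG) b) = tgt0 TwoG b"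
      by (simp_all add: assoc_two_grpd_simps src0_def tgt0_def target2_simps)
    show "hcomp TwoG (idn (Ver TwoG) (idn (Hor TwoG) (tgt0 TwoG b))) b = b"
      "hcomp TwoG b (idn (Ver TwoG) (idn (Hor TwoG) (src0 TwoG b))) = b"
      using b by (simp_all add: assoc_two_grpd_simps src0_def tgt0_def arrows2_iff)
  qed
  show "hcomp TwoG (idn (Ver TwoG) g) (idn (Ver TwoG) f) = idn (Ver TwoG) (mult (Hor TwoG) g f)"
    if "(g, f) \<in> composable (Hor TwoG)" for g f
  proof -
    have "g \<in> arr (Grpd \<GG>)" "f \<in> arr (Grpd \<GG>)" "src (Grpd \<GG>) g = tgt (Grpd \<GG>) f"
      using that by (simp_all add: composable_def assoc_two_grpd_simps)
    moreover from this have "idn (Bundle \<GG>) (tgt (Grpd \<GG>) g) \<in> arr (Bundle \<GG>)"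
      using H.idn_closed[of "tgt (Grpd \<GG>) g"] by simp
    ultimately show ?thesis
      using H.src_idn[of "tgt (Grpd \<GG>) g"] by (simp add: assoc_two_grpd_simps)
  qed
  fix b a assume "(b, a) \<in> hcomposable TwoG"
  then have b: "fst b \<in> arr (Bundle \<GG>)" "snd b \<in> arr (Grpd \<GG>)" "src (Bundle \<GG>) (fst b) = tgt (Grpd \<GG>) (snd b)"
    and a: "fst a \<in> arr (Bundle \<GG>)" "snd a \<in> arr (Grpd \<GG>)" "src (Bundle \<GG>) (fst a) = tgt (Grpd \<GG>) (snd a)"
    and ba: "src (Grpd \<GG>) (snd b) = tgt (Grpd \<GG>) (snd a)"
    by (simp_all add: hcomp_iff arrows2_iff)
  show "src (Ver TwoG) (hcomp TwoG b a) = mult (Hor TwoG) (src (Ver TwoG) b) (src (Ver TwoG) a)"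
    by (simp add: assoc_two_grpd_simps)
  show "tgt (Ver TwoG) (hcomp TwoG b a) = mult (Hor TwoG) (tgt (Ver TwoG) b) (tgt (Ver TwoG) a)"
    using b a ba
    by (simp add: assoc_two_grpd_simps target2_def bdry_mult bdry_act_arr G.mult_assoc_arr)
  show "hcomp TwoG (hcomp TwoG c b) a = hcomp TwoG c (hcomp TwoG b a)" if "(c, b) \<in> hcomposable TwoG" for c
  proof -
    have c: "fst c \<in> arr (Bundle \<GG>)" "snd c \<in> arr (Grpd \<GG>)" "src (Bundle \<GG>) (fst c) = tgt (Grpd \<GG>) (snd c)"
      and cb: "src (Grpd \<GG>) (snd c) = tgt (Grpd \<GG>) (snd b)"
      using that by (simp_all add: hcomp_iff arrows2_iff)
    show ?thesis
      using a b c ba cb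
      by (simp add: assoc_two_grpd_simps act_mult act_comp G.inve_mult H.mult_assoc_arr G.mult_assoc_arr)
  qed
  show "hcomp TwoG (mult (Ver TwoG) b' b) (mult (Ver TwoG) a' a) =
      mult (Ver TwoG) (hcomp TwoG b' a') (hcomp TwoG b a)"
    if "(b', b) \<in> composable (Ver TwoG)" "(a', a) \<in> composable (Ver TwoG)" for b' a'
  proof -
    have b': "fst b' \<in> arr (Bundle \<GG>)" "snd b' = mult (Grpd \<GG>) (bdry \<GG> (fst b)) (snd b)"
        "src (Bundle \<GG>) (fst b') = src (Bundle \<GG>) (fst b)"
      and a': "fst a' \<in> arr (Bundle \<GG>)" "snd a' = mult (Grpd \<GG>) (bdry \<GG> (fst a)) (snd a)"
        "src (Bundle \<GG>) (fst a') = src (Bundle \<GG>) (fst a)"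
      using that a b by (auto simp: composable_def assoc_two_grpd_simps arrows2_iff target2_def)
    let ?k = "act \<GG> (fst a') (inve (Grpd \<GG>) (snd b))"
    have "act \<GG> (fst a') (inve (Grpd \<GG>) (snd b')) = act \<GG> ?k (inve (Grpd \<GG>) (bdry \<GG> (fst b)))"
      using a b a' b' ba by (simp add: G.inve_mult act_comp)
    also have "\<dots> = mult (Bundle \<GG>) (mult (Bundle \<GG>) (fst b) ?k) (inve (Bundle \<GG>) (fst b))"
      using a b a' ba by (intro act_inve_bdry) simp_all
    finally show ?thesis
      using a b a' b'(1,3) ba
      by (simp add: assoc_two_grpd_simps act_mult H.mult_assoc_arr)
  qed
qed

end

lemma strict_two_functor_assoc:
  assumes X1: "crossed_module \<GG>1" and X2: "crossed_module \<GG>2"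
    and \<chi>: "strict_xmod_morphism \<GG>1 \<GG>2 \<chi>0 \<chi>G \<chi>H"
  shows "strict_two_functor (assoc_two_grpd \<GG>1) (assoc_two_grpd \<GG>2) \<chi>0 \<chi>G (map_prod \<chi>H \<chi>G)"
proof -
  interpret X1: crossed_module \<GG>1 by (rule X1)
  interpret X2: crossed_module \<GG>2 by (rule X2)
  have mG: "strict_morphism (Grpd \<GG>1) (Grpd \<GG>2) \<chi>0 \<chi>G" and mH: "strict_morphism (Bundle \<GG>1) (Bundle \<GG>2) \<chi>0 \<chi>H"
    and chi_bdry: "\<And>h. h \<in> arr (Bundle \<GG>1) \<Longrightarrow> \<chi>G (bdry \<GG>1 h) = bdry \<GG>2 (\<chi>H h)"
    and chi_act: "\<And>g h. g \<in> arr (Grpd \<GG>1) \<Longrightarrow> h \<in> fibre (Bundle \<GG>1) (tgt (Grpd \<GG>1) g) \<Longrightarrow>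
        \<chi>H (act \<GG>1 h g) = act \<GG>2 (\<chi>H h) (\<chi>G g)"
    using \<chi> unfolding strict_xmod_morphism_def by blast+
  note sG = strict_morphismD[OF mG] and sH = strict_morphismD[OF mH]
  have inve: "\<chi>G (inve (Grpd \<GG>1) g) = inve (Grpd \<GG>2) (\<chi>G g)" if "g \<in> arr (Grpd \<GG>1)" for g
    using that sG(6)[of "inve (Grpd \<GG>1) g" g] sG(5)[of "src (Grpd \<GG>1) g"]
    by (intro X2.G.inve_unique) (simp_all add: sG(3,4,7))
  have cont: "continuous_map (arrows2 \<GG>1) (arrows2 \<GG>2) (map_prod \<chi>H \<chi>G)"
    unfolding X2.continuous_map_into_arrows2
    using continuous_map_apply[OF sH(2) X1.continuous_fst_arrows2] continuous_map_apply[OF sG(2) X1.continuous_snd_arrows2]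
    by (auto simp: map_prod_def case_prod_unfold X2.fibre_iff X1.arrows2_iff sG(3,4) sH(3,7))
  have target: "target2 \<GG>2 (map_prod \<chi>H \<chi>G b) = \<chi>G (target2 \<GG>1 b)" if "b \<in> topspace (arrows2 \<GG>1)" for b
    using that by (simp add: target2_def X1.arrows2_iff map_prod_def case_prod_unfold sG(6) chi_bdry)
  show ?thesis
    unfolding strict_two_functor_def assoc_two_grpd_simps(1)
  proof (intro conjI mG)
    show "strict_morphism (Ver (assoc_two_grpd \<GG>1)) (Ver (assoc_two_grpd \<GG>2)) \<chi>G (map_prod \<chi>H \<chi>G)"
      unfolding strict_morphism_def assoc_two_grpd_simps
    proof (intro conjI ballI sG(2) cont)
      show "snd (map_prod \<chi>H \<chi>G b) = \<chi>G (snd b)" for b by (simp add: snd_map_prod)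
      show "target2 \<GG>2 (map_prod \<chi>H \<chi>G b) = \<chi>G (target2 \<GG>1 b)" if "b \<in> topspace (arrows2 \<GG>1)" for b
        by (rule target[OF that])
      show "map_prod \<chi>H \<chi>G (idn (Bundle \<GG>1) (tgt (Grpd \<GG>1) g), g) =
          (idn (Bundle \<GG>2) (tgt (Grpd \<GG>2) (\<chi>G g)), \<chi>G g)" if "g \<in> arr (Grpd \<GG>1)" for g
        using that sH(5)[of "tgt (Grpd \<GG>1) g"] by (simp add: sG(4))
      show "case p of (b, a) \<Rightarrow> map_prod \<chi>H \<chi>G (mult (Bundle \<GG>1) (fst b) (fst a), snd a) =
          (mult (Bundle \<GG>2) (fst (map_prod \<chi>H \<chi>G b)) (fst (map_prod \<chi>H \<chi>G a)), snd (map_prod \<chi>H \<chi>G a))"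
        if "p \<in> composable (Ver (assoc_two_grpd \<GG>1))" for p
        using that sH(6) by (auto simp: composable_def assoc_two_grpd_simps X1.arrows2_iff target2_def)
    qed
    show "\<forall>(b, a)\<in>hcomposable (assoc_two_grpd \<GG>1). map_prod \<chi>H \<chi>G (hcomp (assoc_two_grpd \<GG>1) b a) =
        hcomp (assoc_two_grpd \<GG>2) (map_prod \<chi>H \<chi>G b) (map_prod \<chi>H \<chi>G a)"
      unfolding assoc_two_grpd_simps
      by (auto simp: hcomposable_def src0_def tgt0_def assoc_two_grpd_simps X1.arrows2_iff X1.fibre_iff
          sH(6) sG(6) chi_act inve)
  qed
qed

text \<open>For a strict morphism of crossed modules, the axioms of the two 2-groupoids and
  2-functoriality hold automatically; what remains are the three conditions of a weak equivalence.\<close>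

lemma hypercoverI:
  assumes X1: "crossed_module \<GG>1" and X2: "crossed_module \<GG>2"
    and \<chi>: "strict_xmod_morphism \<GG>1 \<GG>2 \<chi>0 \<chi>G \<chi>H"
    and ess: "essentially_surjective (Obj (Grpd \<GG>1)) \<chi>0 (Grpd \<GG>2)"
    and full: "fullness \<GG>1 \<GG>2 \<chi>0 \<chi>G" and faithful: "faithfulness \<GG>1 \<GG>2 \<chi>G \<chi>H"
  shows "hypercover \<GG>1 \<GG>2 \<chi>0 \<chi>G \<chi>H"
proof -
  have "strict_morphism (Grpd \<GG>1) (Grpd \<GG>2) \<chi>0 \<chi>G" using \<chi> by (simp add: strict_xmod_morphism_def)
  note full' = fullness_iff[OF X2 this crossed_module.groupoid_Grpd[OF X1], THEN iffD2, OF full]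
  show ?thesis
    unfolding hypercover_def weak_equivalence_def assoc_two_grpd_simps
    using \<chi> ess full' faithful[unfolded faithfulness_def] strict_two_functor_assoc[OF X1 X2 \<chi>]
      crossed_module.topological_two_groupoid_assoc[OF X1] crossed_module.topological_two_groupoid_assoc[OF X2]
    by blast
qed

section \<open>The crossed module of two commuting bundles\<close>

definition full_subgroupoid :: "('z, 'm) tgrpd \<Rightarrow> 'z set \<Rightarrow> ('z, 'm) tgrpd" where
  "full_subgroupoid M W = M\<lparr>Obj := subtopology (Obj M) W,
     Arr := subtopology (Arr M) {m. src M m \<in> W \<and> tgt M m \<in> W}\<rparr>"

lemma full_subgroupoid_simps:
  "Obj (full_subgroupoid M W) = subtopology (Obj M) W"
  "Arr (full_subgroupoid M W) = subtopology (Arr M) {m. src M m \<in> W \<and> tgt M m \<in> W}"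
  "src (full_subgroupoid M W) = src M" "tgt (full_subgroupoid M W) = tgt M"
  "idn (full_subgroupoid M W) = idn M" "mult (full_subgroupoid M W) = mult M"
  "inve (full_subgroupoid M W) = inve M"
  by (simp_all add: full_subgroupoid_def)

lemma (in topological_groupoid) topological_groupoid_full_subgroupoid:
  "topological_groupoid (full_subgroupoid G W)"
proof
  let ?F = "full_subgroupoid G W"
  show "continuous_map (Arr ?F) (Obj ?F) (src ?F)" "continuous_map (Arr ?F) (Obj ?F) (tgt ?F)"
    using continuous_src continuous_tgt
    by (auto simp: full_subgroupoid_simps continuous_map_in_subtopology continuous_map_from_subtopology)
  show "continuous_map (Obj ?F) (Arr ?F) (idn ?F)" "continuous_map (Arr ?F) (Arr ?F) (inve ?F)"
    using continuous_idn continuous_inve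
    by (auto simp: full_subgroupoid_simps continuous_map_in_subtopology continuous_map_from_subtopology)
  have fst_F: "continuous_map (subtopology (prod_topology (Arr ?F) (Arr ?F)) (composable ?F)) (Arr G) fst"
    and snd_F: "continuous_map (subtopology (prod_topology (Arr ?F) (Arr ?F)) (composable ?F)) (Arr G) snd"
    using continuous_map_subtopology_fst[of "Arr ?F" "Arr ?F"] continuous_map_subtopology_snd[of "Arr ?F" "Arr ?F"]
    unfolding full_subgroupoid_simps continuous_map_in_subtopology[of _ "Arr G"] by blast+
  have "continuous_map (subtopology (prod_topology (Arr ?F) (Arr ?F)) (composable ?F)) (Arr G)
      (\<lambda>p. mult G (fst p) (snd p))"
    by (rule continuous_gmult_apply[OF fst_F snd_F]) (auto simp: composable_def full_subgroupoid_simps)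
  then show "continuous_map (subtopology (prod_topology (Arr ?F) (Arr ?F)) (composable ?F)) (Arr ?F)
     (\<lambda>(g, f). mult ?F g f)"
    unfolding full_subgroupoid_simps(2)[of G W]
    by (auto simp: continuous_map_in_subtopology[of _ "Arr G"] composable_def full_subgroupoid_simps
        case_prod_unfold Pi_iff)
qed (auto simp: composable_def full_subgroupoid_simps mult_assoc_arr)

text \<open>Two bundles \<open>A\<close> and \<open>B\<close> of subgroups of the isotropy of a groupoid, both stable under
  conjugation, that commute with each other. The product bundle then is a crossed module over the
  groupoid, the boundary being multiplication; commutation is needed for the boundary to be
  multiplicative and for the Peiffer identity. The injection \<open>e\<close> encodes pairs.\<close>

locale commuting_pair = topological_groupoid N for N :: "('z, 'm) tgrpd" +
  fixes A B :: "'m set" and e :: "'m \<times> 'm \<Rightarrow> 'h"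
  assumes inj_e: "inj e"
    and isotropic: "x \<in> A \<union> B \<Longrightarrow> x \<in> arr N \<and> src N x = tgt N x"
    and units_A: "z \<in> obj N \<Longrightarrow> idn N z \<in> A" and units_B: "z \<in> obj N \<Longrightarrow> idn N z \<in> B"
    and mult_A: "x \<in> A \<Longrightarrow> y \<in> A \<Longrightarrow> src N x = src N y \<Longrightarrow> mult N x y \<in> A"
    and mult_B: "x \<in> B \<Longrightarrow> y \<in> B \<Longrightarrow> src N x = src N y \<Longrightarrow> mult N x y \<in> B"
    and inve_A: "x \<in> A \<Longrightarrow> inve N x \<in> A" and inve_B: "x \<in> B \<Longrightarrow> inve N x \<in> B"
    and conj_A: "x \<in> A \<Longrightarrow> m \<in> arr N \<Longrightarrow> src N x = tgt N m \<Longrightarrow> mult N (inve N m) (mult N x m) \<in> A"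
    and conj_B: "x \<in> B \<Longrightarrow> m \<in> arr N \<Longrightarrow> src N x = tgt N m \<Longrightarrow> mult N (inve N m) (mult N x m) \<in> B"
    and commute: "x \<in> A \<Longrightarrow> y \<in> B \<Longrightarrow> src N x = src N y \<Longrightarrow> mult N x y = mult N y x"
begin

lemma A_simps [simp]: "x \<in> A \<Longrightarrow> x \<in> arr N" "x \<in> A \<Longrightarrow> tgt N x = src N x"
  and B_simps [simp]: "x \<in> B \<Longrightarrow> x \<in> arr N" "x \<in> B \<Longrightarrow> tgt N x = src N x"
  using isotropic by auto

definition pairs :: "('m \<times> 'm) topology" where
  "pairs = subtopology (prod_topology (Arr N) (Arr N)) {(x, y). x \<in> A \<and> y \<in> B \<and> src N x = src N y}"

definition d :: "'h \<Rightarrow> 'm \<times> 'm" where "d = inv_into UNIV e"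

lemma d_e [simp]: "d (e p) = p"
  by (simp add: d_def inj_e)

lemma pairs_iff: "p \<in> topspace pairs \<longleftrightarrow> fst p \<in> A \<and> snd p \<in> B \<and> src N (fst p) = src N (snd p)"
  by (auto simp: pairs_def mem_Times_iff)

lemma continuous_map_into_pairs:
  "continuous_map X pairs f \<longleftrightarrow> continuous_map X (Arr N) (\<lambda>x. fst (f x)) \<and>
     continuous_map X (Arr N) (\<lambda>x. snd (f x)) \<and> (\<forall>x\<in>topspace X. f x \<in> topspace pairs)"
  unfolding pairs_iff
  by (auto simp: pairs_def continuous_map_in_subtopology continuous_map_pairwise o_def Pi_iff case_prod_unfold)

definition H :: "('z, 'h) tgrpd" where
  "H = \<lparr> Obj = Obj N, Arr = coinduced pairs e,
     src = (\<lambda>u. src N (fst (d u))), tgt = (\<lambda>u. src N (fst (d u))),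
     idn = (\<lambda>z. e (idn N z, idn N z)),
     mult = (\<lambda>u v. e (mult N (fst (d u)) (fst (d v)), mult N (snd (d u)) (snd (d v)))),
     inve = (\<lambda>u. e (inve N (fst (d u)), inve N (snd (d u)))) \<rparr>"

definition conj :: "'h \<Rightarrow> 'm \<Rightarrow> 'h" where
  "conj u m = e (mult N (inve N m) (mult N (fst (d u)) m), mult N (inve N m) (mult N (snd (d u)) m))"

definition X :: "('z, 'm, 'h) xmod" where
  "X = \<lparr> Grpd = N, Bundle = H, bdry = (\<lambda>u. mult N (fst (d u)) (snd (d u))), act = conj \<rparr>"

lemma H_simps:
  "Obj H = Obj N" "Arr H = coinduced pairs e" "src H u = src N (fst (d u))" "tgt H u = src N (fst (d u))"
  "idn H z = e (idn N z, idn N z)"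
  "mult H u v = e (mult N (fst (d u)) (fst (d v)), mult N (snd (d u)) (snd (d v)))"
  "inve H u = e (inve N (fst (d u)), inve N (snd (d u)))"
  by (simp_all add: H_def)

lemma arr_H: "u \<in> arr H \<longleftrightarrow> (\<exists>a b. u = e (a, b) \<and> a \<in> A \<and> b \<in> B \<and> src N a = src N b)"
proof -
  have "arr H = e ` topspace pairs" by (simp add: H_simps)
  then show ?thesis by (auto simp: pairs_iff inj_eq[OF inj_e])
qed

lemma arr_HE:
  assumes "u \<in> arr H"
  obtains a b where "u = e (a, b)" "a \<in> A" "b \<in> B" "src N a = src N b"
  using assms arr_H by blast

lemma e_arr_H: "e (a, b) \<in> arr H \<longleftrightarrow> a \<in> A \<and> b \<in> B \<and> src N a = src N b"
  using inj_e by (auto simp: arr_H inj_eq)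

lemma continuous_d: "continuous_map (Arr H) pairs d"
  unfolding H_simps by (rule continuous_map_decode) simp

lemma continuous_fst_d: "continuous_map Y (Arr H) f \<Longrightarrow> continuous_map Y (Arr N) (\<lambda>y. fst (d (f y)))"
  and continuous_snd_d: "continuous_map Y (Arr H) f \<Longrightarrow> continuous_map Y (Arr N) (\<lambda>y. snd (d (f y)))"
  using continuous_map_apply[OF continuous_d, of Y f] by (simp_all add: continuous_map_into_pairs)

lemma continuous_map_into_H:
  "continuous_map Y (Arr N) f \<Longrightarrow> continuous_map Y (Arr N) g \<Longrightarrow>
    (\<And>y. y \<in> topspace Y \<Longrightarrow> f y \<in> A \<and> g y \<in> B \<and> src N (f y) = src N (g y)) \<Longrightarrow>
    continuous_map Y (Arr H) (\<lambda>y. e (f y, g y))"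
  unfolding H_simps
  by (intro continuous_map_apply[OF continuous_map_to_coinduced])
    (simp add: continuous_map_into_pairs pairs_iff)

lemma d_arr:
  assumes "u \<in> arr H"
  shows "fst (d u) \<in> A" "snd (d u) \<in> B" "src N (snd (d u)) = src N (fst (d u))" "e (d u) = u"
  using assms by (auto elim!: arr_HE)

lemma group_bundle_H: "group_bundle H"
proof (intro group_bundle.intro group_bundle_axioms.intro)
  show "topological_groupoid H"
  proof
    show "continuous_map (Arr H) (Obj H) (src H)" "continuous_map (Arr H) (Obj H) (tgt H)"
      unfolding H_simps(1) H_simps(3,4)[abs_def]
      by (intro continuous_src_apply continuous_fst_d continuous_map_ident)+
    show "continuous_map (Obj H) (Arr H) (idn H)"
      unfolding H_simps(1) H_simps(5)[abs_def]
      by (intro continuous_map_into_H continuous_idn) (simp add: units_A units_B)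
    show "continuous_map (Arr H) (Arr H) (inve H)"
      unfolding H_simps(7)[abs_def]
      by (intro continuous_map_into_H continuous_inve_apply continuous_fst_d continuous_snd_d continuous_map_ident)
        (simp add: d_arr inve_A inve_B)
    let ?C = "subtopology (prod_topology (Arr H) (Arr H)) (composable H)"
    have C: "fst p \<in> arr H" "snd p \<in> arr H" "src N (fst (d (fst p))) = src N (fst (d (snd p)))"
      if "p \<in> topspace ?C" for p
      using that by (auto simp: composable_def H_simps(3,4))
    have "continuous_map ?C (Arr H) (\<lambda>p. mult H (fst p) (snd p))"
      unfolding H_simps(6)
      by (intro continuous_map_into_H continuous_gmult_apply continuous_fst_d continuous_snd_d
          continuous_map_subtopology_fst continuous_map_subtopology_snd)
        (use C in \<open>simp_all add: d_arr mult_A mult_B\<close>)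
    then show "continuous_map ?C (Arr H) (\<lambda>(g, f). mult H g f)" by (simp add: case_prod_unfold)
    fix g f h assume "(g, f) \<in> composable H" "(f, h) \<in> composable H"
    then show "mult H (mult H g f) h = mult H g (mult H f h)"
      by (simp add: composable_def H_simps(3,4,6) d_arr mult_assoc_arr)
  next
    fix g assume g: "g \<in> arr H"
    show "mult H (idn H (tgt H g)) g = g" "mult H g (idn H (src H g)) = g"
      "mult H (inve H g) g = idn H (src H g)" "mult H g (inve H g) = idn H (tgt H g)"
      "src H (inve H g) = tgt H g" "tgt H (inve H g) = src H g"
      using g by (simp_all add: H_simps(3-7) d_arr)
  qed (simp_all add: H_simps(1,3-6) composable_def d_arr)
qed (simp add: H_simps(3,4))

lemma X_simps:
  "Grpd X = N" "Bundle X = H" "bdry X u = mult N (fst (d u)) (snd (d u))" "act X = conj"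
  by (simp_all add: X_def)

lemma conj_arr:
  assumes "u \<in> arr H" "m \<in> arr N" "src H u = tgt N m"
  shows "conj u m \<in> arr H" "src H (conj u m) = src N m"
  using assms conj_A[of "fst (d u)" m] conj_B[of "snd (d u)" m]
  by (simp_all add: conj_def e_arr_H d_arr H_simps(3))

lemma conj_comp:
  assumes "u \<in> arr H" "m \<in> arr N" "n \<in> arr N" "src H u = tgt N m" "src N m = tgt N n"
  shows "conj u (mult N m n) = conj (conj u m) n"
  using assms by (simp add: conj_def d_arr H_simps(3) inve_mult mult_assoc_arr)

lemma conj_idn: "u \<in> arr H \<Longrightarrow> conj u (idn N (src H u)) = u"
  by (simp add: conj_def d_arr H_simps(3))

lemma continuous_conj:
  assumes "continuous_map Y (Arr H) f" "continuous_map Y (Arr N) g"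
    and src: "\<And>y. y \<in> topspace Y \<Longrightarrow> src H (f y) = tgt N (g y)"
  shows "continuous_map Y (Arr H) (\<lambda>y. conj (f y) (g y))"
  unfolding conj_def
proof (intro continuous_map_into_H continuous_gmult_apply continuous_inve_apply continuous_fst_d
    continuous_snd_d assms(1,2))
  fix y assume y: "y \<in> topspace Y"
  note 1 = continuous_map_point[OF assms(1) y] continuous_map_point[OF assms(2) y] src[OF y]
  show "src N (fst (d (f y))) = tgt N (g y)" "src N (snd (d (f y))) = tgt N (g y)"
    "src N (inve N (g y)) = tgt N (mult N (fst (d (f y))) (g y))"
    "src N (inve N (g y)) = tgt N (mult N (snd (d (f y))) (g y))"
    using 1 by (simp_all add: d_arr H_simps(3))
  show "mult N (inve N (g y)) (mult N (fst (d (f y))) (g y)) \<in> A \<and>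
      mult N (inve N (g y)) (mult N (snd (d (f y))) (g y)) \<in> B \<and>
      src N (mult N (inve N (g y)) (mult N (fst (d (f y))) (g y))) =
      src N (mult N (inve N (g y)) (mult N (snd (d (f y))) (g y)))"
    using 1 conj_A[of "fst (d (f y))" "g y"] conj_B[of "snd (d (f y))" "g y"]
    by (simp add: d_arr H_simps(3))
qed

lemma crossed_module_X: "crossed_module X"
proof (intro crossed_module.intro, unfold X_simps(1,2,4))
  show "topological_groupoid N" by (rule topological_groupoid_axioms)
  show "group_bundle H" by (rule group_bundle_H)
  interpret H: group_bundle H by (rule group_bundle_H)
  show "Obj H = Obj N" by (simp add: H_simps)
  have fib: "h \<in> fibre H x \<longleftrightarrow> h \<in> arr H \<and> src H h = x" for h x by (simp add: fibre_def)
  show "strict_morphism H N (\<lambda>x. x) (bdry X)"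
    unfolding strict_morphism_def
  proof (intro conjI ballI)
    show "continuous_map (Obj H) (Obj N) (\<lambda>x. x)" by (simp add: H_simps(1) continuous_map_ident)
    show "continuous_map (Arr H) (Arr N) (bdry X)"
      unfolding X_simps(3)[abs_def]
      by (intro continuous_gmult_apply continuous_fst_d continuous_snd_d continuous_map_ident) (simp add: d_arr)
    show "src N (bdry X g) = src H g" "tgt N (bdry X g) = tgt H g" if "g \<in> arr H" for g
      using that by (simp_all add: X_simps(3) H_simps(3,4) d_arr)
    show "bdry X (idn H x) = idn N x" if "x \<in> obj H" for x
      using that by (simp add: X_simps(3) H_simps(1,5))
    show "case p of (g, f) \<Rightarrow> bdry X (mult H g f) = mult N (bdry X g) (bdry X f)" if "p \<in> composable H" for p
    proof -
      obtain u v where p: "p = (u, v)" by (rule prod.exhaust)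
      have uv: "u \<in> arr H" "v \<in> arr H" "src N (fst (d u)) = src N (fst (d v))"
        using that unfolding p by (simp_all add: composable_def H_simps(3,4))
      have "mult N (fst (d v)) (mult N (snd (d u)) (snd (d v))) =
          mult N (mult N (fst (d v)) (snd (d u))) (snd (d v))"
        using uv by (simp add: d_arr mult_assoc_arr)
      also have "\<dots> = mult N (mult N (snd (d u)) (fst (d v))) (snd (d v))"
        using uv commute[of "fst (d v)" "snd (d u)"] by (simp add: d_arr)
      finally show ?thesis
        using uv by (simp add: p X_simps(3) H_simps(6) d_arr mult_assoc_arr)
    qed
  qed
  show "groupoid_action N H conj"
  proof
    show "homeomorphic_map (subtopology (Arr H) (fibre H (tgt N g))) (subtopology (Arr H) (fibre H (src N g)))
        (\<lambda>h. conj h g)" if g: "g \<in> arr N" for g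
    proof (rule homeomorphic_map_witness[where g = "\<lambda>h. conj h (inve N g)"])
      have c: "continuous_map (subtopology (Arr H) (fibre H (tgt N k))) (subtopology (Arr H) (fibre H (src N k)))
          (\<lambda>h. conj h k)" if k: "k \<in> arr N" for k
        unfolding continuous_map_in_subtopology
      proof
        show "continuous_map (subtopology (Arr H) (fibre H (tgt N k))) (Arr H) (\<lambda>h. conj h k)"
          by (rule continuous_conj) (use k in \<open>auto simp: fib continuous_map_from_subtopology continuous_map_ident\<close>)
        show "(\<lambda>h. conj h k) \<in> topspace (subtopology (Arr H) (fibre H (tgt N k))) \<rightarrow> fibre H (src N k)"
          using k conj_arr by (auto simp: fib)
      qed
      show "continuous_map (subtopology (Arr H) (fibre H (tgt N g))) (subtopology (Arr H) (fibre H (src N g)))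
          (\<lambda>h. conj h g)" by (rule c[OF g])
      show "continuous_map (subtopology (Arr H) (fibre H (src N g))) (subtopology (Arr H) (fibre H (tgt N g)))
          (\<lambda>h. conj h (inve N g))" using c[of "inve N g"] g by simp
      show "conj (conj h g) (inve N g) = h" if "h \<in> topspace (subtopology (Arr H) (fibre H (tgt N g)))" for h
        using that g conj_comp[of h g "inve N g"] conj_idn[of h] by (simp add: fib)
      show "conj (conj h (inve N g)) g = h" if "h \<in> topspace (subtopology (Arr H) (fibre H (src N g)))" for h
        using that g conj_comp[of h "inve N g" g] conj_idn[of h] by (simp add: fib)
    qed
    show "conj (mult H h k) g = mult H (conj h g) (conj k g)"
      if "g \<in> arr N" "h \<in> fibre H (tgt N g)" "k \<in> fibre H (tgt N g)" for g h k
      using that by (simp add: fib conj_def H_simps(3,6) d_arr mult_assoc_arr)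
    have "continuous_map (subtopology (prod_topology (Arr H) (Arr N)) {(h, g). src H h = tgt N g}) (Arr H)
        (\<lambda>p. conj (fst p) (snd p))"
      by (rule continuous_conj) (auto simp: continuous_map_subtopology_fst continuous_map_subtopology_snd)
    then show "continuous_map (subtopology (prod_topology (Arr H) (Arr N)) {(h, g). src H h = tgt N g}) (Arr H)
        (\<lambda>(h, g). conj h g)" by (simp add: case_prod_unfold)
    show "conj h (mult N g f) = conj (conj h g) f"
      if "(g, f) \<in> composable N" "h \<in> fibre H (tgt N g)" for g f h
      using that conj_comp[of h g f] by (simp add: fib composable_def)
    show "conj h (idn N x) = h" if "x \<in> obj N" "h \<in> fibre H x" for x h
      using that conj_idn[of h] by (simp add: fib)
  qed
  show "bdry X (conj h g) = mult N (mult N (inve N g) (bdry X h)) g" if "g \<in> arr N" "h \<in> fibre H (tgt N g)" for g h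
    using that by (simp add: fib X_simps(3) conj_def H_simps(3) d_arr mult_assoc_arr)
  show "conj k (bdry X h) = mult H (mult H (inve H h) k) h" if h: "h \<in> fibre H x" and k: "k \<in> fibre H x" for h k x
  proof -
    have hk: "h \<in> arr H" "k \<in> arr H" "src H h = src H k" using h k by (simp_all add: fib)
    obtain a b where h: "h = e (a, b)" "a \<in> A" "b \<in> B" "src N a = src N b"
      using hk(1) by (rule arr_HE)
    obtain a' b' where k: "k = e (a', b')" "a' \<in> A" "b' \<in> B" "src N a' = src N b'"
      using hk(2) by (rule arr_HE)
    have s: "src N a' = src N a" using hk(3) h k by (simp add: H_simps(3))
    \<comment> \<open>Conjugating by \<open>ab\<close> amounts to conjugating by \<open>a\<close> in the first component and, after exchanging
    the two factors, by \<open>b\<close> in the second one.\<close>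
    have "mult N (inve N (mult N a b)) (mult N a' (mult N a b)) =
        mult N (inve N b) (mult N (mult N (inve N a) (mult N a' a)) b)"
      using h k s by (simp add: inve_mult mult_assoc_arr)
    also have "\<dots> = mult N (inve N b) (mult N b (mult N (inve N a) (mult N a' a)))"
      using commute[of "mult N (inve N a) (mult N a' a)" b] h k s mult_A inve_A by simp
    also have "\<dots> = mult N (mult N (inve N a) a') a"
      using h k s by (simp add: mult_assoc_arr)
    finally have 1: "mult N (inve N (mult N a b)) (mult N a' (mult N a b)) = mult N (mult N (inve N a) a') a" .
    have "mult N (inve N b) (mult N b' b) \<in> B" using h k s by (intro conj_B) simp_all
    then have c: "mult N (mult N (inve N b) (mult N b' b)) a = mult N a (mult N (inve N b) (mult N b' b))"
      using h k s by (intro commute[symmetric]) simp_all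
    have "mult N (inve N (mult N a b)) (mult N b' (mult N a b)) =
        mult N (inve N (mult N b a)) (mult N b' (mult N b a))"
      using commute[of a b] h by simp
    also have "\<dots> = mult N (inve N a) (mult N (mult N (inve N b) (mult N b' b)) a)"
      using h k s by (simp add: inve_mult mult_assoc_arr)
    also have "\<dots> = mult N (inve N a) (mult N a (mult N (inve N b) (mult N b' b)))"
      by (simp only: c)
    also have "\<dots> = mult N (mult N (inve N b) b') b"
      using h k s by (simp add: mult_assoc_arr)
    finally have 2: "mult N (inve N (mult N a b)) (mult N b' (mult N a b)) = mult N (mult N (inve N b) b') b" .
    show ?thesis unfolding conj_def X_simps(3) H_simps(6,7) h(1) k(1) d_e fst_conv snd_conv 1 2 ..
  qed
qed

end

section \<open>The span of hypercovers of a crossed extension\<close>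

text \<open>One half of a crossed extension of groupoids, with its structure maps stripped of the base
  points that the pullbacks carry: \<open>p\<close> is the middle component of \<open>\<alpha>2\<close>, and \<open>\<kappa>\<close> is the inverse of
  \<open>\<alpha>1\<close>, defined on the kernel \<open>K\<close> and forgetting the base point.\<close>

locale extension_half = crossed_module \<GG> + M: topological_groupoid M
  for \<GG> :: "('x, 'g, 'h) xmod" and M :: "('z, 'm) tgrpd" +
  fixes \<tau> :: "'z \<Rightarrow> 'x" and K :: "'m set" and \<alpha>1 :: "'z \<times> 'h \<Rightarrow> 'm" and \<alpha>2 :: "'m \<Rightarrow> 'z \<times> 'g \<times> 'z"
  assumes side: "groupoid_side \<GG> M \<tau> K \<alpha>1 \<alpha>2"
begin

abbreviation "PH \<equiv> pullback_bundle (Obj M) \<tau> (Bundle \<GG>)"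
abbreviation "PG \<equiv> pullback_grpd (Obj M) \<tau> (Grpd \<GG>)"

lemma sideD:
  "continuous_map (Obj M) (Obj (Grpd \<GG>)) \<tau>"
  "strict_morphism PH M (\<lambda>z. z) \<alpha>1" "strict_morphism M PG (\<lambda>z. z) \<alpha>2"
  "\<And>p. p \<in> arr PH \<Longrightarrow> \<alpha>2 (\<alpha>1 p) = (fst p, bdry \<GG> (snd p), fst p)"
  "embedding_map (Arr PH) (Arr M) \<alpha>1" "\<alpha>2 ` arr M = arr PG" "\<alpha>1 ` arr PH = K"
  "\<And>m p. m \<in> arr M \<Longrightarrow> p \<in> fibre PH (tgt M m) \<Longrightarrow>
     \<alpha>1 ((\<lambda>(_, h) (_, g, z2). (z2, act \<GG> h g)) p (\<alpha>2 m)) = mult M (mult M (inve M m) (\<alpha>1 p)) m"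
  using side unfolding groupoid_side_def Let_def pullback_xmod_simps by (simp_all add: case_prod_unfold)

definition p :: "'m \<Rightarrow> 'g" where "p m = fst (snd (\<alpha>2 m))"

lemma arr_PH: "(z, h) \<in> arr PH \<longleftrightarrow> z \<in> obj M \<and> h \<in> arr (Bundle \<GG>) \<and> src (Bundle \<GG>) h = \<tau> z"
  by (simp add: arr_pullback_bundle fibre_iff)

lemma \<tau>_obj [simp]: "z \<in> obj M \<Longrightarrow> \<tau> z \<in> obj (Grpd \<GG>)"
  by (rule continuous_map_point[OF sideD(1)])

lemma \<alpha>2_eq: "m \<in> arr M \<Longrightarrow> \<alpha>2 m = (tgt M m, p m, src M m)"
  using strict_morphismD(3,4)[OF sideD(3), of m] by (cases "\<alpha>2 m") (simp add: p_def pullback_grpd_simps)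

lemma p_arr [simp]:
  assumes "m \<in> arr M"
  shows "p m \<in> arr (Grpd \<GG>)" "src (Grpd \<GG>) (p m) = \<tau> (src M m)" "tgt (Grpd \<GG>) (p m) = \<tau> (tgt M m)"
  using strict_morphismD(7)[OF sideD(3) assms] unfolding \<alpha>2_eq[OF assms] by (simp_all add: arr_pullback_grpd)

lemma p_mult: "m \<in> arr M \<Longrightarrow> n \<in> arr M \<Longrightarrow> src M m = tgt M n \<Longrightarrow> p (mult M m n) = mult (Grpd \<GG>) (p m) (p n)"
  using strict_morphismD(6)[OF sideD(3), of m n] by (simp add: \<alpha>2_eq pullback_grpd_simps)

lemma p_idn: "z \<in> obj M \<Longrightarrow> p (idn M z) = idn (Grpd \<GG>) (\<tau> z)"
  using strict_morphismD(5)[OF sideD(3), of z] by (simp add: \<alpha>2_eq pullback_grpd_simps)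

lemma p_inve:
  assumes "m \<in> arr M"
  shows "p (inve M m) = inve (Grpd \<GG>) (p m)"
  by (rule G.inve_unique) (use assms p_mult[of "inve M m" m] in \<open>simp_all add: p_idn\<close>)

lemma continuous_p: "continuous_map (Arr M) (Arr (Grpd \<GG>)) p"
proof -
  have "continuous_map (Arr M) (prod_topology (Obj M) (prod_topology (Arr (Grpd \<GG>)) (Obj M))) \<alpha>2"
    using strict_morphismD(2)[OF sideD(3)] unfolding pullback_grpd_simps continuous_map_in_subtopology by blast
  then show ?thesis unfolding p_def[abs_def] by (intro continuous_map_fst_apply continuous_map_snd_apply)
qed

lemma unit_iff: "m \<in> arr M \<Longrightarrow>
    \<alpha>2 m \<in> units PG \<longleftrightarrow> src M m = tgt M m \<and> p m = idn (Grpd \<GG>) (\<tau> (src M m))"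
  unfolding units_def by (auto simp: \<alpha>2_eq pullback_grpd_simps)

lemma \<alpha>1_arr:
  assumes "z \<in> obj M" "h \<in> arr (Bundle \<GG>)" "src (Bundle \<GG>) h = \<tau> z"
  shows "\<alpha>1 (z, h) \<in> arr M" "src M (\<alpha>1 (z, h)) = z" "tgt M (\<alpha>1 (z, h)) = z"
    "p (\<alpha>1 (z, h)) = bdry \<GG> h" "\<alpha>1 (z, h) \<in> K"
proof -
  have a: "(z, h) \<in> arr PH" using assms by (simp add: arr_PH)
  show "\<alpha>1 (z, h) \<in> arr M" "src M (\<alpha>1 (z, h)) = z" "tgt M (\<alpha>1 (z, h)) = z"
    using strict_morphismD(3,4,7)[OF sideD(2) a] by (simp_all add: pullback_bundle_simps(1,3-6))
  show "p (\<alpha>1 (z, h)) = bdry \<GG> h" using sideD(4)[OF a] by (simp add: p_def)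
  show "\<alpha>1 (z, h) \<in> K" using sideD(7) a by blast
qed

lemma \<alpha>1_mult:
  assumes "z \<in> obj M" "h \<in> arr (Bundle \<GG>)" "src (Bundle \<GG>) h = \<tau> z" "k \<in> arr (Bundle \<GG>)" "src (Bundle \<GG>) k = \<tau> z"
  shows "\<alpha>1 (z, mult (Bundle \<GG>) h k) = mult M (\<alpha>1 (z, h)) (\<alpha>1 (z, k))"
  using strict_morphismD(6)[OF sideD(2), of "(z, h)" "(z, k)"] assms
  by (simp add: arr_PH pullback_bundle_simps(1,3-6))

lemma \<alpha>1_idn: "z \<in> obj M \<Longrightarrow> \<alpha>1 (z, idn (Bundle \<GG>) (\<tau> z)) = idn M z"
  using strict_morphismD(5)[OF sideD(2), of z] by (simp add: pullback_bundle_simps(1,3-6))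

lemma \<alpha>1_act:
  assumes "m \<in> arr M" "h \<in> arr (Bundle \<GG>)" "src (Bundle \<GG>) h = \<tau> (tgt M m)"
  shows "\<alpha>1 (src M m, act \<GG> h (p m)) = mult M (inve M m) (mult M (\<alpha>1 (tgt M m, h)) m)"
proof -
  have "(tgt M m, h) \<in> fibre PH (tgt M m)"
    using assms by (simp add: fibre_def[of PH] arr_PH pullback_bundle_simps(3))
  from sideD(8)[OF assms(1) this] show ?thesis
    using assms \<alpha>1_arr[of "tgt M m" h] by (simp add: \<alpha>2_eq M.mult_assoc_arr)
qed

definition \<kappa> :: "'m \<Rightarrow> 'h" where "\<kappa> x = snd (inv_into (arr PH) \<alpha>1 x)"

lemma \<kappa>_\<alpha>1: "z \<in> obj M \<Longrightarrow> h \<in> arr (Bundle \<GG>) \<Longrightarrow> src (Bundle \<GG>) h = \<tau> z \<Longrightarrow> \<kappa> (\<alpha>1 (z, h)) = h"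
  using embedding_map_inverse(2)[OF sideD(5)] by (simp add: \<kappa>_def arr_PH)

lemma \<kappa>:
  assumes "x \<in> K"
  shows "x \<in> arr M" "tgt M x = src M x" "\<kappa> x \<in> arr (Bundle \<GG>)" "src (Bundle \<GG>) (\<kappa> x) = \<tau> (src M x)"
    "\<alpha>1 (src M x, \<kappa> x) = x"
proof -
  have "x \<in> \<alpha>1 ` arr PH" using assms sideD(7) by simp
  then obtain q where q: "q \<in> arr PH" "x = \<alpha>1 q" by (elim imageE)
  obtain z h where zh: "q = (z, h)" by (rule prod.exhaust)
  have a: "z \<in> obj M" "h \<in> arr (Bundle \<GG>)" "src (Bundle \<GG>) h = \<tau> z" using q zh by (simp_all add: arr_PH)
  show "x \<in> arr M" "tgt M x = src M x" "\<kappa> x \<in> arr (Bundle \<GG>)" "src (Bundle \<GG>) (\<kappa> x) = \<tau> (src M x)"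
    "\<alpha>1 (src M x, \<kappa> x) = x"
    using q zh a by (simp_all add: \<alpha>1_arr \<kappa>_\<alpha>1)
qed

lemma continuous_\<kappa>: "continuous_map (subtopology (Arr M) K) (Arr (Bundle \<GG>)) \<kappa>"
proof -
  have "continuous_map (subtopology (Arr M) K) (Arr PH) (inv_into (arr PH) \<alpha>1)"
    using embedding_map_inverse(3)[OF sideD(5)] by (simp add: sideD(7))
  then show ?thesis
    unfolding \<kappa>_def[abs_def] continuous_map_into_pullback_bundle by blast
qed

lemma \<kappa>_mult:
  assumes "x \<in> K" "y \<in> K" "src M x = src M y"
  shows "\<kappa> (mult M x y) = mult (Bundle \<GG>) (\<kappa> x) (\<kappa> y)"
proof -
  note x = \<kappa>[OF assms(1), unfolded assms(3)] and y = \<kappa>[OF assms(2)]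
  show ?thesis
    using \<alpha>1_mult[of "src M y" "\<kappa> x" "\<kappa> y"] \<kappa>_\<alpha>1[of "src M y" "mult (Bundle \<GG>) (\<kappa> x) (\<kappa> y)"] x y
    by simp
qed

lemma \<kappa>_idn: "z \<in> obj M \<Longrightarrow> \<kappa> (idn M z) = idn (Bundle \<GG>) (\<tau> z)"
  using \<alpha>1_idn[of z] \<kappa>_\<alpha>1[of z "idn (Bundle \<GG>) (\<tau> z)"] H.idn_closed[of "\<tau> z"] H.src_idn[of "\<tau> z"] by simp

lemma \<kappa>_conj:
  assumes "x \<in> K" "m \<in> arr M" "src M x = tgt M m"
  shows "\<kappa> (mult M (inve M m) (mult M x m)) = act \<GG> (\<kappa> x) (p m)"
proof -
  have "\<alpha>1 (src M m, act \<GG> (\<kappa> x) (p m)) = mult M (inve M m) (mult M x m)"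
    using \<alpha>1_act[of m "\<kappa> x"] \<kappa>[OF assms(1)] assms by simp
  then show ?thesis
    using \<kappa>_\<alpha>1[of "src M m" "act \<GG> (\<kappa> x) (p m)"] \<kappa>[OF assms(1)] assms by simp
qed

lemma lift_arrow:
  assumes "z1 \<in> obj M" "z2 \<in> obj M" "g \<in> arr (Grpd \<GG>)" "tgt (Grpd \<GG>) g = \<tau> z1" "src (Grpd \<GG>) g = \<tau> z2"
  shows "\<exists>m\<in>arr M. tgt M m = z1 \<and> src M m = z2 \<and> p m = g"
proof -
  have "(z1, g, z2) \<in> \<alpha>2 ` arr M" using assms by (simp add: sideD(6) arr_pullback_grpd)
  then obtain m where "m \<in> arr M" "(z1, g, z2) = \<alpha>2 m" by (elim imageE)
  then show ?thesis by (auto simp: \<alpha>2_eq)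
qed

text \<open>The projection \<open>\<alpha>2\<close> is onto the whole pullback, so an arrow of \<open>\<GG>\<close> between images of two
  objects lifts to an arrow between these objects.\<close>

lemma connected_by_\<tau>: 
  assumes "z1 \<in> obj M" "z2 \<in> obj M"
  shows "connected_by (Grpd \<GG>) (\<tau> z1) (\<tau> z2) \<longleftrightarrow> connected_by M z1 z2"
proof
  assume "connected_by M z1 z2"
  then obtain m where "m \<in> arr M" "src M m = z1" "tgt M m = z2" unfolding connected_by_def by blast
  then show "connected_by (Grpd \<GG>) (\<tau> z1) (\<tau> z2)"
    unfolding connected_by_def by (intro bexI[of _ "p m"]) simp_all
next
  assume "connected_by (Grpd \<GG>) (\<tau> z1) (\<tau> z2)"
  then obtain g where "g \<in> arr (Grpd \<GG>)" "src (Grpd \<GG>) g = \<tau> z1" "tgt (Grpd \<GG>) g = \<tau> z2"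
    unfolding connected_by_def by blast
  then show "connected_by M z1 z2"
    using lift_arrow[OF assms(2,1)] unfolding connected_by_def by blast
qed

text \<open>The crossed module \<open>\<MM>\<close> consists of pairs of arrows in the two kernels; \<open>a\<close> and \<open>b\<close> are the
  components of a pair and \<open>j\<close> is the pairing. Naming the operations like this lets both
  projections of the crossed module of pairs be instances of the lemma, with the components
  exchanged in one of them.

  The point is the pullback condition. Let \<open>h\<close> define a 2-arrow from \<open>p(m)\<close> to \<open>p(m')\<close>. The arrows
  \<open>m\<close> and \<open>m'\<close> have the same ends, since \<open>\<tau>\<close> is injective on \<open>W\<close>. A 2-arrow from \<open>m\<close> to \<open>m'\<close> over
  \<open>h\<close> is a pair \<open>(x, y)\<close> with \<open>x y m = m'\<close> whose first component is the copy of \<open>h\<close> in \<open>K\<close>. This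
  leaves exactly one possibility for \<open>y\<close>, which lies in the kernel of the projection because
  \<open>p(m') = \<partial>h p(m)\<close> and depends continuously on \<open>h\<close>, \<open>m\<close> and \<open>m'\<close>.\<close>

lemma hypercover_of_half:
  fixes \<MM> :: "('z, 'm, 'u) xmod" and a b :: "'u \<Rightarrow> 'm" and j :: "'m \<Rightarrow> 'm \<Rightarrow> 'u"
  assumes W: "W \<subseteq> obj M" and inj: "inj_on \<tau> W"
    and ess: "\<And>x. x \<in> obj (Grpd \<GG>) \<Longrightarrow> \<exists>z\<in>W. connected_by (Grpd \<GG>) x (\<tau> z)"
    and X: "crossed_module \<MM>" and base: "Grpd \<MM> = full_subgroupoid M W"
    and ab: "\<And>u. u \<in> arr (Bundle \<MM>) \<Longrightarrow> a u \<in> K \<and> b u \<in> unit_kernel M \<tau> \<GG> \<alpha>2 \<and>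
      src M (a u) = src (Bundle \<MM>) u \<and> src M (b u) = src (Bundle \<MM>) u \<and> bdry \<MM> u = mult M (a u) (b u)"
    and cont: "continuous_map (Arr (Bundle \<MM>)) (Arr M) a"
    and a_idn: "\<And>z. z \<in> W \<Longrightarrow> a (idn (Bundle \<MM>) z) = idn M z"
    and a_mult: "\<And>u v. u \<in> arr (Bundle \<MM>) \<Longrightarrow> v \<in> arr (Bundle \<MM>) \<Longrightarrow> src (Bundle \<MM>) u = src (Bundle \<MM>) v \<Longrightarrow>
      a (mult (Bundle \<MM>) u v) = mult M (a u) (a v)"
    and a_act: "\<And>u m. u \<in> arr (Bundle \<MM>) \<Longrightarrow> m \<in> arr (full_subgroupoid M W) \<Longrightarrow> src (Bundle \<MM>) u = tgt M m \<Longrightarrow>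
      a (act \<MM> u m) = mult M (inve M m) (mult M (a u) m)"
    and j: "\<And>x y. x \<in> K \<Longrightarrow> y \<in> unit_kernel M \<tau> \<GG> \<alpha>2 \<Longrightarrow> src M x = src M y \<Longrightarrow> src M x \<in> W \<Longrightarrow>
      j x y \<in> arr (Bundle \<MM>) \<and> a (j x y) = x \<and> b (j x y) = y"
    and j_ab: "\<And>u. u \<in> arr (Bundle \<MM>) \<Longrightarrow> j (a u) (b u) = u"
    and continuous_j: "continuous_map (subtopology (prod_topology (Arr M) (Arr M))
        {(x, y). x \<in> K \<and> y \<in> unit_kernel M \<tau> \<GG> \<alpha>2 \<and> src M x = src M y \<and> src M x \<in> W})
        (Arr (Bundle \<MM>)) (\<lambda>(x, y). j x y)"
  shows "hypercover \<MM> \<GG> \<tau> p (\<lambda>u. \<kappa> (a u))"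
proof -
  interpret X: crossed_module \<MM> by (rule X)
  let ?N = "full_subgroupoid M W"
  note N = full_subgroupoid_simps[of M W]
  have objN: "obj ?N = W" using W by (auto simp: N)
  have Nm: "m \<in> arr M" "src M m \<in> W" "tgt M m \<in> W" if "m \<in> arr ?N" for m using that by (simp_all add: N)
  have objX: "Obj (Bundle \<MM>) = subtopology (Obj M) W" using X.obj_Bundle by (simp add: base N)
  have srcX: "src (Bundle \<MM>) u \<in> W" if "u \<in> arr (Bundle \<MM>)" for u
    using X.src_obj[OF that] by (simp add: base objN)
  have ker: "y \<in> unit_kernel M \<tau> \<GG> \<alpha>2 \<longleftrightarrow> y \<in> arr M \<and> tgt M y = src M y \<and> p y = idn (Grpd \<GG>) (\<tau> (src M y))" for y
    unfolding unit_kernel_def using unit_iff[of y] by auto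
  have abD: "a u \<in> K" "a u \<in> arr M" "src M (a u) = src (Bundle \<MM>) u" "tgt M (a u) = src (Bundle \<MM>) u"
      "b u \<in> unit_kernel M \<tau> \<GG> \<alpha>2" "b u \<in> arr M" "src M (b u) = src (Bundle \<MM>) u" "tgt M (b u) = src (Bundle \<MM>) u"
      "p (b u) = idn (Grpd \<GG>) (\<tau> (src (Bundle \<MM>) u))" "bdry \<MM> u = mult M (a u) (b u)"
    if "u \<in> arr (Bundle \<MM>)" for u
    using ab[OF that] \<kappa>(1,2)[of "a u"] by (simp_all add: ker)
  have mG: "strict_morphism ?N (Grpd \<GG>) \<tau> p"
    unfolding strict_morphism_def
  proof (intro conjI ballI)
    show "continuous_map (Obj ?N) (Obj (Grpd \<GG>)) \<tau>" "continuous_map (Arr ?N) (Arr (Grpd \<GG>)) p"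
      unfolding N by (intro continuous_map_from_subtopology sideD(1) continuous_p)+
    show "p (idn ?N x) = idn (Grpd \<GG>) (\<tau> x)" if "x \<in> obj ?N" for x
      using that W by (auto simp: objN N p_idn)
  qed (auto simp: N composable_def p_mult)
  have cont_\<kappa>: "continuous_map (Arr (Bundle \<MM>)) (Arr (Bundle \<GG>)) (\<lambda>u. \<kappa> (a u))"
    by (rule continuous_map_apply[OF continuous_\<kappa>])
      (use cont abD in \<open>auto simp: continuous_map_in_subtopology\<close>)
  have mH: "strict_morphism (Bundle \<MM>) (Bundle \<GG>) \<tau> (\<lambda>u. \<kappa> (a u))"
    unfolding strict_morphism_def
  proof (intro conjI ballI cont_\<kappa>)
    show "continuous_map (Obj (Bundle \<MM>)) (Obj (Bundle \<GG>)) \<tau>"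
      using sideD(1) by (simp add: base N continuous_map_from_subtopology)
    show "src (Bundle \<GG>) (\<kappa> (a u)) = \<tau> (src (Bundle \<MM>) u)" "tgt (Bundle \<GG>) (\<kappa> (a u)) = \<tau> (tgt (Bundle \<MM>) u)"
      if "u \<in> arr (Bundle \<MM>)" for u using that abD[OF that] \<kappa>[of "a u"] by simp_all
    show "\<kappa> (a (idn (Bundle \<MM>) z)) = idn (Bundle \<GG>) (\<tau> z)" if "z \<in> obj (Bundle \<MM>)" for z
      using that W \<kappa>_idn[of z] a_idn[of z] by (auto simp: base N)
    show "case q of (u, v) \<Rightarrow> \<kappa> (a (mult (Bundle \<MM>) u v)) = mult (Bundle \<GG>) (\<kappa> (a u)) (\<kappa> (a v))"
      if "q \<in> composable (Bundle \<MM>)" for q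
      using that abD a_mult \<kappa>_mult by (auto simp: composable_def)
  qed
  have \<kappa>_bdry: "p (bdry \<MM> u) = bdry \<GG> (\<kappa> (a u))" if "u \<in> arr (Bundle \<MM>)" for u
  proof -
    have z: "src (Bundle \<MM>) u \<in> obj M" using srcX[OF that] W by blast
    have "p (a u) = bdry \<GG> (\<kappa> (a u))"
      using \<alpha>1_arr(4)[of "src M (a u)" "\<kappa> (a u)"] \<kappa>[of "a u"] abD[OF that] z by simp
    then show ?thesis using abD[OF that] \<kappa>(3,4)[of "a u"] by (simp add: p_mult)
  qed
  have morph: "strict_xmod_morphism \<MM> \<GG> \<tau> p (\<lambda>u. \<kappa> (a u))"
    unfolding strict_xmod_morphism_def base
  proof (intro conjI ballI mG mH)
    show "p (bdry \<MM> u) = bdry \<GG> (\<kappa> (a u))" if "u \<in> arr (Bundle \<MM>)" for u by (rule \<kappa>_bdry[OF that])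
    show "\<kappa> (a (act \<MM> u m)) = act \<GG> (\<kappa> (a u)) (p m)"
      if m: "m \<in> arr ?N" and u: "u \<in> fibre (Bundle \<MM>) (tgt ?N m)" for m u
    proof -
      have u: "u \<in> arr (Bundle \<MM>)" "src (Bundle \<MM>) u = tgt M m" using u by (simp_all add: X.fibre_iff N)
      show ?thesis using a_act[OF u(1) m u(2)] \<kappa>_conj[of "a u" m] abD[OF u(1)] u Nm[OF m] by simp
    qed
  qed
  have essential: "essentially_surjective (Obj (Grpd \<MM>)) \<tau> (Grpd \<GG>)"
    unfolding G.essentially_surjective_iff base objN using ess by blast
  have full: "fullness \<MM> \<GG> \<tau> p"
    unfolding fullness_def base objN
  proof (intro ballI impI)
    fix z1 z2 g assume z: "z1 \<in> W" "z2 \<in> W" and g: "g \<in> arr (Grpd \<GG>)"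
      "tgt (Grpd \<GG>) g = \<tau> z1 \<and> src (Grpd \<GG>) g = \<tau> z2"
    then obtain m where m: "m \<in> arr M" "tgt M m = z1" "src M m = z2" "p m = g"
      using lift_arrow[of z1 z2 g] W by blast
    have i: "idn (Bundle \<GG>) (tgt (Grpd \<GG>) g) \<in> fibre (Bundle \<GG>) (tgt (Grpd \<GG>) g)"
      using g(1) H.idn_closed[of "tgt (Grpd \<GG>) g"] H.src_idn[of "tgt (Grpd \<GG>) g"]
      by (simp add: fibre_iff)
    have "p m = mult (Grpd \<GG>) (bdry \<GG> (idn (Bundle \<GG>) (tgt (Grpd \<GG>) g))) g" using m g(1) by simp
    moreover have "m \<in> arr ?N" "tgt ?N m = z1" "src ?N m = z2" using m z by (simp_all add: N)
    ultimately show "\<exists>f\<in>arr ?N. \<exists>h\<in>fibre (Bundle \<GG>) (tgt (Grpd \<GG>) g). tgt ?N f = z1 \<and> src ?N f = z2 \<and>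
        p f = mult (Grpd \<GG>) (bdry \<GG> h) g"
      using i by blast
  qed
  define Y where "Y = subtopology (prod_topology (arrows2 \<GG>) (prod_topology (Arr ?N) (Arr ?N)))
      {(b, m, m'). snd b = p m \<and> target2 \<GG> b = p m'}"
  define F where "F v = (map_prod (\<lambda>u. \<kappa> (a u)) p v, snd v, target2 \<MM> v)" for v
  \<comment> \<open>A point of the fibre product has the form \<open>q = ((h, g), m, m')\<close>, and \<open>(x q, y q)\<close> is the 2-arrow
    from \<open>m\<close> to \<open>m'\<close> lying over \<open>h\<close>.\<close>
  define x where "x q = \<alpha>1 (tgt M (fst (snd q)), fst (fst q))" for q :: "('h \<times> 'g) \<times> 'm \<times> 'm"
  define y where "y q = mult M (inve M (x q)) (mult M (snd (snd q)) (inve M (fst (snd q))))"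
    for q :: "('h \<times> 'g) \<times> 'm \<times> 'm"
  have YD: "fst q \<in> topspace (arrows2 \<GG>)" "fst (snd q) \<in> arr ?N" "snd (snd q) \<in> arr ?N"
      "snd (fst q) = p (fst (snd q))" "target2 \<GG> (fst q) = p (snd (snd q))" if "q \<in> topspace Y" for q
    using that by (auto simp: Y_def)
  have Yarr: "fst (fst q) \<in> arr (Bundle \<GG>)" "src (Bundle \<GG>) (fst (fst q)) = \<tau> (tgt M (fst (snd q)))"
      "fst (snd q) \<in> arr M" "snd (snd q) \<in> arr M" "tgt M (fst (snd q)) \<in> W" "src M (fst (snd q)) \<in> W"
      "tgt M (snd (snd q)) = tgt M (fst (snd q))" "src M (snd (snd q)) = src M (fst (snd q))"
      "p (snd (snd q)) = mult (Grpd \<GG>) (bdry \<GG> (fst (fst q))) (p (fst (snd q)))" if "q \<in> topspace Y" for q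
  proof -
    note q = YD[OF that]
    note m = Nm[OF q(2)] and m' = Nm[OF q(3)]
    have b: "fst (fst q) \<in> arr (Bundle \<GG>)" "src (Bundle \<GG>) (fst (fst q)) = tgt (Grpd \<GG>) (snd (fst q))"
      using q(1) by (simp_all add: arrows2_iff)
    show "fst (fst q) \<in> arr (Bundle \<GG>)" "src (Bundle \<GG>) (fst (fst q)) = \<tau> (tgt M (fst (snd q)))"
      "fst (snd q) \<in> arr M" "snd (snd q) \<in> arr M" "tgt M (fst (snd q)) \<in> W" "src M (fst (snd q)) \<in> W"
      using b m m' q(4) by simp_all
    show "p (snd (snd q)) = mult (Grpd \<GG>) (bdry \<GG> (fst (fst q))) (p (fst (snd q)))"
      using q(4,5) by (simp add: target2_def)
    have "tgt (Grpd \<GG>) (p (snd (snd q))) = tgt (Grpd \<GG>) (p (fst (snd q)))"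
      "src (Grpd \<GG>) (p (snd (snd q))) = src (Grpd \<GG>) (p (fst (snd q)))"
      using target2_simps(2,3)[OF q(1)] q(4,5) by simp_all
    then have "\<tau> (tgt M (snd (snd q))) = \<tau> (tgt M (fst (snd q)))" "\<tau> (src M (snd (snd q))) = \<tau> (src M (fst (snd q)))"
      using m m' by simp_all
    then show "tgt M (snd (snd q)) = tgt M (fst (snd q))" "src M (snd (snd q)) = src M (fst (snd q))"
      using inj_onD[OF inj] m m' by blast+
  qed
  have xD: "x q \<in> arr M" "src M (x q) = tgt M (fst (snd q))" "tgt M (x q) = tgt M (fst (snd q))"
      "p (x q) = bdry \<GG> (fst (fst q))" "x q \<in> K" "\<kappa> (x q) = fst (fst q)" if "q \<in> topspace Y" for q
    using Yarr[OF that] W \<alpha>1_arr[of "tgt M (fst (snd q))" "fst (fst q)"] \<kappa>_\<alpha>1[of "tgt M (fst (snd q))" "fst (fst q)"]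
    by (auto simp: x_def)
  have yD: "y q \<in> unit_kernel M \<tau> \<GG> \<alpha>2" "src M (y q) = tgt M (fst (snd q))"
      "mult M (mult M (x q) (y q)) (fst (snd q)) = snd (snd q)" if "q \<in> topspace Y" for q
  proof -
    note q = Yarr[OF that] xD[OF that]
    have "p (y q) = mult (Grpd \<GG>) (inve (Grpd \<GG>) (bdry \<GG> (fst (fst q))))
        (mult (Grpd \<GG>) (mult (Grpd \<GG>) (bdry \<GG> (fst (fst q))) (p (fst (snd q)))) (inve (Grpd \<GG>) (p (fst (snd q)))))"
      using q by (simp add: y_def p_mult p_inve)
    also have "\<dots> = idn (Grpd \<GG>) (\<tau> (tgt M (fst (snd q))))"
      using q by (simp add: G.mult_assoc_arr)
    finally show "y q \<in> unit_kernel M \<tau> \<GG> \<alpha>2" unfolding ker using q by (simp add: y_def)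
    show "src M (y q) = tgt M (fst (snd q))" using q by (simp add: y_def)
    show "mult M (mult M (x q) (y q)) (fst (snd q)) = snd (snd q)"
      using q by (simp add: y_def M.mult_assoc_arr)
  qed
  have jD: "j (x q) (y q) \<in> arr (Bundle \<MM>)" "a (j (x q) (y q)) = x q" "b (j (x q) (y q)) = y q"
      "src (Bundle \<MM>) (j (x q) (y q)) = tgt M (fst (snd q))" if "q \<in> topspace Y" for q
  proof -
    show 1: "j (x q) (y q) \<in> arr (Bundle \<MM>)" "a (j (x q) (y q)) = x q" "b (j (x q) (y q)) = y q"
      using j[of "x q" "y q"] xD[OF that] yD[OF that] Yarr(5)[OF that] by simp_all
    show "src (Bundle \<MM>) (j (x q) (y q)) = tgt M (fst (snd q))"
      using abD(3)[OF 1(1)] 1(2) xD(2)[OF that] by simp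
  qed
  have "homeomorphic_map (arrows2 \<MM>) Y F"
  proof (rule homeomorphic_map_witness[where g = "\<lambda>q. (j (x q) (y q), fst (snd q))"])
    have v: "fst v \<in> arr (Bundle \<MM>)" "snd v \<in> arr ?N" "src (Bundle \<MM>) (fst v) = tgt M (snd v)"
      if "v \<in> topspace (arrows2 \<MM>)" for v
      using that by (simp_all add: X.arrows2_iff base N)
    have tgt2: "target2 \<MM> v = mult M (mult M (a (fst v)) (b (fst v))) (snd v)" if "v \<in> topspace (arrows2 \<MM>)" for v
      using abD(10)[OF v(1)[OF that]] by (simp add: target2_def base N)
    have FY: "F v \<in> topspace Y" if "v \<in> topspace (arrows2 \<MM>)" for v
    proof -
      note w = v[OF that] and n = Nm[OF v(2)[OF that]] and c = abD[OF v(1)[OF that]]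
      have "map_prod (\<lambda>u. \<kappa> (a u)) p v \<in> topspace (arrows2 \<GG>)"
        using w n c \<kappa>[of "a (fst v)"] by (simp add: arrows2_iff fst_map_prod snd_map_prod)
      moreover have "target2 \<MM> v \<in> arr ?N" using X.target2_simps(1)[OF that] by (simp add: base)
      moreover have "target2 \<GG> (map_prod (\<lambda>u. \<kappa> (a u)) p v) = p (target2 \<MM> v)"
        using w n c \<kappa>(3,4)[OF c(1)] \<kappa>_bdry[OF w(1)] by (simp add: target2_def fst_map_prod snd_map_prod base N p_mult)
      ultimately show ?thesis using w(2) by (simp add: F_def Y_def snd_map_prod)
    qed
    have cN: "continuous_map (arrows2 \<MM>) (Arr ?N) snd" using X.continuous_snd_arrows2 by (simp add: base)
    then have cM: "continuous_map (arrows2 \<MM>) (Arr M) snd" by (simp add: N continuous_map_in_subtopology)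
    have "continuous_map (arrows2 \<MM>) (arrows2 \<GG>) (map_prod (\<lambda>u. \<kappa> (a u)) p)"
      unfolding continuous_map_into_arrows2 fst_map_prod snd_map_prod
    proof (intro conjI ballI)
      show "continuous_map (arrows2 \<MM>) (Arr (Bundle \<GG>)) (\<lambda>v. \<kappa> (a (fst v)))"
        by (rule continuous_map_apply[OF cont_\<kappa> X.continuous_fst_arrows2])
      show "continuous_map (arrows2 \<MM>) (Arr (Grpd \<GG>)) (\<lambda>v. p (snd v))"
        by (rule continuous_map_apply[OF continuous_p cM])
      show "\<kappa> (a (fst w)) \<in> fibre (Bundle \<GG>) (tgt (Grpd \<GG>) (p (snd w)))" if "w \<in> topspace (arrows2 \<MM>)" for w
        using FY[OF that] YD(1) by (fastforce simp: F_def arrows2_iff fibre_iff fst_map_prod snd_map_prod)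
    qed
    moreover have "continuous_map (arrows2 \<MM>) (Arr ?N) (target2 \<MM>)" using X.continuous_target2 by (simp add: base)
    ultimately show "continuous_map (arrows2 \<MM>) Y F"
      unfolding Y_def continuous_map_in_subtopology F_def continuous_map_paired
      using cN FY by (auto simp: Y_def F_def)
    have c0: "continuous_map Y (arrows2 \<GG>) fst" "continuous_map Y (prod_topology (Arr ?N) (Arr ?N)) snd"
      unfolding Y_def by (rule continuous_map_subtopology_fst, rule continuous_map_subtopology_snd)
    have c1: "continuous_map Y (Arr ?N) (\<lambda>q. fst (snd q))" "continuous_map Y (Arr ?N) (\<lambda>q. snd (snd q))"
      by (rule continuous_map_fst_apply[OF c0(2)], rule continuous_map_snd_apply[OF c0(2)])
    then have c2: "continuous_map Y (Arr M) (\<lambda>q. fst (snd q))" "continuous_map Y (Arr M) (\<lambda>q. snd (snd q))"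
      by (simp_all add: N continuous_map_in_subtopology)
    have cx: "continuous_map Y (Arr M) x"
      unfolding x_def[abs_def]
    proof (rule continuous_map_apply[OF embedding_map_inverse(1)[OF sideD(5)]])
      show "continuous_map Y (Arr PH) (\<lambda>q. (tgt M (fst (snd q)), fst (fst q)))"
        unfolding continuous_map_into_pullback_bundle fst_conv snd_conv
        by (intro conjI ballI M.continuous_tgt_apply c2(1) continuous_map_apply[OF continuous_fst_arrows2 c0(1)])
          (simp add: fibre_iff Yarr)
    qed
    have cy: "continuous_map Y (Arr M) y"
      unfolding y_def[abs_def]
      by (intro M.continuous_gmult_apply M.continuous_inve_apply cx c2) (simp_all add: Yarr xD)
    have cj: "continuous_map Y (Arr (Bundle \<MM>)) (\<lambda>q. j (x q) (y q))"
      by (rule continuous_map_binop[OF continuous_j cx cy]) (simp add: xD yD Yarr)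
    show "continuous_map Y (arrows2 \<MM>) (\<lambda>q. (j (x q) (y q), fst (snd q)))"
      unfolding X.continuous_map_into_arrows2 fst_conv snd_conv base
      by (intro conjI ballI cj c1) (simp add: X.fibre_iff jD N)
    show "F (j (x q) (y q), fst (snd q)) = q" if "q \<in> topspace Y" for q
      using jD[OF that] xD[OF that] yD[OF that] YD(4)[OF that] abD(10)[OF jD(1)[OF that]]
      by (simp add: F_def target2_def base N prod_eq_iff)
    show "(j (x (F v)) (y (F v)), fst (snd (F v))) = v" if "v \<in> topspace (arrows2 \<MM>)" for v
    proof -
      note w = v[OF that] and n = Nm[OF v(2)[OF that]] and c = abD[OF v(1)[OF that]]
      have "x (F v) = a (fst v)"
        using \<kappa>(5)[OF c(1)] c w by (simp add: x_def F_def fst_map_prod)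
      moreover from this have "y (F v) = b (fst v)"
        using c w n tgt2[OF that] by (simp add: y_def F_def M.mult_assoc_arr)
      ultimately show ?thesis using j_ab[OF w(1)] by (simp add: F_def)
    qed
  qed
  then have faithful: "faithfulness \<MM> \<GG> p (\<lambda>u. \<kappa> (a u))"
    unfolding faithfulness_def base Y_def F_def[abs_def] .
  show ?thesis
    by (rule hypercoverI[OF X crossed_module_axioms morph essential full faithful])
qed

end

locale two_halves = L: extension_half \<GG>1 M \<tau> K1 \<alpha>1 \<alpha>2 + R: extension_half \<GG>2 M \<sigma> K2 \<beta>1 \<beta>2
  for \<GG>1 :: "('x, 'g, 'h) xmod" and \<GG>2 :: "('y, 'k, 'l) xmod" and M :: "('z, 'm) tgrpd"
    and \<tau> \<sigma> K1 K2 \<alpha>1 \<alpha>2 \<beta>1 \<beta>2 +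
  assumes K1: "K1 = unit_kernel M \<sigma> \<GG>2 \<beta>2" and K2: "K2 = unit_kernel M \<tau> \<GG>1 \<alpha>2"
begin

lemma K1_iff: "x \<in> K1 \<longleftrightarrow> x \<in> arr M \<and> tgt M x = src M x \<and> R.p x = idn (Grpd \<GG>2) (\<sigma> (src M x))"
  unfolding K1 unit_kernel_def using R.unit_iff[of x] by auto

lemma K2_iff: "x \<in> K2 \<longleftrightarrow> x \<in> arr M \<and> tgt M x = src M x \<and> L.p x = idn (Grpd \<GG>1) (\<tau> (src M x))"
  unfolding K2 unit_kernel_def using L.unit_iff[of x] by auto

text \<open>Conjugation by \<open>y\<close> on the copy of the bundle of \<open>\<GG>1\<close> is the action of the image of \<open>y\<close>,
  which is a unit.\<close>

lemma kernels_commute: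
  assumes x: "x \<in> K1" and y: "y \<in> K2" and src: "src M x = src M y"
  shows "mult M x y = mult M y x"
proof -
  have k: "L.\<kappa> x \<in> arr (Bundle \<GG>1)" "src (Bundle \<GG>1) (L.\<kappa> x) = \<tau> (src M y)" "\<alpha>1 (src M y, L.\<kappa> x) = x"
    using L.\<kappa>(3-5)[OF x] src by simp_all
  have y': "y \<in> arr M" "tgt M y = src M y" "L.p y = idn (Grpd \<GG>1) (\<tau> (src M y))" using y by (simp_all add: K2_iff)
  have x': "x \<in> arr M" "tgt M x = src M y" using L.\<kappa>(1,2)[OF x] src by simp_all
  have "x = mult M (inve M y) (mult M x y)"
    using L.\<alpha>1_act[of y "L.\<kappa> x"] k y' by simp
  then have "mult M y x = mult M y (mult M (inve M y) (mult M x y))" by simp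
  then show ?thesis using x' y' src by simp
qed

lemma commuting_pair_restricted:
  fixes e :: "'m \<times> 'm \<Rightarrow> 'u"
  assumes e: "inj e" and W: "W \<subseteq> obj M"
  shows "commuting_pair (full_subgroupoid M W) {x \<in> K1. src M x \<in> W} {x \<in> K2. src M x \<in> W} e"
proof (intro commuting_pair.intro commuting_pair_axioms.intro)
  show "topological_groupoid (full_subgroupoid M W)" by (rule L.M.topological_groupoid_full_subgroupoid)
  note N = full_subgroupoid_simps
  fix z assume z: "z \<in> obj (full_subgroupoid M W)"
  then have z: "z \<in> W" "z \<in> obj M" by (simp_all add: N)
  then show "idn (full_subgroupoid M W) z \<in> {x \<in> K1. src M x \<in> W}"
    "idn (full_subgroupoid M W) z \<in> {x \<in> K2. src M x \<in> W}"
    by (simp_all add: N K1_iff K2_iff L.p_idn R.p_idn)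
next
  fix x y assume "x \<in> {x \<in> K1. src M x \<in> W}" "y \<in> {x \<in> K2. src M x \<in> W}"
    "src (full_subgroupoid M W) x = src (full_subgroupoid M W) y"
  then show "mult (full_subgroupoid M W) x y = mult (full_subgroupoid M W) y x"
    using kernels_commute[of x y] by (simp add: full_subgroupoid_simps)
qed (auto simp: full_subgroupoid_simps K1_iff K2_iff L.p_mult R.p_mult L.p_inve R.p_inve e)

text \<open>With one object from each orbit of \<open>M\<close>, both \<open>\<tau>\<close> and \<open>\<sigma>\<close> are injective, as they reflect
  orbits, and they still meet every orbit.\<close>

lemma span_of_hypercovers:
  fixes e :: "'m \<times> 'm \<Rightarrow> 'u"
  assumes e: "inj e"
    and ess1: "essentially_surjective (Obj M) \<tau> (Grpd \<GG>1)"
    and ess2: "essentially_surjective (Obj M) \<sigma> (Grpd \<GG>2)"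
  shows "\<exists>\<MM> :: ('z, 'm, 'u) xmod. crossed_module \<MM> \<and>
    (\<exists>\<chi>0 \<chi>G \<chi>H. hypercover \<MM> \<GG>1 \<chi>0 \<chi>G \<chi>H) \<and> (\<exists>\<chi>0 \<chi>G \<chi>H. hypercover \<MM> \<GG>2 \<chi>0 \<chi>G \<chi>H)"
proof -
  obtain W where W: "W \<subseteq> obj M" and rep: "\<And>z. z \<in> obj M \<Longrightarrow> \<exists>w\<in>W. connected_by M z w"
    and sep: "\<And>w w'. w \<in> W \<Longrightarrow> w' \<in> W \<Longrightarrow> connected_by M w w' \<Longrightarrow> w = w'"
    by (rule L.M.orbit_representatives) blast
  have inj1: "inj_on \<tau> W"
  proof (rule inj_onI)
    fix w w' assume w: "w \<in> W" "w' \<in> W" "\<tau> w = \<tau> w'"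
    then have "connected_by (Grpd \<GG>1) (\<tau> w) (\<tau> w')"
      using W L.G.connected_by_refl[of "\<tau> w'"] by auto
    then show "w = w'" using L.connected_by_\<tau>[of w w'] w W sep by blast
  qed
  have inj2: "inj_on \<sigma> W"
  proof (rule inj_onI)
    fix w w' assume w: "w \<in> W" "w' \<in> W" "\<sigma> w = \<sigma> w'"
    then have "connected_by (Grpd \<GG>2) (\<sigma> w) (\<sigma> w')"
      using W R.G.connected_by_refl[of "\<sigma> w'"] by auto
    then show "w = w'" using R.connected_by_\<tau>[of w w'] w W sep by blast
  qed
  have cov1: "\<exists>w\<in>W. connected_by (Grpd \<GG>1) x (\<tau> w)" if x: "x \<in> obj (Grpd \<GG>1)" for x
  proof -
    obtain z where z: "z \<in> obj M" "connected_by (Grpd \<GG>1) x (\<tau> z)"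
      using ess1 x unfolding L.G.essentially_surjective_iff by blast
    then obtain w where w: "w \<in> W" "connected_by M z w" using rep by blast
    then have "connected_by (Grpd \<GG>1) (\<tau> z) (\<tau> w)"
      using L.connected_by_\<tau>[of z w] z W by blast
    then show ?thesis using w(1) z(2) L.G.connected_by_trans by blast
  qed
  have cov2: "\<exists>w\<in>W. connected_by (Grpd \<GG>2) x (\<sigma> w)" if x: "x \<in> obj (Grpd \<GG>2)" for x
  proof -
    obtain z where z: "z \<in> obj M" "connected_by (Grpd \<GG>2) x (\<sigma> z)"
      using ess2 x unfolding R.G.essentially_surjective_iff by blast
    then obtain w where w: "w \<in> W" "connected_by M z w" using rep by blast
    then have "connected_by (Grpd \<GG>2) (\<sigma> z) (\<sigma> w)"
      using R.connected_by_\<tau>[of z w] z W by blast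
    then show ?thesis using w(1) z(2) R.G.connected_by_trans by blast
  qed
  let ?N = "full_subgroupoid M W"
  note N = full_subgroupoid_simps[of M W]
  let ?A = "{x \<in> K1. src M x \<in> W}" and ?B = "{x \<in> K2. src M x \<in> W}"
  interpret C: commuting_pair ?N ?A ?B e by (rule commuting_pair_restricted[OF e W])
  note X = C.crossed_module_X
  have toM: "continuous_map Y (Arr M) f" if "continuous_map Y (Arr ?N) f" for Y :: "'u topology" and f
    using that by (simp add: N continuous_map_in_subtopology)
  have cont1: "continuous_map (Arr (Bundle C.X)) (Arr M) (\<lambda>u. fst (C.d u))"
    and cont2: "continuous_map (Arr (Bundle C.X)) (Arr M) (\<lambda>u. snd (C.d u))"
    unfolding C.X_simps
    by (rule toM[OF C.continuous_fst_d[OF continuous_map_ident]],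
        rule toM[OF C.continuous_snd_d[OF continuous_map_ident]])
  have into: "continuous_map Y (Arr C.H) (\<lambda>q. e (f q, g q))"
    if f: "continuous_map Y (Arr M) f" and g: "continuous_map Y (Arr M) g"
      and fg: "\<And>q. q \<in> topspace Y \<Longrightarrow> f q \<in> ?A \<and> g q \<in> ?B \<and> src M (f q) = src M (g q)"
    for Y :: "('m \<times> 'm) topology" and f g
  proof (rule C.continuous_map_into_H)
    show "continuous_map Y (Arr ?N) f" "continuous_map Y (Arr ?N) g"
      using f g fg unfolding N continuous_map_in_subtopology by (auto simp: K1_iff K2_iff)
  qed (use fg in \<open>simp add: N\<close>)
  have "hypercover C.X \<GG>1 \<tau> L.p (\<lambda>u. L.\<kappa> (fst (C.d u)))"
  proof (rule L.hypercover_of_half[where b = "\<lambda>u. snd (C.d u)" and j = "\<lambda>x y. e (x, y)", folded K2,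
        OF W inj1 cov1 X _ _ cont1])
    show "continuous_map (subtopology (prod_topology (Arr M) (Arr M))
        {(x, y). x \<in> K1 \<and> y \<in> K2 \<and> src M x = src M y \<and> src M x \<in> W})
        (Arr (Bundle C.X)) (\<lambda>(x, y). e (x, y))"
      unfolding C.X_simps case_prod_unfold
      by (rule into) (auto simp: continuous_map_subtopology_fst continuous_map_subtopology_snd)
  qed (auto simp: C.X_simps C.H_simps(1,3-7) C.d_arr C.conj_def C.e_arr_H N elim!: C.arr_HE)
  moreover have "hypercover C.X \<GG>2 \<sigma> R.p (\<lambda>u. R.\<kappa> (snd (C.d u)))"
  proof (rule R.hypercover_of_half[where b = "\<lambda>u. fst (C.d u)" and j = "\<lambda>x y. e (y, x)", folded K1,
        OF W inj2 cov2 X _ _ cont2])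
    show "continuous_map (subtopology (prod_topology (Arr M) (Arr M))
        {(x, y). x \<in> K2 \<and> y \<in> K1 \<and> src M x = src M y \<and> src M x \<in> W})
        (Arr (Bundle C.X)) (\<lambda>(x, y). e (y, x))"
      unfolding C.X_simps case_prod_unfold
      by (rule into) (auto simp: continuous_map_subtopology_fst continuous_map_subtopology_snd)
    show "snd (C.d u) \<in> K2 \<and> fst (C.d u) \<in> K1 \<and> src M (snd (C.d u)) = src (Bundle C.X) u \<and>
        src M (fst (C.d u)) = src (Bundle C.X) u \<and> bdry C.X u = mult M (snd (C.d u)) (fst (C.d u))"
      if "u \<in> arr (Bundle C.X)" for u
      using that kernels_commute by (auto simp: C.X_simps C.H_simps(1,3-7) C.d_arr N elim!: C.arr_HE)
  qed (auto simp: C.X_simps C.H_simps(1,3-7) C.d_arr C.conj_def C.e_arr_H N elim!: C.arr_HE)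
  ultimately show ?thesis using X by blast
qed

end

section \<open>Crossed extensions and Morita equivalence\<close>

lemma crossed_extension_imp_morita:
  fixes \<GG>1 \<GG>2 :: "('u, 'u, 'u) xmod" and M :: "('u, 'u) tgrpd" and e :: "'u \<times> 'u \<Rightarrow> 'u"
  assumes X1: "crossed_module \<GG>1" and X2: "crossed_module \<GG>2" and e: "inj e"
    and ext: "crossed_extension \<GG>1 \<GG>2 M \<tau> \<sigma> \<alpha>1 \<alpha>2 \<beta>1 \<beta>2"
    and ess1: "essentially_surjective (Obj M) \<tau> (Grpd \<GG>1)"
    and ess2: "essentially_surjective (Obj M) \<sigma> (Grpd \<GG>2)"
  shows "morita_equivalent \<GG>1 \<GG>2"
proof -
  note ext = ext[unfolded crossed_extension_iff]
  interpret two_halves \<GG>1 \<GG>2 M \<tau> \<sigma> "unit_kernel M \<sigma> \<GG>2 \<beta>2" "unit_kernel M \<tau> \<GG>1 \<alpha>2" \<alpha>1 \<alpha>2 \<beta>1 \<beta>2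
    by (intro two_halves.intro two_halves_axioms.intro extension_half.intro extension_half_axioms.intro X1 X2)
      (use ext in simp_all)
  obtain \<MM> :: "('u, 'u, 'u) xmod" where \<MM>: "crossed_module \<MM>"
    "\<exists>\<chi>0 \<chi>G \<chi>H. hypercover \<MM> \<GG>1 \<chi>0 \<chi>G \<chi>H" "\<exists>\<chi>0 \<chi>G \<chi>H. hypercover \<MM> \<GG>2 \<chi>0 \<chi>G \<chi>H"
    using span_of_hypercovers[OF e ess1 ess2] by blast
  show ?thesis
    unfolding morita_equivalent_def
    by (rule exI[of _ "[\<GG>1, \<MM>, \<GG>2]"]) (use X1 X2 \<MM> in \<open>auto simp: less_Suc_eq\<close>)
qed

(* The infinite type 'u is a universe: all spaces, including those asserted to exist, have
   subsets of 'u as carriers. Without the conjuncts essentially_surjective, the empty groupoid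
   would be a crossed extension of any two crossed modules. *)
theorem theorem4p23:
  fixes \<GG>1 \<GG>2 :: "('u, 'u, 'u) xmod"
  assumes "infinite (UNIV :: 'u set)"
    and "crossed_module \<GG>1" and "crossed_module \<GG>2"
  shows "(\<exists>(M :: ('u, 'u) tgrpd) \<tau> \<sigma> \<alpha>1 \<alpha>2 \<beta>1 \<beta>2.
            crossed_extension \<GG>1 \<GG>2 M \<tau> \<sigma> \<alpha>1 \<alpha>2 \<beta>1 \<beta>2 \<and>
            essentially_surjective (Obj M) \<tau> (Grpd \<GG>1) \<and>
            essentially_surjective (Obj M) \<sigma> (Grpd \<GG>2))
         \<longleftrightarrow> morita_equivalent \<GG>1 \<GG>2"
proof -
  have "(card_of (UNIV \<times> UNIV :: ('u \<times> 'u) set), card_of (UNIV :: 'u set)) \<in> ordLeq"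
    using card_of_Times_same_infinite[OF assms(1)] by (rule ordIso_imp_ordLeq)
  then obtain e :: "'u \<times> 'u \<Rightarrow> 'u" where e: "inj e"
    unfolding card_of_ordLeq[symmetric] by auto
  show ?thesis
    using crossed_extension_imp_morita[OF assms(2,3) e] morita_equivalent_linking[OF _ e]
      linking_imp_crossed_extension[OF assms(2,3) e] by blast
qed

end
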